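(* Let $p$ be an odd prime, let $E/\mathbb{Q}_p$ be an elliptic curve given by a Weierstrass equation with coefficients in $\mathbb{Z}_p$, and let $\mathbf{P}=(P_1,P_2)\in E(\mathbb{Q}_p)^2$ be such that the reduction of $P_1$ modulo $p$ has order $r>3$, and $P_2,\ P_2\pm P_1\not\equiv\mathcal{O}\pmod p$. Suppose that $p\nmid r$. Let $(\Psi_n(\mathbf{P}))_{n\ge1}$, $(\Phi_n(\mathbf{P}))_{n\ge1}$ and $(\overline{\Omega}_n(\mathbf{P}))_{n\ge1}$ be the sequences of values of the translated division polynomials of $E$ at $\mathbf{P}$. Then there exists a power $q=p^N$ ($N\ge1$) such that for all $m\ge1$ the limits $$\lim_{i\to\infty}\Psi_{mq^i}(\mathbf{P}),\qquad \lim_{i\to\infty}\Phi_{mq^i}(\mathbf{P}),\qquad \lim_{i\to\infty}\overline{\Omega}_{mq^i}(\mathbf{P})$$ exist in $\mathbb{Z}_p$.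
   Context: Reduction. A point $Q\in E(\mathbb{Q}_p)$ reduces to a point of the reduced cubic over $\mathbb{F}_p$, and $Q\equiv\mathcal{O}\pmod p$ means that it reduces to $\mathcal{O}$ (i.e. $Q=\mathcal{O}$ or $x(Q)\notin\mathbb{Z}_p$). "The reduction of $P_1$ has order $r$" means that it is a nonsingular point of the reduced cubic having order $r$ in the group of nonsingular points. Translated division polynomials. Let $f^*(x,y)=y^2+\alpha_1xy+\alpha_3y-x^3-\alpha_2x^2-\alpha_4x-\alpha_6$ and $R^*=\mathbb{Z}[\alpha_1,\alpha_2,\alpha_3,\alpha_4,\alpha_6][x_1,y_1,x_2,y_2][(x_1-x_2)^{-1}]/\langle f^*(x_1,y_1),f^*(x_2,y_2)\rangle$. Let $\beta_1=2y_1+\alpha_1x_1+\alpha_3$ and $\beta_2=3x_1^4+b_2x_1^3+3b_4x_1^2+3b_6x_1+b_8$ with $b_i$ the usual Weierstrass quantities attached to the $\alpha_i$. The elements $\Psi_n$ ($n\in\mathbb{Z}$) of the fraction field of $R^*$ are determined by $\Psi_{-1}=x_1-x_2$, $\Psi_0=\Psi_1=1$, $\Psi_2=2x_1+x_2-\left(\frac{y_2-y_1}{x_2-x_1}\right)^2-\alpha_1\frac{y_2-y_1}{x_2-x_1}+\alpha_2$, and $\Psi_{m+2}\Psi_{m-2}=\beta_1^2\Psi_{m+1}\Psi_{m-1}-\beta_2\Psi_m^2$ for all $m\in\mathbb{Z}$. Further $\Phi_n=x_1\Psi_n^2-\Psi_{n+1}\Psi_{n-1}$ and $\overline{\Omega}_n=\left(\Psi_{n-1}^2\Psi_{n+2}-\Psi_{n-2}\Psi_{n+1}^2-\beta_1\Psi_n(\alpha_1\Phi_n+\alpha_3\Psi_n^2)\right)/(2\beta_1)$.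 All of these lie in $R^*$. For $E/K$ with Weierstrass coefficients $a_i$ and $\mathbf{P}=(P_1,P_2)\in E(K)^2$ with $P_1,P_2,P_2\pm P_1\neq\mathcal{O}$, the values $\Psi_n(\mathbf{P}),\Phi_n(\mathbf{P}),\overline{\Omega}_n(\mathbf{P})\in K$ are the images under the ring homomorphism $R^*\to K$ with $\alpha_i\mapsto a_i$, $(x_i,y_i)\mapsto$ coordinates of $P_i$; when $[n]P_1+P_2\ne\mathcal{O}$ one has $[n]P_1+P_2=\left(\Phi_n(\mathbf{P})/\Psi_n(\mathbf{P})^2,\ \overline{\Omega}_n(\mathbf{P})/\Psi_n(\mathbf{P})^3\right)$. *)

theory Defs
  imports
    Complex_Main
    "HOL-Computational_Algebra.Computational_Algebra"
    "HOL-Library.Poly_Mapping"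
    "Berlekamp_Zassenhaus.Finite_Field"
begin

section \<open>The field of p-adic numbers\<close>

subsection \<open>The p-adic absolute value on the rationals\<close>

definition rat_pabs :: "nat \<Rightarrow> rat \<Rightarrow> real" where
  "rat_pabs p x =
     (if x = 0 then 0
      else real p powi (int (multiplicity (int p) (snd (quotient_of x)))
                        - int (multiplicity (int p) (fst (quotient_of x)))))"

lemma rat_pabs_0 [simp]: "rat_pabs p 0 = 0"
  by (simp add: rat_pabs_def)

lemma rat_pabs_fraction:
  fixes a b :: int
  assumes p: "prime p" and a: "a \<noteq> 0" and b: "b \<noteq> 0"
  shows "rat_pabs p (of_int a / of_int b) =
           real p powi (int (multiplicity (int p) b) - int (multiplicity (int p) a))"
proof -
  define x where "x = (of_int a / of_int b :: rat)"
  obtain c d where cd: "quotient_of x = (c, d)" by (cases "quotient_of x")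
  have d: "d > 0" and x: "x = of_int c / of_int d"
    using quotient_of_denom_pos[OF cd] quotient_of_div[OF cd] by auto
  have x0: "x \<noteq> 0" using a b by (simp add: x_def)
  hence c: "c \<noteq> 0" using x by auto
  have "(of_int (a * d) :: rat) = of_int (c * b)"
    using x b d by (simp add: x_def field_simps)
  hence eq: "a * d = c * b" by (simp only: of_int_eq_iff)
  have pi: "prime_elem (int p)" using p by simp
  have "multiplicity (int p) a + multiplicity (int p) d
      = multiplicity (int p) c + multiplicity (int p) b"
    using a b c d arg_cong[OF eq, of "multiplicity (int p)"]
    by (simp add: prime_elem_multiplicity_mult_distrib[OF pi])
  hence "int (multiplicity (int p) d) - int (multiplicity (int p) c)
       = int (multiplicity (int p) b) - int (multiplicity (int p) a)" by linarith
  thus ?thesis using x0 by (simp add: rat_pabs_def cd flip: x_def)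
qed

lemma rat_pabs_eq_0_iff [simp]: "prime p \<Longrightarrow> rat_pabs p x = 0 \<longleftrightarrow> x = 0"
  by (auto simp: rat_pabs_def power_int_eq_0_iff prime_gt_0_nat)

lemma rat_pabs_nonneg [simp]: "rat_pabs p x \<ge> 0"
  by (simp add: rat_pabs_def)

lemma rat_fraction_cases:
  fixes x :: rat
  obtains a b :: int where "b \<noteq> 0" "x = of_int a / of_int b"
proof -
  obtain c d where cd: "quotient_of x = (c, d)" by (cases "quotient_of x")
  show ?thesis
    using that[of d c] quotient_of_denom_pos[OF cd] quotient_of_div[OF cd] by auto
qed

lemma rat_pabs_mult:
  assumes p: "prime p"
  shows "rat_pabs p (x * y) = rat_pabs p x * rat_pabs p y"
proof (cases "x = 0 \<or> y = 0")
  case False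
  obtain a b where ab: "b \<noteq> 0" "x = of_int a / of_int b" by (rule rat_fraction_cases)
  obtain c d where cd: "d \<noteq> 0" "y = of_int c / of_int d" by (rule rat_fraction_cases)
  have ac: "a \<noteq> 0" "c \<noteq> 0" using False ab cd by auto
  have xy: "x * y = of_int (a * c) / of_int (b * d)" using ab cd by simp
  have pi: "prime_elem (int p)" using p by simp
  have p0: "real p \<noteq> 0" using p by (auto simp: prime_gt_0_nat)
  have "rat_pabs p (x * y) = real p powi
         ((int (multiplicity (int p) b) - int (multiplicity (int p) a))
        + (int (multiplicity (int p) d) - int (multiplicity (int p) c)))"
    unfolding xy using ab(1) cd(1) ac
    by (subst rat_pabs_fraction[OF p])
       (simp_all add: prime_elem_multiplicity_mult_distrib[OF pi] algebra_simps)
  also have "\<dots> = rat_pabs p x * rat_pabs p y"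
    unfolding ab(2) cd(2) using ab(1) cd(1) ac p0
    by (simp add: rat_pabs_fraction[OF p] power_int_add)
  finally show ?thesis .
qed auto

lemma rat_pabs_minus [simp]:
  assumes p: "prime p"
  shows "rat_pabs p (- x) = rat_pabs p x"
proof (cases "x = 0")
  case False
  obtain a b where ab: "b \<noteq> 0" "x = of_int a / of_int b" by (rule rat_fraction_cases)
  have "a \<noteq> 0" using ab False by auto
  hence "rat_pabs p (of_int (- a) / of_int b) = rat_pabs p (of_int a / of_int b)"
    using ab(1) by (subst (1 2) rat_pabs_fraction[OF p]) simp_all
  thus ?thesis using ab by simp
qed auto

lemma rat_pabs_diff_commute: "prime p \<Longrightarrow> rat_pabs p (x - y) = rat_pabs p (y - x)"
  using rat_pabs_minus[of p "x - y"] by simp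

lemma rat_pabs_of_int:
  assumes "prime p" "k \<noteq> 0"
  shows "rat_pabs p (of_int k) = real p powi (- int (multiplicity (int p) k))"
  using rat_pabs_fraction[of p k 1] assms by simp

lemma rat_pabs_1 [simp]: "prime p \<Longrightarrow> rat_pabs p 1 = 1"
  using rat_pabs_of_int[of p 1] by simp

lemma rat_pabs_ultrametric:
  assumes p: "prime p"
  shows "rat_pabs p (x + y) \<le> max (rat_pabs p x) (rat_pabs p y)"
proof (cases "x = 0 \<or> y = 0 \<or> x + y = 0")
  case False
  obtain a b where ab: "b \<noteq> 0" "x = of_int a / of_int b" by (rule rat_fraction_cases)
  obtain c d where cd: "d \<noteq> 0" "y = of_int c / of_int d" by (rule rat_fraction_cases)
  define A C B where "A = a * d" and "C = c * b" and "B = b * d"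
  have B: "B \<noteq> 0" and x: "x = of_int A / of_int B" and y: "y = of_int C / of_int B"
    and xy: "x + y = of_int (A + C) / of_int B"
    using ab cd by (auto simp: A_def B_def C_def field_simps)
  have nz: "A \<noteq> 0" "C \<noteq> 0" "A + C \<noteq> 0"
    using False x y xy by auto
  let ?m = "multiplicity (int p)"
  have "int p ^ min (?m A) (?m C) dvd A + C"
    by (intro dvd_add; rule dvd_trans[OF le_imp_power_dvd multiplicity_dvd]) auto
  hence le: "min (?m A) (?m C) \<le> ?m (A + C)"
    using nz p by (intro multiplicity_geI) (auto simp: zdvd1_eq dest: prime_gt_1_nat)
  have p1: "real p \<ge> 1" using prime_gt_0_nat[OF p] by simp
  have mono: "real p powi i \<le> real p powi j" if "i \<le> j" for i j
    using that p1 by (rule power_int_increasing)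
  have "rat_pabs p (x + y) = real p powi (int (?m B) - int (?m (A + C)))"
    unfolding xy by (rule rat_pabs_fraction[OF p nz(3) B])
  also have "\<dots> \<le> real p powi (int (?m B) - int (min (?m A) (?m C)))"
    using le by (intro mono) auto
  also have "\<dots> \<le> max (real p powi (int (?m B) - int (?m A))) (real p powi (int (?m B) - int (?m C)))"
    by (cases "?m A \<le> ?m C") (auto simp: min_def)
  also have "\<dots> = max (rat_pabs p x) (rat_pabs p y)"
    unfolding x y by (simp add: rat_pabs_fraction[OF p] nz B)
  finally show ?thesis .
qed (auto simp: max_def)

lemma rat_pabs_triangle:
  assumes p: "prime p"
  shows "rat_pabs p (x + y) \<le> rat_pabs p x + rat_pabs p y"
  using rat_pabs_ultrametric[OF p, of x y] rat_pabs_nonneg[of p x] rat_pabs_nonneg[of p y]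
  by linarith

lemma rat_pabs_diff_le:
  assumes p: "prime p"
  shows "\<bar>rat_pabs p x - rat_pabs p y\<bar> \<le> rat_pabs p (x - y)"
  using rat_pabs_triangle[OF p, of "x - y" y] rat_pabs_triangle[OF p, of "y - x" x]
    rat_pabs_diff_commute[OF p, of x y] by auto

lemma rat_pabs_inverse:
  assumes p: "prime p"
  shows "rat_pabs p (inverse x) = inverse (rat_pabs p x)"
proof (cases "x = 0")
  case False
  hence "rat_pabs p x * rat_pabs p (inverse x) = 1"
    by (simp add: p flip: rat_pabs_mult)
  thus ?thesis by (metis inverse_unique)
qed auto


subsection \<open>The completion\<close>

definition pcauchy :: "nat \<Rightarrow> (nat \<Rightarrow> rat) \<Rightarrow> bool" where
  "pcauchy p X \<longleftrightarrow> (\<forall>e>0. \<exists>M. \<forall>m\<ge>M. \<forall>n\<ge>M. rat_pabs p (X m - X n) < e)"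

definition pvanishes :: "nat \<Rightarrow> (nat \<Rightarrow> rat) \<Rightarrow> bool" where
  "pvanishes p X \<longleftrightarrow> (\<lambda>n. rat_pabs p (X n)) \<longlonglongrightarrow> 0"

lemma pcauchy_const [simp]: "pcauchy p (\<lambda>_. c)"
  by (auto simp: pcauchy_def)

lemma pvanishes_0 [simp]: "pvanishes p (\<lambda>_. 0)"
  by (simp add: pvanishes_def)

lemma pvanishes_squeeze:
  assumes "f \<longlonglongrightarrow> 0" "\<And>n. rat_pabs p (X n) \<le> f n"
  shows "pvanishes p X"
  unfolding pvanishes_def
  by (rule tendsto_sandwich[OF _ _ tendsto_const assms(1)]) (use assms(2) in auto)

lemma pvanishes_add:
  assumes "prime p" "pvanishes p X" "pvanishes p Y"
  shows "pvanishes p (\<lambda>n. X n + Y n)"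
  by (rule pvanishes_squeeze[where f = "\<lambda>n. rat_pabs p (X n) + rat_pabs p (Y n)"])
     (use assms tendsto_add[of "\<lambda>n. rat_pabs p (X n)" 0 _ "\<lambda>n. rat_pabs p (Y n)" 0]
       in \<open>auto simp: pvanishes_def rat_pabs_triangle\<close>)

lemma pvanishes_minus: "prime p \<Longrightarrow> pvanishes p X \<Longrightarrow> pvanishes p (\<lambda>n. - X n)"
  by (simp add: pvanishes_def)

lemma pcauchy_add:
  assumes p: "prime p" and X: "pcauchy p X" and Y: "pcauchy p Y"
  shows "pcauchy p (\<lambda>n. X n + Y n)"
  unfolding pcauchy_def
proof (intro allI impI)
  fix e :: real assume e: "e > 0"
  obtain M where M: "\<And>m n. m \<ge> M \<Longrightarrow> n \<ge> M \<Longrightarrow> rat_pabs p (X m - X n) < e"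
    using X e unfolding pcauchy_def by metis
  obtain N where N: "\<And>m n. m \<ge> N \<Longrightarrow> n \<ge> N \<Longrightarrow> rat_pabs p (Y m - Y n) < e"
    using Y e unfolding pcauchy_def by metis
  have "rat_pabs p ((X m + Y m) - (X n + Y n)) < e" if "m \<ge> max M N" "n \<ge> max M N" for m n
    using rat_pabs_ultrametric[OF p, of "X m - X n" "Y m - Y n"] M[of m n] N[of m n] that
    by (simp add: algebra_simps)
  thus "\<exists>M. \<forall>m\<ge>M. \<forall>n\<ge>M. rat_pabs p ((X m + Y m) - (X n + Y n)) < e" by blast
qed

lemma pcauchy_minus:
  assumes "prime p" "pcauchy p X"
  shows "pcauchy p (\<lambda>n. - X n)"
proof -
  have "rat_pabs p (- X m - - X n) = rat_pabs p (X m - X n)" for m n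
    using rat_pabs_minus[OF assms(1), of "X m - X n"] by (simp add: algebra_simps)
  thus ?thesis using assms(2) unfolding pcauchy_def by simp
qed

lemma pcauchy_imp_convergent:
  assumes p: "prime p" and X: "pcauchy p X"
  shows "convergent (\<lambda>n. rat_pabs p (X n))"
proof -
  have "Cauchy (\<lambda>n. rat_pabs p (X n))"
  proof (rule metric_CauchyI)
    fix e :: real assume "e > 0"
    then obtain M where M: "\<And>m n. m \<ge> M \<Longrightarrow> n \<ge> M \<Longrightarrow> rat_pabs p (X m - X n) < e"
      using X unfolding pcauchy_def by metis
    have "dist (rat_pabs p (X m)) (rat_pabs p (X n)) < e" if "m \<ge> M" "n \<ge> M" for m n
      using rat_pabs_diff_le[OF p, of "X m" "X n"] M[OF that] by (simp add: dist_real_def)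
    thus "\<exists>M. \<forall>m\<ge>M. \<forall>n\<ge>M. dist (rat_pabs p (X m)) (rat_pabs p (X n)) < e" by blast
  qed
  thus ?thesis by (simp add: Cauchy_convergent_iff)
qed

lemma pcauchy_bounded:
  assumes p: "prime p" and X: "pcauchy p X"
  obtains B where "B > 0" "\<And>n. rat_pabs p (X n) \<le> B"
proof -
  have "Bseq (\<lambda>n. rat_pabs p (X n))"
    using pcauchy_imp_convergent[OF p X] by (rule convergent_imp_Bseq)
  then obtain B where "B > 0" "\<forall>n. norm (rat_pabs p (X n)) \<le> B" by (auto simp: Bseq_def)
  thus ?thesis by (intro that[of B]) auto
qed

lemma pvanishes_mult:
  assumes p: "prime p" and X: "pcauchy p X" and Y: "pvanishes p Y"
  shows "pvanishes p (\<lambda>n. X n * Y n)"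
proof -
  obtain B where B: "B > 0" "\<And>n. rat_pabs p (X n) \<le> B" by (rule pcauchy_bounded[OF p X]) blast
  show ?thesis
    by (rule pvanishes_squeeze[where f = "\<lambda>n. B * rat_pabs p (Y n)"])
       (use Y B tendsto_mult[OF tendsto_const, of "\<lambda>n. rat_pabs p (Y n)" 0 _ B] in
         \<open>auto simp: pvanishes_def rat_pabs_mult[OF p] mult_right_mono\<close>)
qed

lemma pcauchy_mult:
  assumes p: "prime p" and X: "pcauchy p X" and Y: "pcauchy p Y"
  shows "pcauchy p (\<lambda>n. X n * Y n)"
  unfolding pcauchy_def
proof (intro allI impI)
  fix e :: real assume e: "e > 0"
  obtain A where A: "A > 0" "\<And>n. rat_pabs p (X n) \<le> A" by (rule pcauchy_bounded[OF p X]) blast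
  obtain B where B: "B > 0" "\<And>n. rat_pabs p (Y n) \<le> B" by (rule pcauchy_bounded[OF p Y]) blast
  obtain M where M: "\<And>m n. m \<ge> M \<Longrightarrow> n \<ge> M \<Longrightarrow> rat_pabs p (X m - X n) < e / B"
    using X e B(1) unfolding pcauchy_def by (metis divide_pos_pos)
  obtain N where N: "\<And>m n. m \<ge> N \<Longrightarrow> n \<ge> N \<Longrightarrow> rat_pabs p (Y m - Y n) < e / A"
    using Y e A(1) unfolding pcauchy_def by (metis divide_pos_pos)
  have "rat_pabs p (X m * Y m - X n * Y n) < e" if mn: "m \<ge> max M N" "n \<ge> max M N" for m n
  proof -
    have "rat_pabs p (X m * (Y m - Y n)) \<le> A * rat_pabs p (Y m - Y n)"
      using A by (simp add: rat_pabs_mult[OF p] mult_right_mono)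
    also have "\<dots> < A * (e / A)" using A N[of m n] mn by (intro mult_strict_left_mono) auto
    finally have 1: "rat_pabs p (X m * (Y m - Y n)) < e" using A by simp
    have "rat_pabs p ((X m - X n) * Y n) \<le> rat_pabs p (X m - X n) * B"
      using B by (simp add: rat_pabs_mult[OF p] mult_left_mono)
    also have "\<dots> < (e / B) * B" using B M[of m n] mn by (intro mult_strict_right_mono) auto
    finally have 2: "rat_pabs p ((X m - X n) * Y n) < e" using B by simp
    show ?thesis
      using rat_pabs_ultrametric[OF p, of "X m * (Y m - Y n)" "(X m - X n) * Y n"] 1 2
      by (simp add: algebra_simps)
  qed
  thus "\<exists>M. \<forall>m\<ge>M. \<forall>n\<ge>M. rat_pabs p (X m * Y m - X n * Y n) < e" by blast
qed

lemma pcauchy_not_pvanishes: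
  assumes p: "prime p" and X: "pcauchy p X" and nz: "\<not> pvanishes p X"
  obtains c M where "c > 0" "\<And>n. n \<ge> M \<Longrightarrow> rat_pabs p (X n) > c"
proof -
  obtain L where L: "(\<lambda>n. rat_pabs p (X n)) \<longlonglongrightarrow> L"
    using pcauchy_imp_convergent[OF p X] by (auto simp: convergent_def)
  have "L \<ge> 0" by (rule LIMSEQ_le_const[OF L]) auto
  moreover have "L \<noteq> 0" using nz L by (auto simp: pvanishes_def)
  ultimately have "L / 2 < L" "L / 2 > 0" by auto
  from order_tendstoD(1)[OF L this(1)] obtain M where "\<forall>n\<ge>M. L / 2 < rat_pabs p (X n)"
    by (auto simp: eventually_sequentially)
  thus ?thesis using that[of "L / 2" M] \<open>L / 2 > 0\<close> by simp
qed

lemma pcauchy_inverse: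
  assumes p: "prime p" and X: "pcauchy p X" and nz: "\<not> pvanishes p X"
  shows "pcauchy p (\<lambda>n. inverse (X n))"
  unfolding pcauchy_def
proof (intro allI impI)
  fix e :: real assume e: "e > 0"
  obtain c N where c: "c > 0" and N: "\<And>n. n \<ge> N \<Longrightarrow> rat_pabs p (X n) > c"
    by (rule pcauchy_not_pvanishes[OF p X nz]) blast
  obtain M where M: "\<And>m n. m \<ge> M \<Longrightarrow> n \<ge> M \<Longrightarrow> rat_pabs p (X m - X n) < c * e * c"
    using X e c unfolding pcauchy_def by (metis mult_pos_pos)
  have "rat_pabs p (inverse (X m) - inverse (X n)) < e" if mn: "m \<ge> max M N" "n \<ge> max M N" for m n
  proof -
    have c': "rat_pabs p (X m) > c" "rat_pabs p (X n) > c" using N mn by auto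
    hence nz: "X m \<noteq> 0" "X n \<noteq> 0" using c by auto
    hence "inverse (X m) - inverse (X n) = inverse (X m) * (X n - X m) * inverse (X n)"
      by (simp add: field_simps)
    hence "rat_pabs p (inverse (X m) - inverse (X n))
        = inverse (rat_pabs p (X m)) * rat_pabs p (X m - X n) * inverse (rat_pabs p (X n))"
      by (simp add: rat_pabs_mult[OF p] rat_pabs_inverse[OF p] rat_pabs_diff_commute[OF p, of "X n"])
    also have "\<dots> \<le> inverse c * rat_pabs p (X m - X n) * inverse c"
      using c c' by (intro mult_mono) (auto intro: le_imp_inverse_le)
    also have "\<dots> < inverse c * (c * e * c) * inverse c"
      using c M[of m n] mn by (intro mult_strict_right_mono mult_strict_left_mono) auto
    finally show ?thesis using c by (simp add: field_simps)
  qed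
  thus "\<exists>M. \<forall>m\<ge>M. \<forall>n\<ge>M. rat_pabs p (inverse (X m) - inverse (X n)) < e" by blast
qed

definition padic_rel :: "'p itself \<Rightarrow> (nat \<Rightarrow> rat) \<Rightarrow> (nat \<Rightarrow> rat) \<Rightarrow> bool" where
  "padic_rel _ X Y \<longleftrightarrow>
     pcauchy CARD('p) X \<and> pcauchy CARD('p) Y \<and> pvanishes CARD('p) (\<lambda>n. X n - Y n)"

lemma part_equivp_padic_rel: "part_equivp (padic_rel TYPE('p :: prime_card))"
proof (rule part_equivpI)
  have p: "prime CARD('p)" by (rule prime_card)
  show "\<exists>X. padic_rel TYPE('p) X X"
    by (rule exI[of _ "\<lambda>_. 0"]) (simp add: padic_rel_def)
  show "symp (padic_rel TYPE('p))"
    by (rule sympI) (auto simp: padic_rel_def pvanishes_def rat_pabs_diff_commute[OF p])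
  show "transp (padic_rel TYPE('p))"
  proof (rule transpI)
    fix X Y Z assume "padic_rel TYPE('p) X Y" "padic_rel TYPE('p) Y Z"
    thus "padic_rel TYPE('p) X Z"
      using pvanishes_add[OF p, of "\<lambda>n. X n - Y n" "\<lambda>n. Y n - Z n"] by (auto simp: padic_rel_def)
  qed
qed

text \<open>
  The prime \<open>p\<close> is the cardinality of the type parameter, so \<open>'p padic\<close> is the
  completion of the rationals with respect to the \<open>CARD('p)\<close>-adic absolute value.
  The carrier consists of the equivalence classes of p-adic Cauchy sequences of rationals.
\<close>

typedef ('p :: prime_card) padic =
  "{C. \<exists>X. padic_rel TYPE('p :: prime_card) X X \<and> C = Collect (padic_rel TYPE('p) X)}"
  using part_equivp_padic_rel[where ?'p = 'p] unfolding part_equivp_def by blast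

definition abs_padic :: "(nat \<Rightarrow> rat) \<Rightarrow> 'p :: prime_card padic" where
  "abs_padic X = Abs_padic (Collect (padic_rel TYPE('p) X))"

definition rep_padic :: "'p :: prime_card padic \<Rightarrow> nat \<Rightarrow> rat" where
  "rep_padic x = (SOME X. X \<in> Rep_padic x)"

definition cr_padic :: "(nat \<Rightarrow> rat) \<Rightarrow> 'p :: prime_card padic \<Rightarrow> bool" where
  "cr_padic \<equiv> \<lambda>X x. padic_rel TYPE('p) X X \<and> abs_padic X = x"

lemma Quotient3_padic:
  "Quotient3 (padic_rel TYPE('p :: prime_card)) abs_padic (rep_padic :: 'p padic \<Rightarrow> _)"
proof -
  interpret quot_type "padic_rel TYPE('p)" Abs_padic "Rep_padic :: 'p padic \<Rightarrow> _"
    by standard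
       (use Rep_padic in \<open>auto simp: part_equivp_padic_rel Rep_padic_inverse Rep_padic_inject
          intro!: Abs_padic_inverse\<close>)
  have "abs = (abs_padic :: _ \<Rightarrow> 'p padic)" "rep = (rep_padic :: 'p padic \<Rightarrow> _)"
    by (auto simp: abs_def abs_padic_def rep_def rep_padic_def)
  thus ?thesis using Quotient by simp
qed

lemma Quotient_padic:
  "Quotient (padic_rel TYPE('p :: prime_card)) abs_padic (rep_padic :: 'p padic \<Rightarrow> _) cr_padic"
  by (rule Quotient3_to_Quotient[OF Quotient3_padic cr_padic_def])

setup_lifting Quotient_padic

instantiation padic :: (prime_card) field
begin

lift_definition zero_padic :: "'a padic" is "\<lambda>_. 0"
  by (simp add: padic_rel_def)

lift_definition one_padic :: "'a padic" is "\<lambda>_. 1"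
  by (simp add: padic_rel_def)

lift_definition plus_padic :: "'a padic \<Rightarrow> 'a padic \<Rightarrow> 'a padic" is "\<lambda>X Y n. X n + Y n"
proof -
  fix X X' Y Y' assume *: "padic_rel TYPE('a) X X'" "padic_rel TYPE('a) Y Y'"
  have "pvanishes CARD('a) (\<lambda>n. (X n - X' n) + (Y n - Y' n))"
    by (rule pvanishes_add) (use * in \<open>auto simp: padic_rel_def prime_card\<close>)
  thus "padic_rel TYPE('a) (\<lambda>n. X n + Y n) (\<lambda>n. X' n + Y' n)"
    using * by (simp add: padic_rel_def pcauchy_add prime_card algebra_simps)
qed

lift_definition uminus_padic :: "'a padic \<Rightarrow> 'a padic" is "\<lambda>X n. - X n"
proof -
  fix X X' assume *: "padic_rel TYPE('a) X X'"
  have "pvanishes CARD('a) (\<lambda>n. - (X n - X' n))"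
    by (rule pvanishes_minus) (use * in \<open>auto simp: padic_rel_def prime_card\<close>)
  thus "padic_rel TYPE('a) (\<lambda>n. - X n) (\<lambda>n. - X' n)"
    using * by (simp add: padic_rel_def pcauchy_minus prime_card algebra_simps)
qed

lift_definition times_padic :: "'a padic \<Rightarrow> 'a padic \<Rightarrow> 'a padic" is "\<lambda>X Y n. X n * Y n"
proof -
  fix X X' Y Y' assume *: "padic_rel TYPE('a) X X'" "padic_rel TYPE('a) Y Y'"
  have "pvanishes CARD('a) (\<lambda>n. X n * (Y n - Y' n) + Y' n * (X n - X' n))"
    by (intro pvanishes_add pvanishes_mult) (use * in \<open>auto simp: padic_rel_def prime_card\<close>)
  thus "padic_rel TYPE('a) (\<lambda>n. X n * Y n) (\<lambda>n. X' n * Y' n)"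
    using * by (simp add: padic_rel_def pcauchy_mult prime_card algebra_simps)
qed

lift_definition inverse_padic :: "'a padic \<Rightarrow> 'a padic"
  is "\<lambda>X. if pvanishes CARD('a) X then (\<lambda>_. 0) else (\<lambda>n. inverse (X n))"
proof -
  fix X Y assume *: "padic_rel TYPE('a) X Y"
  have p: "prime CARD('a)" by (rule prime_card)
  have X: "pcauchy CARD('a) X" and Y: "pcauchy CARD('a) Y"
    and XY: "pvanishes CARD('a) (\<lambda>n. X n - Y n)"
    using * by (auto simp: padic_rel_def)
  have YX: "pvanishes CARD('a) (\<lambda>n. Y n - X n)"
    using XY by (simp add: pvanishes_def rat_pabs_diff_commute[OF p])
  have iff: "pvanishes CARD('a) X \<longleftrightarrow> pvanishes CARD('a) Y"
    using pvanishes_add[OF p XY, of Y] pvanishes_add[OF p YX, of X] by auto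
  show "padic_rel TYPE('a)
     (if pvanishes CARD('a) X then (\<lambda>_. 0) else (\<lambda>n. inverse (X n)))
     (if pvanishes CARD('a) Y then (\<lambda>_. 0) else (\<lambda>n. inverse (Y n)))"
  proof (cases "pvanishes CARD('a) X")
    case True
    thus ?thesis using iff by (simp add: padic_rel_def)
  next
    case False
    hence nX: "\<not> pvanishes CARD('a) X" and nY: "\<not> pvanishes CARD('a) Y" using iff by auto
    obtain c M where c: "c > 0" "\<And>n. n \<ge> M \<Longrightarrow> rat_pabs CARD('a) (X n) > c"
      by (rule pcauchy_not_pvanishes[OF p X nX]) blast
    obtain d N where d: "d > 0" "\<And>n. n \<ge> N \<Longrightarrow> rat_pabs CARD('a) (Y n) > d"
      by (rule pcauchy_not_pvanishes[OF p Y nY]) blast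
    have iX: "pcauchy CARD('a) (\<lambda>n. inverse (X n))" and iY: "pcauchy CARD('a) (\<lambda>n. inverse (Y n))"
      using pcauchy_inverse[OF p] X Y nX nY by auto
    have van: "pvanishes CARD('a) (\<lambda>n. (inverse (X n) * inverse (Y n)) * (Y n - X n))"
      by (intro pvanishes_mult pcauchy_mult p iX iY YX)
    have "eventually (\<lambda>n. rat_pabs CARD('a) ((inverse (X n) * inverse (Y n)) * (Y n - X n))
             = rat_pabs CARD('a) (inverse (X n) - inverse (Y n))) sequentially"
      using eventually_ge_at_top[of "max M N"]
    proof eventually_elim
      case (elim n)
      hence "X n \<noteq> 0" "Y n \<noteq> 0" using c(2)[of n] d(2)[of n] c(1) d(1) by auto
      thus ?case by (simp add: field_simps)
    qed
    hence "pvanishes CARD('a) (\<lambda>n. inverse (X n) - inverse (Y n))"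
      using van unfolding pvanishes_def by (rule Lim_transform_eventually[rotated])
    thus ?thesis using nX nY iX iY by (simp add: padic_rel_def)
  qed
qed

definition minus_padic :: "'a padic \<Rightarrow> 'a padic \<Rightarrow> 'a padic" where
  "minus_padic x y = x + - y"

definition divide_padic :: "'a padic \<Rightarrow> 'a padic \<Rightarrow> 'a padic" where
  "divide_padic x y = x * inverse y"

instance
proof
  have p: "prime CARD('a)" by (rule prime_card)
  fix a b c :: "'a padic"
  show "a + b + c = a + (b + c)"
    by transfer (auto simp: padic_rel_def add_ac intro!: pcauchy_add prime_card)
  show "a + b = b + a"
    by transfer (auto simp: padic_rel_def add_ac intro!: pcauchy_add prime_card)
  show "0 + a = a" by transfer (auto simp: padic_rel_def)
  show "- a + a = 0" by transfer (auto simp: padic_rel_def)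
  show "a - b = a + - b" by (simp add: minus_padic_def)
  show "a * b * c = a * (b * c)"
    by transfer (auto simp: padic_rel_def mult_ac intro!: pcauchy_mult prime_card)
  show "a * b = b * a"
    by transfer (auto simp: padic_rel_def mult_ac intro!: pcauchy_mult prime_card)
  show "1 * a = a" by transfer (auto simp: padic_rel_def)
  show "(a + b) * c = a * c + b * c"
    by transfer (auto simp: padic_rel_def algebra_simps intro!: pcauchy_mult pcauchy_add prime_card)
  show "(0 :: 'a padic) \<noteq> 1"
    by transfer (simp add: padic_rel_def pvanishes_def prime_card LIMSEQ_const_iff)
  show "inverse a * a = 1" if "a \<noteq> 0"
    using that
  proof transfer
    fix X assume "padic_rel TYPE('a) X X" and nz: "\<not> padic_rel TYPE('a) X (\<lambda>_. 0)"
    hence X: "pcauchy CARD('a) X" and nv: "\<not> pvanishes CARD('a) X" by (auto simp: padic_rel_def)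
    obtain c M where c: "c > 0" "\<And>n. n \<ge> M \<Longrightarrow> rat_pabs CARD('a) (X n) > c"
      by (rule pcauchy_not_pvanishes[OF p X nv]) blast
    have "eventually (\<lambda>n. 0 = rat_pabs CARD('a) (inverse (X n) * X n - 1)) sequentially"
      using eventually_ge_at_top[of M]
    proof eventually_elim
      case (elim n)
      hence "X n \<noteq> 0" using c(2)[of n] c(1) by auto
      thus ?case by simp
    qed
    hence "pvanishes CARD('a) (\<lambda>n. inverse (X n) * X n - 1)"
      unfolding pvanishes_def by (rule Lim_transform_eventually[OF tendsto_const])
    thus "padic_rel TYPE('a)
       (\<lambda>n. (if pvanishes CARD('a) X then \<lambda>_. 0 else (\<lambda>n. inverse (X n))) n * X n) (\<lambda>_. 1)"
      using nv X by (auto simp: padic_rel_def intro!: pcauchy_mult pcauchy_inverse p)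
  qed
  show "a div b = a * inverse b" by (simp add: divide_padic_def)
  show "inverse (0 :: 'a padic) = 0" by transfer (simp add: padic_rel_def)
qed

end

lemma padic_cases:
  fixes x :: "'p :: prime_card padic"
  obtains X where "x = abs_padic X" "pcauchy CARD('p) X"
  by (metis Quotient3_abs_rep Quotient3_padic Quotient3_rep_reflp padic_rel_def)

lemma padic_rel_refl: "padic_rel TYPE('p) X X \<longleftrightarrow> pcauchy CARD('p) X"
  by (simp add: padic_rel_def)

lemma plus_abs_padic:
  "pcauchy CARD('p :: prime_card) X \<Longrightarrow> pcauchy CARD('p) Y \<Longrightarrow>
     (abs_padic X + abs_padic Y :: 'p padic) = abs_padic (\<lambda>n. X n + Y n)"
  by (simp add: plus_padic.abs_eq padic_rel_refl)

lemma times_abs_padic: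
  "pcauchy CARD('p :: prime_card) X \<Longrightarrow> pcauchy CARD('p) Y \<Longrightarrow>
     (abs_padic X * abs_padic Y :: 'p padic) = abs_padic (\<lambda>n. X n * Y n)"
  by (simp add: times_padic.abs_eq padic_rel_refl)

lemma uminus_abs_padic:
  "pcauchy CARD('p :: prime_card) X \<Longrightarrow> (- abs_padic X :: 'p padic) = abs_padic (\<lambda>n. - X n)"
  by (simp add: uminus_padic.abs_eq padic_rel_refl)

lift_definition padic_abs :: "'a :: prime_card padic \<Rightarrow> real" is "\<lambda>X. lim (\<lambda>n. rat_pabs CARD('a) (X n))"
proof -
  fix X Y assume *: "padic_rel TYPE('a) X Y"
  have p: "prime CARD('a)" by (rule prime_card)
  obtain L where L: "(\<lambda>n. rat_pabs CARD('a) (X n)) \<longlonglongrightarrow> L"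
    using pcauchy_imp_convergent[OF p, of X] * by (auto simp: convergent_def padic_rel_def)
  have "(\<lambda>n. rat_pabs CARD('a) (X n) - rat_pabs CARD('a) (Y n)) \<longlonglongrightarrow> 0"
    by (rule tendsto_0_le[of "\<lambda>n. rat_pabs CARD('a) (X n - Y n)" _ _ 1])
       (use * rat_pabs_diff_le[OF p] in \<open>auto simp: padic_rel_def pvanishes_def\<close>)
  from tendsto_diff[OF L this] have "(\<lambda>n. rat_pabs CARD('a) (Y n)) \<longlonglongrightarrow> L" by simp
  with L show "lim (\<lambda>n. rat_pabs CARD('a) (X n)) = lim (\<lambda>n. rat_pabs CARD('a) (Y n))"
    by (metis limI)
qed

lemma abs_padic_LIMSEQ:
  assumes "pcauchy CARD('p :: prime_card) X"
  shows "(\<lambda>n. rat_pabs CARD('p) (X n)) \<longlonglongrightarrow> padic_abs (abs_padic X :: 'p padic)"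
  using pcauchy_imp_convergent[OF prime_card assms] assms
  by (simp add: padic_abs.abs_eq padic_rel_refl convergent_LIMSEQ_iff)

lemma padic_abs_ge_0 [simp]: "padic_abs (x :: 'p :: prime_card padic) \<ge> 0"
proof -
  obtain X where X: "x = abs_padic X" "pcauchy CARD('p) X" by (rule padic_cases)
  show ?thesis unfolding X(1) by (rule LIMSEQ_le_const[OF abs_padic_LIMSEQ[OF X(2)]]) auto
qed

lemma padic_abs_eq_0_iff [simp]: "padic_abs (x :: 'p :: prime_card padic) = 0 \<longleftrightarrow> x = 0"
proof -
  obtain X where X: "x = abs_padic X" "pcauchy CARD('p) X" by (rule padic_cases)
  have "padic_abs x = 0 \<longleftrightarrow> pvanishes CARD('p) X"
    unfolding pvanishes_def X(1) using abs_padic_LIMSEQ[OF X(2)] LIMSEQ_unique by metis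
  also have "\<dots> \<longleftrightarrow> padic_rel TYPE('p) X (\<lambda>_. 0)"
    using X(2) by (simp add: padic_rel_def)
  also have "\<dots> \<longleftrightarrow> x = 0"
    using Quotient3_rel[OF Quotient3_padic[where ?'p = 'p], of X "\<lambda>_. 0"] X(2)
    by (auto simp: X(1) zero_padic_def padic_rel_refl)
  finally show ?thesis .
qed

lemma padic_abs_mult: "padic_abs (x * y :: 'p :: prime_card padic) = padic_abs x * padic_abs y"
proof -
  obtain X where X: "x = abs_padic X" "pcauchy CARD('p) X" by (rule padic_cases)
  obtain Y where Y: "y = abs_padic Y" "pcauchy CARD('p) Y" by (rule padic_cases)
  have "(\<lambda>n. rat_pabs CARD('p) (X n * Y n)) \<longlonglongrightarrow> padic_abs (x * y)"
    unfolding X(1) Y(1) times_abs_padic[OF X(2) Y(2)]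
    by (rule abs_padic_LIMSEQ) (intro pcauchy_mult prime_card X Y)
  moreover have "(\<lambda>n. rat_pabs CARD('p) (X n * Y n)) \<longlonglongrightarrow> padic_abs x * padic_abs y"
    unfolding X(1) Y(1) rat_pabs_mult[OF prime_card]
    by (intro tendsto_mult abs_padic_LIMSEQ X Y)
  ultimately show ?thesis by (rule LIMSEQ_unique)
qed

lemma padic_abs_minus [simp]: "padic_abs (- x :: 'p :: prime_card padic) = padic_abs x"
proof -
  obtain X where X: "x = abs_padic X" "pcauchy CARD('p) X" by (rule padic_cases)
  have "(\<lambda>n. rat_pabs CARD('p) (- X n)) \<longlonglongrightarrow> padic_abs (- x)"
    unfolding X(1) uminus_abs_padic[OF X(2)]
    by (rule abs_padic_LIMSEQ) (intro pcauchy_minus prime_card X)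
  thus ?thesis
    using abs_padic_LIMSEQ[OF X(2)] unfolding X(1) rat_pabs_minus[OF prime_card]
    by (rule LIMSEQ_unique)
qed

lemma padic_abs_ultrametric:
  "padic_abs (x + y :: 'p :: prime_card padic) \<le> max (padic_abs x) (padic_abs y)"
proof -
  obtain X where X: "x = abs_padic X" "pcauchy CARD('p) X" by (rule padic_cases)
  obtain Y where Y: "y = abs_padic Y" "pcauchy CARD('p) Y" by (rule padic_cases)
  have "(\<lambda>n. rat_pabs CARD('p) (X n + Y n)) \<longlonglongrightarrow> padic_abs (x + y)"
    unfolding X(1) Y(1) plus_abs_padic[OF X(2) Y(2)]
    by (rule abs_padic_LIMSEQ) (intro pcauchy_add prime_card X Y)
  moreover have "(\<lambda>n. max (rat_pabs CARD('p) (X n)) (rat_pabs CARD('p) (Y n)))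
      \<longlonglongrightarrow> max (padic_abs x) (padic_abs y)"
    unfolding X(1) Y(1) by (intro tendsto_max abs_padic_LIMSEQ X Y)
  ultimately show ?thesis
    by (rule LIMSEQ_le) (auto intro!: rat_pabs_ultrametric prime_card)
qed

lemma abs_padic_of_nat: "abs_padic (\<lambda>_. of_nat k) = (of_nat k :: 'p :: prime_card padic)"
proof (induction k)
  case 0
  show ?case by (simp add: zero_padic_def)
next
  case (Suc k)
  have "(of_nat (Suc k) :: 'p padic) = 1 + abs_padic (\<lambda>_. of_nat k)" by (simp add: Suc)
  also have "\<dots> = abs_padic (\<lambda>_. of_nat (Suc k))"
    by (simp add: one_padic_def plus_abs_padic)
  finally show ?case ..
qed

lemma abs_padic_of_int: "abs_padic (\<lambda>_. of_int k) = (of_int k :: 'p :: prime_card padic)"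
proof (cases k rule: int_cases2)
  case (nonneg n)
  thus ?thesis using abs_padic_of_nat[of n, where ?'p = 'p] by simp
next
  case (nonpos n)
  thus ?thesis using abs_padic_of_nat[of n, where ?'p = 'p]
    uminus_abs_padic[of "\<lambda>_. of_nat n", where ?'p = 'p] by simp
qed

lemma padic_abs_of_int:
  "padic_abs (of_int k :: 'p :: prime_card padic) = rat_pabs CARD('p) (of_int k)"
  using abs_padic_LIMSEQ[of "\<lambda>_. of_int k", where ?'p = 'p]
  by (simp add: abs_padic_of_int LIMSEQ_const_iff)

instantiation padic :: (prime_card) metric_space
begin

definition dist_padic :: "'a padic \<Rightarrow> 'a padic \<Rightarrow> real" where
  "dist_padic x y = padic_abs (x - y)"

definition uniformity_padic :: "('a padic \<times> 'a padic) filter" where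
  "uniformity_padic = (INF e\<in>{0<..}. principal {(x, y). dist x y < e})"

definition open_padic :: "'a padic set \<Rightarrow> bool" where
  "open_padic U \<longleftrightarrow> (\<forall>x\<in>U. eventually (\<lambda>(x', y). x' = x \<longrightarrow> y \<in> U) uniformity)"

instance
proof
  fix x y z :: "'a padic"
  show "dist x y = 0 \<longleftrightarrow> x = y" by (simp add: dist_padic_def)
  show "dist x y \<le> dist x z + dist y z"
    using padic_abs_ultrametric[of "x - z" "z - y"] padic_abs_minus[of "y - z"]
      padic_abs_ge_0[of "x - z"] padic_abs_ge_0[of "y - z"]
    unfolding dist_padic_def by (simp del: padic_abs_minus padic_abs_ge_0)
qed (fact uniformity_padic_def open_padic_def)+

end

definition padic_integers :: "'p :: prime_card padic set" where
  "padic_integers = {x. padic_abs x \<le> 1}"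

text \<open>
  \<^term>\<open>padic_residue x\<close> is the residue class in the field with \<open>p\<close> elements of a p-adic
  integer \<open>x\<close>; it is unspecified for other \<open>x\<close>.
\<close>

definition padic_residue :: "'p :: prime_card padic \<Rightarrow> 'p mod_ring" where
  "padic_residue x = (THE c. \<exists>k :: int. c = of_int k \<and> padic_abs (x - of_int k) < 1)"


section \<open>Weierstrass curves\<close>

datatype 'a weierstrass = Weierstrass (wa1: 'a) (wa2: 'a) (wa3: 'a) (wa4: 'a) (wa6: 'a)

definition weierstrass_poly :: "'a :: comm_ring_1 weierstrass \<Rightarrow> 'a \<Rightarrow> 'a \<Rightarrow> 'a" where
  "weierstrass_poly E x y =
     y ^ 2 + wa1 E * x * y + wa3 E * y - x ^ 3 - wa2 E * x ^ 2 - wa4 E * x - wa6 E"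

definition wb2 :: "'a :: comm_ring_1 weierstrass \<Rightarrow> 'a" where
  "wb2 E = wa1 E ^ 2 + 4 * wa2 E"

definition wb4 :: "'a :: comm_ring_1 weierstrass \<Rightarrow> 'a" where
  "wb4 E = 2 * wa4 E + wa1 E * wa3 E"

definition wb6 :: "'a :: comm_ring_1 weierstrass \<Rightarrow> 'a" where
  "wb6 E = wa3 E ^ 2 + 4 * wa6 E"

definition wb8 :: "'a :: comm_ring_1 weierstrass \<Rightarrow> 'a" where
  "wb8 E = wa1 E ^ 2 * wa6 E + 4 * wa2 E * wa6 E - wa1 E * wa3 E * wa4 E
             + wa2 E * wa3 E ^ 2 - wa4 E ^ 2"

definition discriminant :: "'a :: comm_ring_1 weierstrass \<Rightarrow> 'a" where
  "discriminant E =
     - (wb2 E ^ 2) * wb8 E - 8 * wb4 E ^ 3 - 27 * wb6 E ^ 2 + 9 * wb2 E * wb4 E * wb6 E"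

definition elliptic_curve :: "'a :: field weierstrass \<Rightarrow> bool" where
  "elliptic_curve E \<longleftrightarrow> discriminant E \<noteq> 0"

datatype 'a point = Infinity | Point (xcoord: 'a) (ycoord: 'a)

definition curve_points :: "'a :: comm_ring_1 weierstrass \<Rightarrow> 'a point set" where
  "curve_points E = insert Infinity {Point x y | x y. weierstrass_poly E x y = 0}"

text \<open>The two conditions are the partial derivatives of the Weierstrass polynomial.\<close>

definition nonsingular_points :: "'a :: comm_ring_1 weierstrass \<Rightarrow> 'a point set" where
  "nonsingular_points E = insert Infinity
     {Point x y | x y. weierstrass_poly E x y = 0 \<and>
        (2 * y + wa1 E * x + wa3 E \<noteq> 0 \<or> wa1 E * y - 3 * x ^ 2 - 2 * wa2 E * x - wa4 E \<noteq> 0)}"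

fun point_neg :: "'a :: field weierstrass \<Rightarrow> 'a point \<Rightarrow> 'a point" where
  "point_neg E Infinity = Infinity"
| "point_neg E (Point x y) = Point x (- y - wa1 E * x - wa3 E)"

text \<open>Chord-tangent addition; \<open>m\<close> is the slope of the line and \<open>c\<close> its intercept.\<close>

fun point_add :: "'a :: field weierstrass \<Rightarrow> 'a point \<Rightarrow> 'a point \<Rightarrow> 'a point" where
  "point_add E Infinity Q = Q"
| "point_add E P Infinity = P"
| "point_add E (Point x1 y1) (Point x2 y2) =
     (if x1 = x2 \<and> y1 + y2 + wa1 E * x2 + wa3 E = 0 then Infinity
      else
        let m = (if x1 = x2
                 then (3 * x1 ^ 2 + 2 * wa2 E * x1 + wa4 E - wa1 E * y1)
                        / (2 * y1 + wa1 E * x1 + wa3 E)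
                 else (y2 - y1) / (x2 - x1));
            c = y1 - m * x1;
            x3 = m ^ 2 + wa1 E * m - wa2 E - x1 - x2
        in Point x3 (- (m + wa1 E) * x3 - c - wa3 E))"

definition point_mult :: "'a :: field weierstrass \<Rightarrow> nat \<Rightarrow> 'a point \<Rightarrow> 'a point" where
  "point_mult E n P = (point_add E P ^^ n) Infinity"

definition has_point_order :: "'a :: field weierstrass \<Rightarrow> 'a point \<Rightarrow> nat \<Rightarrow> bool" where
  "has_point_order E P r \<longleftrightarrow>
     r > 0 \<and> point_mult E r P = Infinity \<and> (\<forall>k. 0 < k \<and> k < r \<longrightarrow> point_mult E k P \<noteq> Infinity)"


section \<open>The ring of translated division polynomials\<close>

datatype uvar = Ua1 | Ua2 | Ua3 | Ua4 | Ua6 | Ux1 | Uy1 | Ux2 | Uy2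

lemma UNIV_uvar: "UNIV = {Ua1, Ua2, Ua3, Ua4, Ua6, Ux1, Uy1, Ux2, Uy2}"
  using uvar.exhaust by auto

instance uvar :: finite
  by standard (simp add: UNIV_uvar)

text \<open>Only needed for the library's proof that the polynomial ring is an integral domain.\<close>

instantiation uvar :: linorder
begin

fun uvar_index :: "uvar \<Rightarrow> nat" where
  "uvar_index Ua1 = 0" | "uvar_index Ua2 = 1" | "uvar_index Ua3 = 2" | "uvar_index Ua4 = 3"
| "uvar_index Ua6 = 4" | "uvar_index Ux1 = 5" | "uvar_index Uy1 = 6" | "uvar_index Ux2 = 7"
| "uvar_index Uy2 = 8"

definition less_eq_uvar :: "uvar \<Rightarrow> uvar \<Rightarrow> bool" where
  "less_eq_uvar u v \<longleftrightarrow> uvar_index u \<le> uvar_index v"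

definition less_uvar :: "uvar \<Rightarrow> uvar \<Rightarrow> bool" where
  "less_uvar u v \<longleftrightarrow> uvar_index u < uvar_index v"

instance
proof
  fix u v :: uvar
  show "u = v" if "u \<le> v" "v \<le> u"
    using that by (cases u; cases v) (auto simp: less_eq_uvar_def)
qed (auto simp: less_eq_uvar_def less_uvar_def)

end

type_synonym upoly = "(uvar \<Rightarrow>\<^sub>0 nat) \<Rightarrow>\<^sub>0 int"

definition pvar :: "uvar \<Rightarrow> upoly" where
  "pvar v = Poly_Mapping.single (Poly_Mapping.single v 1) 1"

definition upoly_curve :: "upoly weierstrass" where
  "upoly_curve = Weierstrass (pvar Ua1) (pvar Ua2) (pvar Ua3) (pvar Ua4) (pvar Ua6)"

abbreviation f1_poly :: upoly where
  "f1_poly \<equiv> weierstrass_poly upoly_curve (pvar Ux1) (pvar Uy1)"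

abbreviation f2_poly :: upoly where
  "f2_poly \<equiv> weierstrass_poly upoly_curve (pvar Ux2) (pvar Uy2)"

abbreviation dx_poly :: upoly where
  "dx_poly \<equiv> pvar Ux1 - pvar Ux2"

text \<open>
  The localisation \<open>\<int>[\<alpha>\<^sub>1, \<dots>, y\<^sub>2][(x\<^sub>1 - x\<^sub>2)\<^sup>-\<^sup>1]\<close> inside the fraction field, and its ideal
  generated by the two Weierstrass polynomials.
\<close>

definition upoly_loc :: "upoly fract set" where
  "upoly_loc = {to_fract F / to_fract dx_poly ^ k | F k. True}"

definition curve_ideal :: "upoly fract set" where
  "curve_ideal = {u * to_fract f1_poly + v * to_fract f2_poly | u v. u \<in> upoly_loc \<and> v \<in> upoly_loc}"

definition upoly_eval :: "(uvar \<Rightarrow> 'a :: comm_ring_1) \<Rightarrow> upoly \<Rightarrow> 'a" where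
  "upoly_eval g F =
     (\<Sum>m\<in>Poly_Mapping.keys F.
        of_int (Poly_Mapping.lookup F m) * (\<Prod>v\<in>UNIV. g v ^ Poly_Mapping.lookup m v))"

lemma upoly_eval_superset:
  assumes "finite S" "Poly_Mapping.keys F \<subseteq> S"
  shows "upoly_eval g F =
     (\<Sum>m\<in>S. of_int (Poly_Mapping.lookup F m) * (\<Prod>v\<in>UNIV. g v ^ Poly_Mapping.lookup m v))"
  unfolding upoly_eval_def
  by (rule sum.mono_neutral_left) (use assms in \<open>auto simp: in_keys_iff\<close>)

lemma upoly_eval_0 [simp]: "upoly_eval g 0 = 0"
  by (simp add: upoly_eval_def)

lemma upoly_eval_add [simp]: "upoly_eval g (F + G) = upoly_eval g F + upoly_eval g G"
proof -
  let ?S = "Poly_Mapping.keys F \<union> Poly_Mapping.keys G"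
  have "Poly_Mapping.keys (F + G) \<subseteq> ?S" by (rule Poly_Mapping.keys_add)
  thus ?thesis
    by (subst (1 2 3) upoly_eval_superset[of ?S])
       (auto simp: lookup_add algebra_simps sum.distrib)
qed

lemma upoly_eval_single:
  "upoly_eval g (Poly_Mapping.single m c) =
     of_int c * (\<Prod>v\<in>UNIV. g v ^ Poly_Mapping.lookup m v)"
  by (subst upoly_eval_superset[of "{m}"]) auto

lemma upoly_induct [case_names single add]:
  assumes "\<And>m c. Q (Poly_Mapping.single m c)" "\<And>F G. Q F \<Longrightarrow> Q G \<Longrightarrow> Q (F + G)"
  shows "Q (F :: upoly)"
proof -
  have "Q (\<Sum>m\<in>S. Poly_Mapping.single m (Poly_Mapping.lookup F m))" if "finite S" for S
    using that
  proof induction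
    case empty
    show ?case using assms(1)[of 0 0] by simp
  qed (use assms in auto)
  moreover have "F = (\<Sum>m\<in>Poly_Mapping.keys F. Poly_Mapping.single m (Poly_Mapping.lookup F m))"
    by (rule poly_mapping_eqI)
       (auto simp: lookup_sum lookup_single when_def sum.delta in_keys_iff)
  ultimately show ?thesis by (metis finite_keys)
qed

lemma upoly_eval_mult [simp]: "upoly_eval g (F * G) = upoly_eval g F * upoly_eval g G"
proof (induction F rule: upoly_induct)
  case (single m c)
  show ?case
    by (induction G rule: upoly_induct)
       (simp_all add: mult_single upoly_eval_single lookup_add power_add prod.distrib
          algebra_simps distrib_left)
qed (simp add: distrib_right)

lemma upoly_eval_1 [simp]: "upoly_eval g 1 = 1"
  by (simp add: upoly_eval_single flip: single_one)

lemma comm_ring_hom_upoly_eval: "comm_ring_hom (upoly_eval g)"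
  by standard auto

lemma upoly_eval_uminus [simp]: "upoly_eval g (- F) = - upoly_eval g F"
proof -
  interpret comm_ring_hom "upoly_eval g" by (rule comm_ring_hom_upoly_eval)
  show ?thesis by (rule hom_uminus)
qed

lemma upoly_eval_diff [simp]: "upoly_eval g (F - G) = upoly_eval g F - upoly_eval g G"
proof -
  interpret comm_ring_hom "upoly_eval g" by (rule comm_ring_hom_upoly_eval)
  show ?thesis by (rule hom_minus)
qed

lemma upoly_eval_power [simp]: "upoly_eval g (F ^ n) = upoly_eval g F ^ n"
  by (induction n) auto

lemma upoly_eval_pvar [simp]: "upoly_eval g (pvar v) = g v"
proof -
  have "(\<Prod>u\<in>UNIV. g u ^ Poly_Mapping.lookup (Poly_Mapping.single v 1) u) = (\<Prod>u\<in>UNIV. if u = v then g u else 1)"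
    by (intro prod.cong) (auto simp: lookup_single)
  thus ?thesis by (simp add: pvar_def upoly_eval_single)
qed

lemma upoly_of_int_eq: "(of_int c :: upoly) = Poly_Mapping.single 0 c"
proof -
  have "Poly_Mapping.single 0 (of_int c) = (of_int c :: upoly)" by (rule single_of_int)
  thus ?thesis by simp
qed

lemma upoly_closure_induct [case_names of_int var add mult]:
  assumes "\<And>c. Q (of_int c)" "\<And>v. Q (pvar v)"
    "\<And>F G. Q F \<Longrightarrow> Q G \<Longrightarrow> Q (F + G)" "\<And>F G. Q F \<Longrightarrow> Q G \<Longrightarrow> Q (F * G)"
  shows "Q (F :: upoly)"
proof (induction F rule: upoly_induct)
  case (single m c)
  have Q1: "Q 1" using assms(1)[of 1] by simp
  have Qpow: "Q (F ^ n)" if "Q F" for F n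
    by (induction n) (use that Q1 assms(4) in auto)
  have Qprod: "Q (prod f S)" if "finite S" "\<And>v. Q (f v)" for f :: "uvar \<Rightarrow> upoly" and S
    using that by induction (use Q1 assms(4) in auto)
  have pw: "pvar v ^ n = Poly_Mapping.single (Poly_Mapping.single v n) 1" for v n
    by (induction n) (auto simp: pvar_def mult_single simp flip: single_add)
  have pr: "(\<Prod>v\<in>S. Poly_Mapping.single (f v) (1 :: int)) = Poly_Mapping.single (\<Sum>v\<in>S. f v) 1"
    if "finite S" for S and f :: "uvar \<Rightarrow> uvar \<Rightarrow>\<^sub>0 nat"
    using that by induction (auto simp: mult_single)
  have m: "m = (\<Sum>v\<in>UNIV. Poly_Mapping.single v (Poly_Mapping.lookup m v))"
    by (rule poly_mapping_eqI) (auto simp: lookup_sum lookup_single when_def sum.delta)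
  have "Poly_Mapping.single m c = of_int c * (\<Prod>v\<in>UNIV. pvar v ^ Poly_Mapping.lookup m v)"
    unfolding pw by (subst pr, simp, subst m[symmetric]) (simp add: upoly_of_int_eq mult_single)
  thus ?case using assms(1,2,4) Qpow Qprod by auto
qed (use assms in auto)

lemma pvar_inject [simp]: "pvar u = pvar v \<longleftrightarrow> u = v"
proof
  assume "pvar u = pvar v"
  hence "upoly_eval (\<lambda>w. if w = u then 1 else 0 :: int) (pvar u)
       = upoly_eval (\<lambda>w. if w = u then 1 else 0) (pvar v)" by simp
  thus "u = v" by (simp split: if_splits)
qed auto

lemma dx_poly_nz [simp]: "dx_poly \<noteq> 0"
  by simp

lemma to_fract_dx_nz [simp]: "to_fract dx_poly \<noteq> 0"
  using dx_poly_nz to_fract_eq_0_iff by blast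

lemma to_fract_power [simp]: "to_fract (x ^ n) = to_fract x ^ n"
  by (induction n) auto

text \<open>
  Solving the two (linear) equations for \<open>\<alpha>\<^sub>4\<close> and \<open>\<alpha>\<^sub>6\<close> identifies the quotient ring with a
  localised polynomial ring in the other variables; hence it is an integral domain.
\<close>

definition elim_poly :: "uvar \<Rightarrow> uvar \<Rightarrow> upoly" where
  "elim_poly x y = pvar y ^ 2 + pvar Ua1 * pvar x * pvar y + pvar Ua3 * pvar y
                     - pvar x ^ 3 - pvar Ua2 * pvar x ^ 2"

lemma weierstrass_poly_upoly_curve:
  "weierstrass_poly upoly_curve (pvar x) (pvar y) = elim_poly x y - pvar Ua4 * pvar x - pvar Ua6"
  by (simp add: weierstrass_poly_def upoly_curve_def elim_poly_def)

definition elim_subst :: "uvar \<Rightarrow> upoly fract" where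
  "elim_subst =
     (let C1 = to_fract (elim_poly Ux1 Uy1);
          C2 = to_fract (elim_poly Ux2 Uy2);
          A4 = (C1 - C2) / to_fract dx_poly
      in (\<lambda>v. if v = Ua4 then A4
              else if v = Ua6 then C1 - A4 * to_fract (pvar Ux1)
              else to_fract (pvar v)))"

definition elim_eval :: "upoly \<Rightarrow> upoly fract" where
  "elim_eval = upoly_eval elim_subst"

lemma elim_eval_simps [simp]:
  "elim_eval 0 = 0" "elim_eval 1 = 1" "elim_eval (F + G) = elim_eval F + elim_eval G"
  "elim_eval (F * G) = elim_eval F * elim_eval G" "elim_eval (F - G) = elim_eval F - elim_eval G"
  "elim_eval (F ^ n) = elim_eval F ^ n"
  by (simp_all add: elim_eval_def)

lemma elim_eval_of_int [simp]: "elim_eval (of_int c) = to_fract (of_int c)"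
proof -
  interpret h: comm_ring_hom elim_eval
    unfolding elim_eval_def by (rule comm_ring_hom_upoly_eval)
  interpret h': comm_ring_hom "to_fract :: upoly \<Rightarrow> _"
    by standard auto
  show ?thesis by (simp add: h.hom_of_int h'.hom_of_int)
qed

lemma elim_eval_pvar: "v \<noteq> Ua4 \<Longrightarrow> v \<noteq> Ua6 \<Longrightarrow> elim_eval (pvar v) = to_fract (pvar v)"
  by (simp add: elim_eval_def elim_subst_def Let_def)

lemma elim_eval_dx [simp]: "elim_eval dx_poly = to_fract dx_poly"
  by (simp add: elim_eval_pvar)

lemma elim_eval_elim_poly:
  "{x, y} \<inter> {Ua4, Ua6} = {} \<Longrightarrow> elim_eval (elim_poly x y) = to_fract (elim_poly x y)"
  unfolding elim_poly_def by (simp only: elim_eval_simps) (auto simp: elim_eval_pvar)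

lemma elim_eval_Ua4: 
  "elim_eval (pvar Ua4) = (to_fract (elim_poly Ux1 Uy1) - to_fract (elim_poly Ux2 Uy2)) / to_fract dx_poly"
  by (simp add: elim_eval_def elim_subst_def Let_def)

lemma elim_eval_Ua6: 
  "elim_eval (pvar Ua6) = to_fract (elim_poly Ux1 Uy1) - elim_eval (pvar Ua4) * to_fract (pvar Ux1)"
  by (simp add: elim_eval_def elim_subst_def Let_def)

lemma elim_eval_f1 [simp]: "elim_eval f1_poly = 0"
  unfolding weierstrass_poly_upoly_curve
  by (simp add: elim_eval_elim_poly elim_eval_Ua6) (simp add: elim_eval_pvar)

lemma elim_eval_f2 [simp]: "elim_eval f2_poly = 0"
proof -
  have "elim_eval f2_poly = elim_eval f2_poly - elim_eval f1_poly" by simp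
  also have "\<dots> = elim_eval (pvar Ua4) * to_fract dx_poly
                  - (to_fract (elim_poly Ux1 Uy1) - to_fract (elim_poly Ux2 Uy2))"
    unfolding weierstrass_poly_upoly_curve elim_eval_simps
    by (simp add: elim_eval_elim_poly elim_eval_pvar[of Ux1] elim_eval_pvar[of Ux2] algebra_simps)
  also have "\<dots> = 0"
    unfolding elim_eval_Ua4 using to_fract_dx_nz
    by (simp only: nonzero_divide_eq_eq times_divide_eq_left nonzero_mult_div_cancel_right
        not_False_eq_True diff_self)
  finally show ?thesis .
qed

lemma elim_normal_form:
  "\<exists>k G u w. dx_poly ^ k * F = G + u * f1_poly + w * f2_poly \<and> elim_eval G = to_fract G"
proof (induction F rule: upoly_closure_induct)
  case (of_int c)
  show ?case by (rule exI[of _ 0], rule exI[of _ "of_int c"], rule exI[of _ 0], rule exI[of _ 0]) simp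
next
  case (var v)
  let ?C1 = "elim_poly Ux1 Uy1" and ?C2 = "elim_poly Ux2 Uy2"
  have C: "elim_eval ?C1 = to_fract ?C1" "elim_eval ?C2 = to_fract ?C2"
    by (simp_all add: elim_eval_elim_poly)
  consider "v = Ua4" | "v = Ua6" | "v \<noteq> Ua4" "v \<noteq> Ua6" by blast
  thus ?case
  proof cases
    case 1
    have "dx_poly ^ 1 * pvar v = (?C1 - ?C2) + (- 1) * f1_poly + 1 * f2_poly"
      unfolding weierstrass_poly_upoly_curve 1 by (simp add: algebra_simps)
    moreover have "elim_eval (?C1 - ?C2) = to_fract (?C1 - ?C2)" by (simp add: C)
    ultimately show ?thesis by blast
  next
    case 2
    have "dx_poly ^ 1 * pvar v = (dx_poly * ?C1 - pvar Ux1 * (?C1 - ?C2))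
            + (pvar Ux1 - dx_poly) * f1_poly + (- pvar Ux1) * f2_poly"
      unfolding weierstrass_poly_upoly_curve 2 by (simp add: algebra_simps)
    moreover have "elim_eval (dx_poly * ?C1 - pvar Ux1 * (?C1 - ?C2))
        = to_fract (dx_poly * ?C1 - pvar Ux1 * (?C1 - ?C2))"
      by (simp add: C elim_eval_pvar)
    ultimately show ?thesis by blast
  next
    case 3
    show ?thesis
      by (rule exI[of _ 0], rule exI[of _ "pvar v"], rule exI[of _ 0], rule exI[of _ 0])
         (simp add: elim_eval_pvar 3)
  qed
next
  case (add F F')
  then obtain k G u w k' G' u' w' where
    *: "dx_poly ^ k * F = G + u * f1_poly + w * f2_poly" "elim_eval G = to_fract G"
       "dx_poly ^ k' * F' = G' + u' * f1_poly + w' * f2_poly" "elim_eval G' = to_fract G'"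
    by blast
  have "dx_poly ^ (k + k') * (F + F') = dx_poly ^ k' * (dx_poly ^ k * F) + dx_poly ^ k * (dx_poly ^ k' * F')"
    by (simp add: power_add algebra_simps del: minus_diff_eq)
  also have "\<dots> = (dx_poly ^ k' * G + dx_poly ^ k * G')
      + (dx_poly ^ k' * u + dx_poly ^ k * u') * f1_poly
      + (dx_poly ^ k' * w + dx_poly ^ k * w') * f2_poly"
    unfolding *(1,3) by (simp only: distrib_left distrib_right mult.assoc add.assoc add.left_commute add.commute)
  finally have "dx_poly ^ (k + k') * (F + F') = \<dots>" .
  moreover have "elim_eval (dx_poly ^ k' * G + dx_poly ^ k * G') = to_fract (dx_poly ^ k' * G + dx_poly ^ k * G')"
    using *(2,4) by (simp del: to_fract_diff elim_eval_simps(5))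
  ultimately show ?case by blast
next
  case (mult F F')
  then obtain k G u w k' G' u' w' where
    *: "dx_poly ^ k * F = G + u * f1_poly + w * f2_poly" "elim_eval G = to_fract G"
       "dx_poly ^ k' * F' = G' + u' * f1_poly + w' * f2_poly" "elim_eval G' = to_fract G'"
    by blast
  have distr: "(G + u * a + w * b) * (G' + u' * a + w' * b)
      = G * G' + (G * u' + u * G' + u * u' * a + u * w' * b) * a + (G * w' + w * G' + w * u' * a + w * w' * b) * b"
    for a b :: upoly by (simp add: algebra_simps)
  have "dx_poly ^ (k + k') * (F * F') = (dx_poly ^ k * F) * (dx_poly ^ k' * F')"
    by (simp only: power_add mult_ac)
  also have "\<dots> = G * G'
      + (G * u' + u * G' + u * u' * f1_poly + u * w' * f2_poly) * f1_poly
      + (G * w' + w * G' + w * u' * f1_poly + w * w' * f2_poly) * f2_poly"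
    unfolding *(1,3) by (rule distr)
  finally have "dx_poly ^ (k + k') * (F * F') = \<dots>" .
  moreover have "elim_eval (G * G') = to_fract (G * G')" using *(2,4) by simp
  ultimately show ?case by blast
qed

lemma upoly_loc_altI: "to_fract F / to_fract dx_poly ^ k \<in> upoly_loc"
  unfolding upoly_loc_def by blast

lemma to_fract_in_upoly_loc: "to_fract F \<in> upoly_loc"
  using upoly_loc_altI[of F 0] by simp

lemma upoly_locE:
  assumes "u \<in> upoly_loc"
  obtains F k where "u = to_fract F / to_fract dx_poly ^ k"
  using assms unfolding upoly_loc_def by blast

lemma fract_div_power_add:
  fixes d :: "'a :: field"
  assumes "d \<noteq> 0"
  shows "a / d ^ k + b / d ^ l = (a * d ^ l + b * d ^ k) / d ^ (k + l)"
  using assms by (simp add: field_simps power_add)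

lemma upoly_loc_add: "u \<in> upoly_loc \<Longrightarrow> v \<in> upoly_loc \<Longrightarrow> u + v \<in> upoly_loc"
proof (elim upoly_locE)
  fix F k G l
  assume u: "u = to_fract F / to_fract dx_poly ^ k" and v: "v = to_fract G / to_fract dx_poly ^ l"
  have "u + v = to_fract (F * dx_poly ^ l + G * dx_poly ^ k) / to_fract dx_poly ^ (k + l)"
    unfolding u v fract_div_power_add[OF to_fract_dx_nz] to_fract_add to_fract_mult to_fract_power ..
  thus ?thesis by (simp only: upoly_loc_altI)
qed

lemma upoly_loc_mult: "u \<in> upoly_loc \<Longrightarrow> v \<in> upoly_loc \<Longrightarrow> u * v \<in> upoly_loc"
proof (elim upoly_locE)
  fix F k G l
  assume u: "u = to_fract F / to_fract dx_poly ^ k" and v: "v = to_fract G / to_fract dx_poly ^ l"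
  have "u * v = to_fract (F * G) / to_fract dx_poly ^ (k + l)"
    unfolding u v to_fract_mult by (simp only: power_add times_divide_times_eq)
  thus ?thesis by (simp only: upoly_loc_altI)
qed

lemma upoly_loc_0 [simp]: "0 \<in> upoly_loc" and upoly_loc_1 [simp]: "1 \<in> upoly_loc"
  using to_fract_in_upoly_loc[of 0] to_fract_in_upoly_loc[of 1] by auto

lemma upoly_loc_minus: "u \<in> upoly_loc \<Longrightarrow> - u \<in> upoly_loc"
  using upoly_loc_mult[OF to_fract_in_upoly_loc[of "- 1"], of u] by simp

lemma elim_eval_eq_0D:
  assumes F: "elim_eval F = 0"
  obtains k u w where "dx_poly ^ k * F = u * f1_poly + w * f2_poly"
proof -
  obtain k G u w where eq: "dx_poly ^ k * F = G + u * f1_poly + w * f2_poly"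
    and G: "elim_eval G = to_fract G" using elim_normal_form by blast
  have "elim_eval (dx_poly ^ k * F) = elim_eval (G + u * f1_poly + w * f2_poly)"
    using eq by (rule arg_cong)
  hence "to_fract G = 0"
    by (simp only: elim_eval_simps(3,4,6) elim_eval_f1 elim_eval_f2 F G
        mult_zero_right mult_zero_left add_0_right)
  hence "dx_poly ^ k * F = u * f1_poly + w * f2_poly" using eq by simp
  thus ?thesis by (rule that)
qed

lemma curve_ideal_iff:
  "to_fract F / to_fract dx_poly ^ j \<in> curve_ideal \<longleftrightarrow> elim_eval F = 0"
proof
  assume "to_fract F / to_fract dx_poly ^ j \<in> curve_ideal"
  then obtain G k H l where eq: "to_fract F / to_fract dx_poly ^ j =
      to_fract G / to_fract dx_poly ^ k * to_fract f1_poly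
      + to_fract H / to_fract dx_poly ^ l * to_fract f2_poly"
    unfolding curve_ideal_def upoly_loc_def by blast
  have aux: "a * (d ^ k * d ^ l) = (b * d ^ l * x + c * d ^ k * y) * d ^ j"
    if "d \<noteq> 0" "a / d ^ j = b / d ^ k * x + c / d ^ l * y" for a b c d x y :: "upoly fract"
  proof -
    have "a / d ^ j * (d ^ j * (d ^ k * d ^ l)) = (b / d ^ k * x + c / d ^ l * y) * (d ^ j * (d ^ k * d ^ l))"
      using that(2) by simp
    thus ?thesis using that(1) by (simp add: algebra_simps)
  qed
  have "to_fract (F * (dx_poly ^ k * dx_poly ^ l))
      = to_fract ((G * dx_poly ^ l * f1_poly + H * dx_poly ^ k * f2_poly) * dx_poly ^ j)"
    unfolding to_fract_mult to_fract_add to_fract_power by (rule aux[OF to_fract_dx_nz eq])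
  hence "F * (dx_poly ^ k * dx_poly ^ l)
      = (G * dx_poly ^ l * f1_poly + H * dx_poly ^ k * f2_poly) * dx_poly ^ j"
    by (simp only: to_fract_eq_iff)
  hence "elim_eval (F * (dx_poly ^ k * dx_poly ^ l))
      = elim_eval ((G * dx_poly ^ l * f1_poly + H * dx_poly ^ k * f2_poly) * dx_poly ^ j)"
    by (rule arg_cong)
  hence "elim_eval F * (to_fract dx_poly ^ k * to_fract dx_poly ^ l) = 0"
    by (simp only: elim_eval_simps(3,4,6) elim_eval_f1 elim_eval_f2 elim_eval_dx
        mult_zero_right mult_zero_left add_0)
  thus "elim_eval F = 0"
    by (simp only: mult_eq_0_iff power_eq_0_iff to_fract_dx_nz simp_thms)
next
  assume F: "elim_eval F = 0"
  then obtain k u w where "dx_poly ^ k * F = u * f1_poly + w * f2_poly"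
    by (rule elim_eval_eq_0D)
  hence "to_fract dx_poly ^ k * to_fract F = to_fract u * to_fract f1_poly + to_fract w * to_fract f2_poly"
    unfolding to_fract_power[symmetric] to_fract_mult[symmetric] to_fract_add[symmetric]
    by (rule arg_cong)
  moreover have "a / d ^ j = b / d ^ (k + j) * x + c / d ^ (k + j) * y"
    if "d \<noteq> 0" "d ^ k * a = b * x + c * y" for a b c d x y :: "upoly fract"
  proof -
    have "a / d ^ j = (d ^ k * a) / d ^ (k + j)" using that(1) by (simp add: power_add)
    thus ?thesis unfolding that(2) by (simp add: add_divide_distrib)
  qed
  ultimately have "to_fract F / to_fract dx_poly ^ j =
      to_fract u / to_fract dx_poly ^ (k + j) * to_fract f1_poly
      + to_fract w / to_fract dx_poly ^ (k + j) * to_fract f2_poly"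
    using to_fract_dx_nz by blast
  thus "to_fract F / to_fract dx_poly ^ j \<in> curve_ideal"
    unfolding curve_ideal_def using upoly_loc_altI by blast
qed

lemma curve_ideal_subset: "u \<in> curve_ideal \<Longrightarrow> u \<in> upoly_loc"
  unfolding curve_ideal_def
  by (auto simp del: to_fract_diff intro!: upoly_loc_add upoly_loc_mult to_fract_in_upoly_loc)

lemma curve_ideal_0 [simp]: "0 \<in> curve_ideal"
  using curve_ideal_iff[of 0 0] by simp

lemma curve_ideal_add:
  assumes "u \<in> curve_ideal" "v \<in> curve_ideal"
  shows "u + v \<in> curve_ideal"
proof -
  obtain a b c d where *: "u = a * to_fract f1_poly + b * to_fract f2_poly"
    "v = c * to_fract f1_poly + d * to_fract f2_poly"
    "a \<in> upoly_loc" "b \<in> upoly_loc" "c \<in> upoly_loc" "d \<in> upoly_loc"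
    using assms unfolding curve_ideal_def by blast
  have "u + v = (a + c) * to_fract f1_poly + (b + d) * to_fract f2_poly"
    unfolding *(1,2) by (simp only: distrib_right add_ac)
  thus ?thesis unfolding curve_ideal_def using *(3-6) upoly_loc_add by blast
qed

lemma curve_ideal_mult:
  assumes "u \<in> upoly_loc" "v \<in> curve_ideal"
  shows "u * v \<in> curve_ideal"
proof -
  obtain c d where *: "v = c * to_fract f1_poly + d * to_fract f2_poly"
    "c \<in> upoly_loc" "d \<in> upoly_loc"
    using assms unfolding curve_ideal_def by blast
  have "u * v = (u * c) * to_fract f1_poly + (u * d) * to_fract f2_poly"
    unfolding *(1) by (simp only: distrib_left mult.assoc)
  thus ?thesis unfolding curve_ideal_def using *(2,3) assms(1) upoly_loc_mult by blast
qed

lemma curve_ideal_minus: "u \<in> curve_ideal \<Longrightarrow> - u \<in> curve_ideal"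
  using curve_ideal_mult[OF upoly_loc_minus[OF upoly_loc_1], of u] by simp

lemma curve_ideal_prime:
  assumes "u \<in> upoly_loc" "v \<in> upoly_loc" "u * v \<in> curve_ideal"
  shows "u \<in> curve_ideal \<or> v \<in> curve_ideal"
  using assms(1,2)
proof (elim upoly_locE)
  fix F k G l
  assume u: "u = to_fract F / to_fract dx_poly ^ k" and v: "v = to_fract G / to_fract dx_poly ^ l"
  have "u * v = to_fract (F * G) / to_fract dx_poly ^ (k + l)"
    unfolding u v to_fract_mult by (simp only: power_add times_divide_times_eq)
  hence "elim_eval (F * G) = 0" using assms(3) by (simp only: curve_ideal_iff)
  thus ?thesis unfolding u v curve_ideal_iff by simp
qed

lemma one_notin_curve_ideal: "1 \<notin> curve_ideal"
  using curve_ideal_iff[of 1 0] by simp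

definition rstar_rel :: "upoly fract \<Rightarrow> upoly fract \<Rightarrow> bool" where
  "rstar_rel u v \<longleftrightarrow> u \<in> upoly_loc \<and> v \<in> upoly_loc \<and> u - v \<in> curve_ideal"

lemma rstar_rel_refl: "rstar_rel u u \<longleftrightarrow> u \<in> upoly_loc"
  by (simp add: rstar_rel_def)

quotient_type rstar = "upoly fract" / partial: rstar_rel
proof (rule part_equivpI)
  show "\<exists>u. rstar_rel u u" using upoly_loc_0 rstar_rel_refl by blast
  show "symp rstar_rel"
    by (rule sympI) (use curve_ideal_minus in \<open>force simp: rstar_rel_def\<close>)
  show "transp rstar_rel"
    by (rule transpI) (use curve_ideal_add in \<open>force simp: rstar_rel_def\<close>)
qed

instantiation rstar :: idom
begin

lift_definition zero_rstar :: rstar is 0 by (simp add: rstar_rel_refl)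

lift_definition one_rstar :: rstar is 1 by (simp add: rstar_rel_refl)

lift_definition plus_rstar :: "rstar \<Rightarrow> rstar \<Rightarrow> rstar" is "(+)"
  by (auto simp: rstar_rel_def upoly_loc_add add_diff_add curve_ideal_add)

lift_definition uminus_rstar :: "rstar \<Rightarrow> rstar" is uminus
  using curve_ideal_minus by (force simp: rstar_rel_def upoly_loc_minus)

lift_definition minus_rstar :: "rstar \<Rightarrow> rstar \<Rightarrow> rstar" is "(-)"
proof -
  fix a b c d assume "rstar_rel a b" "rstar_rel c d"
  hence "a - b + - (c - d) \<in> curve_ideal" "a - c \<in> upoly_loc" "b - d \<in> upoly_loc"
    using upoly_loc_add[OF _ upoly_loc_minus, of a c] upoly_loc_add[OF _ upoly_loc_minus, of b d]
      curve_ideal_add[OF _ curve_ideal_minus, of "a - b" "c - d"]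
    by (auto simp: rstar_rel_def)
  thus "rstar_rel (a - c) (b - d)" by (simp add: rstar_rel_def algebra_simps)
qed

lift_definition times_rstar :: "rstar \<Rightarrow> rstar \<Rightarrow> rstar" is "(*)"
proof -
  fix a b c d assume *: "rstar_rel a b" "rstar_rel c d"
  have "a * (c - d) + d * (a - b) \<in> curve_ideal"
    using * by (auto simp: rstar_rel_def intro!: curve_ideal_add curve_ideal_mult)
  thus "rstar_rel (a * c) (b * d)"
    using * by (simp add: rstar_rel_def upoly_loc_mult algebra_simps)
qed

instance
proof
  fix a b c :: rstar
  show "a + b + c = a + (b + c)"
    by transfer (simp add: rstar_rel_def upoly_loc_add add.assoc)
  show "a + b = b + a"
    by transfer (simp add: rstar_rel_def upoly_loc_add add.commute)
  show "0 + a = a" by transfer (simp add: rstar_rel_def)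
  show "- a + a = 0" by transfer (simp add: rstar_rel_def)
  show "a - b = a + - b"
    by transfer (simp add: rstar_rel_def upoly_loc_add[OF _ upoly_loc_minus, simplified])
  show "a * b * c = a * (b * c)"
    by transfer (simp add: rstar_rel_def upoly_loc_mult mult.assoc)
  show "a * b = b * a"
    by transfer (simp add: rstar_rel_def upoly_loc_mult mult.commute)
  show "1 * a = a" by transfer (simp add: rstar_rel_def)
  show "(a + b) * c = a * c + b * c"
    by transfer (simp add: rstar_rel_def upoly_loc_mult upoly_loc_add distrib_right)
  show "a * (b + c) = a * b + a * c"
    by transfer (simp add: rstar_rel_def upoly_loc_mult upoly_loc_add distrib_left)
  show "0 * a = 0" "a * 0 = 0" by (transfer, simp add: rstar_rel_def)+
  show "(0 :: rstar) \<noteq> 1"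
    by transfer (use one_notin_curve_ideal curve_ideal_minus[of "- 1"] in \<open>auto simp: rstar_rel_def\<close>)
  show "a * b \<noteq> 0" if "a \<noteq> 0" "b \<noteq> 0"
    using that by transfer (use curve_ideal_prime in \<open>auto simp: rstar_rel_def upoly_loc_mult\<close>)
qed

end

definition rvar :: "uvar \<Rightarrow> rstar" where
  "rvar v = abs_rstar (to_fract (pvar v))"

lemma rstar_rel_iff:
  "u \<in> upoly_loc \<Longrightarrow> v \<in> upoly_loc \<Longrightarrow> abs_rstar u = abs_rstar v \<longleftrightarrow> u - v \<in> curve_ideal"
  using Quotient3_rel[OF Quotient3_rstar, of u v] by (auto simp: rstar_rel_def)

definition rstar_of_poly :: "upoly \<Rightarrow> rstar" where
  "rstar_of_poly F = abs_rstar (to_fract F)"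

lemma comm_ring_hom_rstar_of_poly: "comm_ring_hom rstar_of_poly"
  by standard
     (simp_all add: rstar_of_poly_def plus_rstar.abs_eq times_rstar.abs_eq rstar_rel_refl
        to_fract_in_upoly_loc zero_rstar_def one_rstar_def)

lemma rvar_eq: "rvar v = rstar_of_poly (pvar v)"
  by (simp add: rvar_def rstar_of_poly_def)

lemma rstar_cases:
  obtains F k where "r * rstar_of_poly dx_poly ^ k = rstar_of_poly F"
proof -
  interpret comm_ring_hom rstar_of_poly by (rule comm_ring_hom_rstar_of_poly)
  have "rstar_rel (rep_rstar r) (rep_rstar r)"
    using Quotient3_rep_reflp[OF Quotient3_rstar] by blast
  hence "rep_rstar r \<in> upoly_loc" by (simp add: rstar_rel_refl)
  then obtain F k where Fk: "rep_rstar r = to_fract F / to_fract dx_poly ^ k"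
    by (rule upoly_locE)
  have r: "r = abs_rstar (to_fract F / to_fract dx_poly ^ k)"
    using Quotient3_abs_rep[OF Quotient3_rstar, of r] unfolding Fk by simp
  have "r * rstar_of_poly dx_poly ^ k = r * abs_rstar (to_fract (dx_poly ^ k))"
    using hom_power[of dx_poly k] unfolding rstar_of_poly_def by simp
  also have "\<dots> = abs_rstar (to_fract F / to_fract dx_poly ^ k * to_fract (dx_poly ^ k))"
    unfolding r by (rule times_rstar.abs_eq) (simp_all only: rstar_rel_refl upoly_loc_altI to_fract_in_upoly_loc)
  also have "to_fract F / to_fract dx_poly ^ k * to_fract (dx_poly ^ k) = to_fract F"
    using to_fract_dx_nz unfolding to_fract_power
    by (simp only: times_divide_eq_left nonzero_mult_div_cancel_right power_eq_0_iff simp_thms not_False_eq_True)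
  finally show ?thesis using that unfolding rstar_of_poly_def by blast
qed

lemma rstar_of_poly_eq_0D:
  assumes "rstar_of_poly F = 0"
  obtains k u w where "dx_poly ^ k * F = u * f1_poly + w * f2_poly"
proof -
  have "to_fract F - 0 \<in> curve_ideal"
    using assms unfolding rstar_of_poly_def zero_rstar_def
    by (subst (asm) rstar_rel_iff) (auto simp: to_fract_in_upoly_loc)
  hence "elim_eval F = 0" using curve_ideal_iff[of F 0] by simp
  thus ?thesis using elim_eval_eq_0D that by blast
qed

lemma rstar_of_poly_dx_nz [simp]: "rstar_of_poly dx_poly \<noteq> 0"
proof
  assume "rstar_of_poly dx_poly = 0"
  hence "to_fract dx_poly - 0 \<in> curve_ideal"
    unfolding rstar_of_poly_def zero_rstar_def
    by (subst (asm) rstar_rel_iff) (auto simp: to_fract_in_upoly_loc simp del: to_fract_diff)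
  hence "elim_eval dx_poly = 0" using curve_ideal_iff[of dx_poly 0] by simp
  thus False using to_fract_dx_nz by (simp only: elim_eval_dx)
qed

text \<open>
  There is exactly one such homomorphism if \<open>P1\<close> and \<open>P2\<close> are affine points of \<open>E\<close> with different
  \<open>x\<close>-coordinates, that is, if none of \<open>P1\<close>, \<open>P2\<close>, \<open>P2 + P1\<close>, \<open>P2 - P1\<close> is the point at infinity
  (see \<open>specialization_unique\<close>).
\<close>

definition specialization :: "'a :: field weierstrass \<Rightarrow> 'a point \<Rightarrow> 'a point \<Rightarrow> rstar \<Rightarrow> 'a" where
  "specialization E P1 P2 =
     (THE h. comm_ring_hom h \<and>
        map_weierstrass (\<lambda>v. h (rvar v)) (Weierstrass Ua1 Ua2 Ua3 Ua4 Ua6) = E \<and>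
        Point (h (rvar Ux1)) (h (rvar Uy1)) = P1 \<and> Point (h (rvar Ux2)) (h (rvar Uy2)) = P2)"

lemma specialization_unique:
  fixes E :: "'a :: field weierstrass"
  assumes P1: "weierstrass_poly E x1 y1 = 0" and P2: "weierstrass_poly E x2 y2 = 0"
    and neq: "x1 \<noteq> x2"
  shows "\<exists>!h. comm_ring_hom h \<and>
    map_weierstrass (\<lambda>v. h (rvar v)) (Weierstrass Ua1 Ua2 Ua3 Ua4 Ua6) = E \<and>
    Point (h (rvar Ux1)) (h (rvar Uy1)) = Point x1 y1 \<and>
    Point (h (rvar Ux2)) (h (rvar Uy2)) = Point x2 y2"
    (is "\<exists>!h. ?H h")
proof (rule ex_ex1I)
  interpret R: comm_ring_hom rstar_of_poly by (rule comm_ring_hom_rstar_of_poly)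
  define g where "g = (\<lambda>v. case v of Ua1 \<Rightarrow> wa1 E | Ua2 \<Rightarrow> wa2 E | Ua3 \<Rightarrow> wa3 E | Ua4 \<Rightarrow> wa4 E
    | Ua6 \<Rightarrow> wa6 E | Ux1 \<Rightarrow> x1 | Uy1 \<Rightarrow> y1 | Ux2 \<Rightarrow> x2 | Uy2 \<Rightarrow> y2)"
  define ev where "ev = upoly_eval g"
  interpret ev: comm_ring_hom ev unfolding ev_def by (rule comm_ring_hom_upoly_eval)
  have ev_pvar: "ev (pvar v) = g v" for v by (simp add: ev_def)
  have f1: "ev f1_poly = 0" and f2: "ev f2_poly = 0"
    using P1 P2 by (simp_all add: weierstrass_poly_def upoly_curve_def ev_def g_def)
  have dx: "ev dx_poly \<noteq> 0" using neq by (simp add: ev_def g_def)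
  have ev_cong: "ev F = ev G" if "rstar_of_poly F = rstar_of_poly G" for F G
  proof -
    have "rstar_of_poly (F - G) = 0" using that by (simp add: R.hom_minus)
    then obtain k u w where "dx_poly ^ k * (F - G) = u * f1_poly + w * f2_poly"
      by (rule rstar_of_poly_eq_0D)
    from arg_cong[OF this, of ev] have "ev dx_poly ^ k * ev (F - G) = 0"
      by (simp only: ev.hom_mult ev.hom_add ev.hom_power f1 f2 mult_zero_right add_0)
    hence "ev (F - G) = 0" using dx by (simp only: mult_eq_0_iff power_eq_0_iff simp_thms)
    thus ?thesis by (simp add: ev.hom_minus)
  qed
  define h where "h = (\<lambda>r. THE c. \<exists>F k. r * rstar_of_poly dx_poly ^ k = rstar_of_poly F
                                     \<and> c = ev F / ev dx_poly ^ k)"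
  have h_eq: "h r = ev F / ev dx_poly ^ k"
    if r: "r * rstar_of_poly dx_poly ^ k = rstar_of_poly F" for r F k
    unfolding h_def
  proof (rule the_equality)
    show "\<exists>F' k'. r * rstar_of_poly dx_poly ^ k' = rstar_of_poly F'
            \<and> ev F / ev dx_poly ^ k = ev F' / ev dx_poly ^ k'" using r by blast
    fix c assume "\<exists>F' k'. r * rstar_of_poly dx_poly ^ k' = rstar_of_poly F'
                            \<and> c = ev F' / ev dx_poly ^ k'"
    then obtain F' k' where r': "r * rstar_of_poly dx_poly ^ k' = rstar_of_poly F'"
      and c: "c = ev F' / ev dx_poly ^ k'" by blast
    have "rstar_of_poly (F * dx_poly ^ k') = rstar_of_poly (F' * dx_poly ^ k)"
      by (simp only: R.hom_mult R.hom_power r[symmetric] r'[symmetric] mult_ac)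
    hence "ev (F * dx_poly ^ k') = ev (F' * dx_poly ^ k)" by (rule ev_cong)
    hence "ev F * ev dx_poly ^ k' = ev F' * ev dx_poly ^ k"
      by (simp only: ev.hom_mult ev.hom_power)
    thus "c = ev F / ev dx_poly ^ k" unfolding c using dx
      by (subst frac_eq_eq) (simp_all only: power_eq_0_iff simp_thms not_False_eq_True)
  qed
  have h_poly: "h (rstar_of_poly F) = ev F" for F using h_eq[of "rstar_of_poly F" 0 F] by simp
  have "comm_ring_hom h"
  proof
    show "h 0 = 0" "h 1 = 1" using h_poly[of 0] h_poly[of 1] by simp_all
    fix r s
    obtain F k where r: "r * rstar_of_poly dx_poly ^ k = rstar_of_poly F" by (rule rstar_cases)
    obtain G l where s: "s * rstar_of_poly dx_poly ^ l = rstar_of_poly G" by (rule rstar_cases)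
    have "(r * s) * rstar_of_poly dx_poly ^ (k + l) = rstar_of_poly (F * G)"
      by (simp only: R.hom_mult r[symmetric] s[symmetric] power_add mult_ac)
    from h_eq[OF this] show "h (r * s) = h r * h s"
      unfolding h_eq[OF r] h_eq[OF s] ev.hom_mult by (simp only: power_add times_divide_times_eq)
    have "(r + s) * rstar_of_poly dx_poly ^ (k + l)
        = (r * rstar_of_poly dx_poly ^ k) * rstar_of_poly dx_poly ^ l
          + (s * rstar_of_poly dx_poly ^ l) * rstar_of_poly dx_poly ^ k"
      by (simp only: power_add distrib_right mult_ac)
    also have "\<dots> = rstar_of_poly (F * dx_poly ^ l + G * dx_poly ^ k)"
      unfolding r s by (simp only: R.hom_add R.hom_mult R.hom_power)
    finally have "h (r + s) = ev (F * dx_poly ^ l + G * dx_poly ^ k) / ev dx_poly ^ (k + l)"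
      by (rule h_eq)
    also have "\<dots> = h r + h s"
      unfolding h_eq[OF r] h_eq[OF s] fract_div_power_add[OF dx]
      by (simp only: ev.hom_add ev.hom_mult ev.hom_power)
    finally show "h (r + s) = h r + h s" .
  qed
  thus "\<exists>h. ?H h"
    by (intro exI[of _ h]) (simp add: rvar_eq h_poly ev_pvar g_def)
next
  interpret R: comm_ring_hom rstar_of_poly by (rule comm_ring_hom_rstar_of_poly)
  fix h h' assume H: "?H h" and H': "?H h'"
  interpret h: comm_ring_hom h using H by simp
  interpret h': comm_ring_hom h' using H' by simp
  have vars: "h (rvar v) = h' (rvar v)" for v
    using H H' by (cases v) auto
  have poly: "h (rstar_of_poly F) = h' (rstar_of_poly F)" for F
  proof (induction F rule: upoly_closure_induct)
    case (var v)
    thus ?case using vars[of v] by (simp add: rvar_eq)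
  qed (simp_all add: R.hom_of_int h.hom_of_int h'.hom_of_int R.hom_add R.hom_mult
        h.hom_add h.hom_mult h'.hom_add h'.hom_mult)
  have "h (rstar_of_poly dx_poly) = x1 - x2"
    using H by (simp add: R.hom_minus h.hom_minus rvar_eq)
  hence dx: "h (rstar_of_poly dx_poly) \<noteq> 0" using neq by simp
  show "h = h'"
  proof
    fix r
    obtain F k where r: "r * rstar_of_poly dx_poly ^ k = rstar_of_poly F" by (rule rstar_cases)
    have "h r * h (rstar_of_poly dx_poly) ^ k = h (rstar_of_poly F)"
      unfolding r[symmetric] by (simp only: h.hom_mult h.hom_power)
    also have "\<dots> = h' (r * rstar_of_poly dx_poly ^ k)" unfolding poly r ..
    also have "\<dots> = h' r * h (rstar_of_poly dx_poly) ^ k"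
      unfolding poly by (simp only: h'.hom_mult h'.hom_power)
    finally show "h r = h' r"
      using dx by (simp only: mult_cancel_right power_eq_0_iff simp_thms)
  qed
qed

definition generic_curve :: "rstar fract weierstrass" where
  "generic_curve =
     map_weierstrass (\<lambda>v. to_fract (rvar v)) (Weierstrass Ua1 Ua2 Ua3 Ua4 Ua6)"

definition gx1 :: "rstar fract" where "gx1 = to_fract (rvar Ux1)"
definition gy1 :: "rstar fract" where "gy1 = to_fract (rvar Uy1)"
definition gx2 :: "rstar fract" where "gx2 = to_fract (rvar Ux2)"
definition gy2 :: "rstar fract" where "gy2 = to_fract (rvar Uy2)"

definition beta1 :: "rstar fract" where
  "beta1 = 2 * gy1 + wa1 generic_curve * gx1 + wa3 generic_curve"

definition beta2 :: "rstar fract" where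
  "beta2 = 3 * gx1 ^ 4 + wb2 generic_curve * gx1 ^ 3 + 3 * wb4 generic_curve * gx1 ^ 2
             + 3 * wb6 generic_curve * gx1 + wb8 generic_curve"

text \<open>
  The recurrence \<open>\<Psi>\<^bsub>m+2\<^esub> \<Psi>\<^bsub>m-2\<^esub> = \<beta>\<^sub>1\<^sup>2 \<Psi>\<^bsub>m+1\<^esub> \<Psi>\<^bsub>m-1\<^esub> - \<beta>\<^sub>2 \<Psi>\<^sub>m\<^sup>2\<close> is solved for \<open>\<Psi>\<^sub>n\<close>
  with \<open>m = n - 2\<close> if \<open>n > 2\<close> and with \<open>m = n + 2\<close> if \<open>n < -1\<close>; the division takes place in the
  fraction field.
\<close>

function Psi :: "int \<Rightarrow> rstar fract" where
  "Psi n =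
     (if n = -1 then gx1 - gx2
      else if n = 0 \<or> n = 1 then 1
      else if n = 2 then
        2 * gx1 + gx2 - ((gy2 - gy1) / (gx2 - gx1)) ^ 2
          - wa1 generic_curve * ((gy2 - gy1) / (gx2 - gx1)) + wa2 generic_curve
      else if n > 2 then
        (beta1 ^ 2 * Psi (n - 1) * Psi (n - 3) - beta2 * Psi (n - 2) ^ 2) / Psi (n - 4)
      else
        (beta1 ^ 2 * Psi (n + 3) * Psi (n + 1) - beta2 * Psi (n + 2) ^ 2) / Psi (n + 4))"
  by auto
termination by (relation "measure (\<lambda>n. nat \<bar>2 * n - 1\<bar>)") auto

declare Psi.simps [simp del]

definition Phi :: "int \<Rightarrow> rstar fract" where
  "Phi n = gx1 * Psi n ^ 2 - Psi (n + 1) * Psi (n - 1)"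

definition Omega :: "int \<Rightarrow> rstar fract" where
  "Omega n =
     (Psi (n - 1) ^ 2 * Psi (n + 2) - Psi (n - 2) * Psi (n + 1) ^ 2
        - beta1 * Psi n * (wa1 generic_curve * Phi n + wa3 generic_curve * Psi n ^ 2)) / (2 * beta1)"

text \<open>
  The value at \<open>(P1, P2)\<close> of an element of the fraction field that lies in \<^typ>\<open>rstar\<close>;
  unspecified for all other elements.
\<close>

definition value_at :: "'a :: field weierstrass \<Rightarrow> 'a point \<Rightarrow> 'a point \<Rightarrow> rstar fract \<Rightarrow> 'a" where
  "value_at E P1 P2 z = specialization E P1 P2 (THE s. to_fract s = z)"


section \<open>Reduction modulo p\<close>

definition reduce_curve :: "'p :: prime_card padic weierstrass \<Rightarrow> 'p mod_ring weierstrass" where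
  "reduce_curve E = map_weierstrass padic_residue E"

text \<open>
  If a point of a curve with p-adic integral coefficients has an integral \<open>x\<close>-coordinate, then
  its \<open>y\<close>-coordinate is integral as well.
\<close>

fun reduce_point :: "'p :: prime_card padic point \<Rightarrow> 'p mod_ring point" where
  "reduce_point Infinity = Infinity"
| "reduce_point (Point x y) =
     (if x \<in> padic_integers then Point (padic_residue x) (padic_residue y) else Infinity)"

end

theory Submission
  imports Defs "HOL-Number_Theory.Totient"
begin

text \<open>
  The sequence \<open>\<Psi>\<close> satisfies a Somos-4 recurrence and hence, by a conserved quantity, a Somos-5
  recurrence. Both hold for a universal sequence of polynomials with integer coefficients; there
  the division in the Somos-4 recurrence is exact because consecutive terms are coprime. So all
  \<open>\<Psi>\<^sub>n\<close> lie in \<open>R\<^sup>*\<close>, and a divisibility in the universal ring gives the same for \<open>\<Omega>\<^sub>n\<close>.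

  Specialized to the p-adic integers, \<open>\<beta>\<^sub>2\<close> is a unit since the order of the reduction of \<open>P\<^sub>1\<close>
  exceeds 3, so no two consecutive terms vanish modulo \<open>p\<close>. Then the two recurrences together determine
  the sequence modulo \<open>p\<close> from five consecutive terms, which makes it periodic modulo \<open>p\<close>. If \<open>T\<close> is a
  period modulo \<open>p\<^sup>h\<close>, then \<open>(\<Psi>\<^bsub>n+T\<^esub> - \<Psi>\<^sub>n) / p\<^sup>h\<close> modulo \<open>p\<close> solves the linearized recurrences over
  the field with \<open>p\<close> elements, whose solutions have a common period \<open>M\<close> independent of \<open>h\<close>; if \<open>M\<close>
  divides \<open>T\<close>, then summing over \<open>p\<close> steps shows that \<open>p T\<close> is a period modulo \<open>p\<^bsup>h+1\<^esup>\<close>. So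
  \<open>\<Psi>\<close> has period \<open>M p\<^sup>h\<close> modulo \<open>p\<^bsup>h+1\<^esup>\<close>, and any power \<open>q\<close> of \<open>p\<close> that is congruent to 1 modulo
  the prime-to-\<open>p\<close> part of \<open>M\<close> works.
\<close>

section \<open>Somos-4 sequences\<close>

text \<open>For \<open>Psi\<close> the coefficients are \<open>a = beta1 ^ 2\<close> and
  \<open>b = - beta2\<close>, whence the plus sign.\<close>

definition somos4 :: "'a :: comm_ring_1 \<Rightarrow> 'a \<Rightarrow> (int \<Rightarrow> 'a) \<Rightarrow> bool" where
  "somos4 a b f \<longleftrightarrow> (\<forall>m. f (m + 2) * f (m - 2) = a * f (m + 1) * f (m - 1) + b * f m ^ 2)"

definition somos5 :: "'a :: comm_ring_1 \<Rightarrow> 'a \<Rightarrow> (int \<Rightarrow> 'a) \<Rightarrow> bool" where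
  "somos5 b c f \<longleftrightarrow> (\<forall>m. f (m + 3) * f (m - 2) + b * f (m + 2) * f (m - 1) = c * f (m + 1) * f m)"

text \<open>
  The conserved quantity of a Somos-4 sequence, cleared of denominators and of the coefficient \<open>b\<close>.
\<close>

definition somos_invariant :: "'a :: comm_ring_1 \<Rightarrow> 'a \<Rightarrow> 'a \<Rightarrow> 'a \<Rightarrow> 'a \<Rightarrow> 'a \<Rightarrow> 'a \<Rightarrow> bool" where
  "somos_invariant a T g0 g1 g2 g3 g4 \<longleftrightarrow>
     g4 * g1 ^ 2 + a * g2 ^ 3 + g3 ^ 2 * g0 = T * g1 * g2 * g3"

text \<open>\<open>g1\<close> times the new relation is a combination of the old relation and the
  two recurrences, in which all terms with \<open>b\<close> cancel. The value \<open>T\<close>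
  therefore stays the same along the sequence.\<close>

lemma somos_invariant_step:
  fixes a b T :: "'a :: idom"
  assumes inv: "somos_invariant a T g0 g1 g2 g3 g4"
    and s: "g4 * g0 = a * g3 * g1 + b * g2 ^ 2" "g5 * g1 = a * g4 * g2 + b * g3 ^ 2"
    and nz: "g1 \<noteq> 0"
  shows "somos_invariant a T g1 g2 g3 g4 g5"
proof -
  have "(g5 * g2 ^ 2 + a * g3 ^ 3 + g4 ^ 2 * g1) * g1 - (T * g2 * g3 * g4) * g1
      = g2 ^ 2 * (g5 * g1 - (a * g4 * g2 + b * g3 ^ 2))
        + g4 * (g4 * g1 ^ 2 + a * g2 ^ 3 + g3 ^ 2 * g0 - T * g1 * g2 * g3)
        - g3 ^ 2 * (g4 * g0 - (a * g3 * g1 + b * g2 ^ 2))"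
    by (simp add: algebra_simps power2_eq_square power3_eq_cube)
  also have "\<dots> = 0" using inv s by (simp add: somos_invariant_def)
  finally show ?thesis using nz by (simp add: somos_invariant_def flip: left_diff_distrib)
qed

text \<open>The left factor is the numerator in the recurrence for the next term \<open>g5\<close>.
  If \<open>g0\<close> and \<open>g1\<close> are coprime, then \<open>g1\<close> divides it, so the
  division is exact; if it is replaced by \<open>g5 * g1\<close>, cancelling \<open>g1\<close>
  leaves the Somos-5 relation.\<close>

lemma somos_step_times:
  fixes a b T :: "'a :: comm_ring_1"
  assumes "somos_invariant a T g0 g1 g2 g3 g4"
    and "g4 * g0 = a * g3 * g1 + b * g2 ^ 2"
  shows "(a * g4 * g2 + b * g3 ^ 2) * g0 = g1 * ((a ^ 2 + b * T) * g3 * g2 - b * g4 * g1)"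
proof -
  have "(a * g4 * g2 + b * g3 ^ 2) * g0 - g1 * ((a ^ 2 + b * T) * g3 * g2 - b * g4 * g1)
      = a * g2 * (g4 * g0 - (a * g3 * g1 + b * g2 ^ 2))
        + b * (g4 * g1 ^ 2 + a * g2 ^ 3 + g3 ^ 2 * g0 - T * g1 * g2 * g3)"
    by (simp add: algebra_simps power2_eq_square power3_eq_cube)
  also have "\<dots> = 0" using assms by (simp add: somos_invariant_def)
  finally show ?thesis by simp
qed

text \<open>This evaluates test homomorphisms: one that sends the initial values and
  \<open>a + b\<close> to 1 sends every term to 1, so no term can vanish.\<close>

lemma somos4_constant_one:
  fixes f :: "int \<Rightarrow> 'a :: comm_ring_1"
  assumes f: "somos4 a b f" and ab: "a + b = 1"
    and init: "f (-1) = 1" "f 0 = 1" "f 1 = 1" "f 2 = 1"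
  shows "f n = 1"
proof -
  have "f n = 1 \<and> f (n + 1) = 1 \<and> f (n + 2) = 1 \<and> f (n + 3) = 1"
  proof (induction n rule: int_induct[where k = "-1"])
    case base
    show ?case using init by simp
  next
    case (step1 i)
    have "f (i + 4) * f i = a * f (i + 3) * f (i + 1) + b * f (i + 2) ^ 2"
      using f[unfolded somos4_def, rule_format, of "i + 2"] by (simp add: add.assoc add.commute[of 1])
    thus ?case using step1 ab by (simp add: add.assoc)
  next
    case (step2 i)
    have "f (i + 3) * f (i - 1) = a * f (i + 2) * f i + b * f (i + 1) ^ 2"
      using f[unfolded somos4_def, rule_format, of "i + 1"] by (simp add: add.assoc)
    thus ?case using step2 ab by (simp add: algebra_simps)
  qed
  thus ?thesis by blast
qed

section \<open>Exactness of the division in the Somos-4 recurrence\<close>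

fun somos_seq :: "'a :: idom_divide \<Rightarrow> 'a \<Rightarrow> 'a \<Rightarrow> 'a \<Rightarrow> nat \<Rightarrow> 'a" where
  "somos_seq a b u v 0 = u"
| "somos_seq a b u v (Suc 0) = 1"
| "somos_seq a b u v (Suc (Suc 0)) = 1"
| "somos_seq a b u v (Suc (Suc (Suc 0))) = v"
| "somos_seq a b u v (Suc (Suc (Suc (Suc n)))) =
     (a * somos_seq a b u v (Suc (Suc (Suc n))) * somos_seq a b u v (Suc n)
        + b * somos_seq a b u v (Suc (Suc n)) ^ 2) div somos_seq a b u v n"

lemma not_coprimeE:
  fixes x y :: "'a :: factorial_semiring"
  assumes "\<not> coprime x y" "x \<noteq> 0"
  obtains p where "prime_elem p" "p dvd x" "p dvd y"
proof -
  obtain d where d: "d dvd x" "d dvd y" "\<not> is_unit d"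
    using assms(1) by (auto simp: coprime_def)
  moreover have "d \<noteq> 0" using d(1) assms(2) by auto
  ultimately obtain p where "prime_elem p" "p dvd d" using prime_divisor_exists by blast
  thus ?thesis using that d dvd_trans by blast
qed

text \<open>The induction carries the conserved quantity and the coprimality of neighbours along
  with the recurrence: the first two make the next division exact, and the recurrence passes
  coprimality on. The homomorphism \<open>h\<close> rules out \<open>b\<close>, the one prime that
  could be a common divisor.\<close>

lemma somos_seq_rec:
  fixes a t u v :: "'a :: {factorial_ring_gcd, semiring_gcd_mult_normalize}"
  assumes b: "b = u * v * t - a * (u + v)" and prime: "prime_elem b"
    and h: "comm_ring_hom (h :: 'a \<Rightarrow> int)" "h a = 1" "h b = 0" "h u = 1" "h v = 1"
  shows "somos_seq a b u v (n + 4) * somos_seq a b u v n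
           = a * somos_seq a b u v (n + 3) * somos_seq a b u v (n + 1)
             + b * somos_seq a b u v (n + 2) ^ 2"
proof -
  interpret h: comm_ring_hom h by (rule h(1))
  define g where "g = somos_seq a b u v"
  \<comment> \<open>The value of the conserved quantity on the first window
    \<open>u, 1, 1, v, v * t - a\<close>.\<close>
  define T where "T = u * v + t"
  have g_simps: "g 0 = u" "g (Suc 0) = 1" "g (Suc (Suc 0)) = 1" "g 2 = 1" "g 3 = v"
    by (simp_all add: g_def eval_nat_numeral)
  have g_rec: "g (n + 4) = (a * g (n + 3) * g (n + 1) + b * g (n + 2) ^ 2) div g n" for n
    by (simp add: g_def eval_nat_numeral)
  have b_ndvd: "\<not> b dvd x" if "h x = 1" for x
    using that h(3) by (auto elim!: dvdE simp: h.hom_mult)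
  \<comment> \<open>A common prime divisor of two consecutive terms divides \<open>b g2\<^sup>2\<close>, so it is associated to \<open>b\<close>;
    but \<open>h\<close> maps \<open>b\<close> to 0 and all terms to 1.\<close>
  have coprime_step: "coprime g4 g3"
    if "g4 * g0 = a * g3 * g1 + b * g2 ^ 2" "coprime g3 g2" "h g4 = 1" for g0 g1 g2 g3 g4
  proof (rule ccontr)
    assume "\<not> coprime g4 g3"
    moreover have "g4 \<noteq> 0" using that(3) h.hom_zero by auto
    ultimately obtain p where p: "prime_elem p" "p dvd g4" "p dvd g3" by (rule not_coprimeE)
    have "b * g2 ^ 2 = g4 * g0 - a * g3 * g1" using that(1) by simp
    also have "p dvd \<dots>" using p(2,3) by simp
    finally have "p dvd b \<or> p dvd g2"
      using p(1) prime_elem_dvd_mult_iff prime_elem_dvd_power by blast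
    moreover have "\<not> p dvd g2"
      using that(2) p(1,3) unfolding coprime_def prime_elem_def by blast
    ultimately have "p dvd b" by blast
    hence "b dvd p"
      using p(1) prime prime_elem_imp_irreducible irreducibleD' prime_elem_not_unit by metis
    thus False using p(2) b_ndvd[OF that(3)] dvd_trans by blast
  qed
  have "(g (n + 4) * g n = a * g (n + 3) * g (n + 1) + b * g (n + 2) ^ 2) \<and>
    somos_invariant a T (g n) (g (n + 1)) (g (n + 2)) (g (n + 3)) (g (n + 4)) \<and>
    coprime (g (n + 1)) (g n) \<and> coprime (g (n + 2)) (g (n + 1)) \<and>
    coprime (g (n + 3)) (g (n + 2)) \<and> coprime (g (n + 4)) (g (n + 3)) \<and>
    h (g n) = 1 \<and> h (g (n + 1)) = 1 \<and> h (g (n + 2)) = 1 \<and> h (g (n + 3)) = 1 \<and> h (g (n + 4)) = 1"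
  proof (induction n)
    case 0
    have u: "u \<noteq> 0" using h(4) h.hom_zero by auto
    \<comment> \<open>The prescribed form of \<open>b\<close> is what makes the first division, by
      \<open>u\<close>, exact.\<close>
    have "a * v + b = u * (v * t - a)" by (simp add: b algebra_simps)
    moreover have "g 4 = (a * v + b) div u" by (simp add: g_def eval_nat_numeral)
    ultimately have g4: "g 4 = v * t - a" using u by simp
    have s: "g 4 * g 0 = a * g 3 * g 1 + b * g 2 ^ 2"
      by (simp add: g_simps g4 b algebra_simps)
    have "h (g 4) * h u = 1"
      using arg_cong[OF s, of h] h by (simp add: g_simps h.hom_mult h.hom_add)
    hence h4: "h (g 4) = 1" using h by simp
    have "coprime (g 4) (g 3)" by (rule coprime_step[OF s _ h4]) (simp add: g_simps)
    moreover have "somos_invariant a T (g 0) (g 1) (g 2) (g 3) (g 4)"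
      by (simp add: somos_invariant_def g_simps g4 T_def power2_eq_square algebra_simps)
    ultimately show ?case using s h4 h g_simps by simp
  next
    case (Suc n)
    define g0 g1 g2 g3 g4 g5 where
      gs: "g0 = g n" "g1 = g (n + 1)" "g2 = g (n + 2)" "g3 = g (n + 3)" "g4 = g (n + 4)" "g5 = g (n + 5)"
    have IH: "g4 * g0 = a * g3 * g1 + b * g2 ^ 2" "somos_invariant a T g0 g1 g2 g3 g4"
      "coprime g1 g0" "coprime g2 g1" "coprime g3 g2" "coprime g4 g3"
      "h g0 = 1" "h g1 = 1" "h g2 = 1" "h g3 = 1" "h g4 = 1"
      using Suc by (simp_all only: gs)
    have "g1 dvd (a * g4 * g2 + b * g3 ^ 2) * g0"
      unfolding somos_step_times[OF IH(2,1)] by simp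
    hence "g1 dvd a * g4 * g2 + b * g3 ^ 2"
      using IH(3) by (simp add: coprime_dvd_mult_left_iff)
    moreover have "g5 = (a * g4 * g2 + b * g3 ^ 2) div g1"
      using g_rec[of "n + 1"] by (simp add: gs eval_nat_numeral)
    ultimately have s: "g5 * g1 = a * g4 * g2 + b * g3 ^ 2" by simp
    have g1: "g1 \<noteq> 0" using IH(8) h.hom_zero by auto
    have "h g5 * h g1 = h (a * g4 * g2 + b * g3 ^ 2)" unfolding s[symmetric] by (simp add: h.hom_mult)
    hence h5: "h g5 = 1" using IH h by (simp add: h.hom_mult h.hom_add)
    have "somos_invariant a T g1 g2 g3 g4 g5" by (rule somos_invariant_step[OF IH(2,1) s g1])
    moreover have "coprime g5 g4" by (rule coprime_step[OF s IH(6) h5])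
    ultimately show ?case using s h5 IH(4-11) by (simp add: gs eval_nat_numeral)
  qed
  thus ?thesis by (simp add: g_def)
qed

text \<open>The recurrence is symmetric under \<open>n \<mapsto> 1 - n\<close> together with the exchange of \<open>u\<close> and \<open>v\<close>.\<close>

definition somos_net :: "'a :: idom_divide \<Rightarrow> 'a \<Rightarrow> 'a \<Rightarrow> 'a \<Rightarrow> int \<Rightarrow> 'a" where
  "somos_net a b u v n =
     (if n \<ge> -1 then somos_seq a b u v (nat (n + 1)) else somos_seq a b v u (nat (2 - n)))"

lemma somos_net_upper: "n \<ge> -1 \<Longrightarrow> somos_net a b u v n = somos_seq a b u v (nat (n + 1))"
  by (simp add: somos_net_def)

lemma somos_net_init:
  "somos_net a b u v (-1) = u" "somos_net a b u v 0 = 1"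
  "somos_net a b u v 1 = 1" "somos_net a b u v 2 = v"
  by (simp_all add: somos_net_def eval_nat_numeral)

lemma somos_net_lower:
  assumes "n \<le> 2"
  shows "somos_net a b u v n = somos_seq a b v u (nat (2 - n))"
proof (cases "n \<ge> -1")
  case True
  hence "n = -1 \<or> n = 0 \<or> n = 1 \<or> n = 2" using assms by auto
  thus ?thesis by (auto simp: somos_net_init eval_nat_numeral)
qed (simp add: somos_net_def)

text \<open>For \<open>m >= 1\<close> all five indices are at least -1, otherwise all are at most 2,
  so one of the two branches covers the whole relation. The condition on \<open>b\<close> is
  symmetric in \<open>u\<close> and \<open>v\<close>, hence the reflected branch satisfies it
  too.\<close>

lemma somos4_somos_net:
  fixes a t u v :: "'a :: {factorial_ring_gcd, semiring_gcd_mult_normalize}"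
  assumes b: "b = u * v * t - a * (u + v)" and prime: "prime_elem b"
    and h: "comm_ring_hom (h :: 'a \<Rightarrow> int)" "h a = 1" "h b = 0" "h u = 1" "h v = 1"
  shows "somos4 a b (somos_net a b u v)"
  unfolding somos4_def
proof
  fix m :: int
  show "somos_net a b u v (m + 2) * somos_net a b u v (m - 2)
      = a * somos_net a b u v (m + 1) * somos_net a b u v (m - 1) + b * somos_net a b u v m ^ 2"
  proof (cases "m \<ge> 1")
    case True
    define n where "n = nat (m - 1)"
    have n: "nat (m - 2 + 1) = n" "nat (m - 1 + 1) = n + 1" "nat (m + 1) = n + 2"
      "nat (m + 1 + 1) = n + 3" "nat (m + 2 + 1) = n + 4"
      using True by (auto simp: n_def)
    show ?thesis
      using somos_seq_rec[OF assms, of n] True by (simp only: somos_net_upper n)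
  next
    case False
    define n where "n = nat (- m)"
    have n: "nat (2 - (m - 2)) = n + 4" "nat (2 - (m - 1)) = n + 3" "nat (2 - m) = n + 2"
      "nat (2 - (m + 1)) = n + 1" "nat (2 - (m + 2)) = n"
      using False by (auto simp: n_def)
    have b': "b = v * u * t - a * (v + u)" by (simp add: b algebra_simps)
    have "somos_net a b u v (m + 2) = somos_seq a b v u n"
      "somos_net a b u v (m + 1) = somos_seq a b v u (n + 1)"
      "somos_net a b u v m = somos_seq a b v u (n + 2)"
      "somos_net a b u v (m - 1) = somos_seq a b v u (n + 3)"
      "somos_net a b u v (m - 2) = somos_seq a b v u (n + 4)"
      using False somos_net_lower[of "m + 2" a b u v, unfolded n]
        somos_net_lower[of "m + 1" a b u v, unfolded n] somos_net_lower[of m a b u v, unfolded n]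
        somos_net_lower[of "m - 1" a b u v, unfolded n] somos_net_lower[of "m - 2" a b u v, unfolded n]
      by simp_all
    thus ?thesis
      using somos_seq_rec[OF b' prime h(1,2,3,5,4), of n] by (simp add: mult_ac)
  qed
qed

section \<open>Two-sided sequences: conserved quantity and Somos-5 relation\<close>

lemma somos_invariant_rev:
  "somos_invariant a T g0 g1 g2 g3 g4 \<longleftrightarrow> somos_invariant a T g4 g3 g2 g1 g0"
  by (auto simp: somos_invariant_def algebra_simps)

text \<open>The conserved quantity is computed on the window around 0, where
  \<open>f (-2) = u * t - a\<close>, and moved both ways; the downward step is the upward step for
  the reversed window.\<close>

lemma somos4_imp_invariant:
  fixes f :: "int \<Rightarrow> 'a :: idom"
  assumes f: "somos4 a b f" and nz: "\<And>n. f n \<noteq> 0"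
    and init: "f (-1) = u" "f 0 = 1" "f 1 = 1" "f 2 = v"
    and b: "b = u * v * t - a * (u + v)"
  shows "somos_invariant a (u * v + t) (f (m - 2)) (f (m - 1)) (f m) (f (m + 1)) (f (m + 2))"
proof (induction m rule: int_induct[where k = 0])
  case base
  have "v * f (-2) = v * (u * t - a)"
    using f[unfolded somos4_def, rule_format, of 0] by (simp add: init b algebra_simps)
  hence "f (-2) = u * t - a" using nz[of 2] init by simp
  thus ?case by (simp add: somos_invariant_def init power2_eq_square algebra_simps)
next
  case (step1 i)
  show ?case
    using somos_invariant_step[OF step1(2) f[unfolded somos4_def, rule_format], of "f (i + 3)"]
      f[unfolded somos4_def, rule_format, of "i + 1"] nz
    by (simp add: algebra_simps)
next
  case (step2 i)
  have "f (i - 2) * f (i + 2) = a * f (i - 1) * f (i + 1) + b * f i ^ 2"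
    using f[unfolded somos4_def, rule_format, of i] by (simp add: mult_ac)
  from somos_invariant_step[OF step2(2)[unfolded somos_invariant_rev[of _ _ "f (i - 2)"]] this,
      of "f (i - 3)"]
  show ?case using f[unfolded somos4_def, rule_format, of "i - 1"] nz
    by (subst somos_invariant_rev) (simp add: algebra_simps)
qed

text \<open>Multiply by \<open>f (m - 1)\<close>, replace \<open>f (m + 3) * f (m - 1)\<close> by
  the Somos-4 recurrence, apply \<open>somos_step_times\<close>, and cancel.\<close>

lemma somos4_imp_somos5:
  fixes f :: "int \<Rightarrow> 'a :: idom"
  assumes f: "somos4 a b f" and nz: "\<And>n. f n \<noteq> 0"
    and init: "f (-1) = u" "f 0 = 1" "f 1 = 1" "f 2 = v"
    and b: "b = u * v * t - a * (u + v)"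
  shows "somos5 b (a ^ 2 + b * (u * v + t)) f"
  unfolding somos5_def
proof
  fix m
  have s4: "f (m + 2) * f (m - 2) = a * f (m + 1) * f (m - 1) + b * f m ^ 2" for m
    using f by (simp add: somos4_def)
  have s: "f (m + 3) * f (m - 1) = a * f (m + 2) * f m + b * f (m + 1) ^ 2"
    using s4[of "m + 1"] by (simp add: algebra_simps)
  have "(f (m + 3) * f (m - 2) + b * f (m + 2) * f (m - 1)) * f (m - 1)
      = (f (m + 3) * f (m - 1)) * f (m - 2) + f (m - 1) * (b * f (m + 2) * f (m - 1))"
    by (simp add: algebra_simps)
  also have "\<dots> = ((a ^ 2 + b * (u * v + t)) * f (m + 1) * f m) * f (m - 1)"
    unfolding s somos_step_times[OF somos4_imp_invariant[OF f nz init b] s4]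
    by (simp add: algebra_simps)
  finally show "f (m + 3) * f (m - 2) + b * f (m + 2) * f (m - 1)
      = (a ^ 2 + b * (u * v + t)) * f (m + 1) * f m"
    using nz[of "m - 1"] by simp
qed

text \<open>Let \<open>r m = f (m + 2) * f (m - 1) / (f m * f (m + 1))\<close>. Modulo
  \<open>p\<close> the recurrence says \<open>r m * r (m - 1) = (u * v) ^ 2\<close>, and
  \<open>r 0 = u * v\<close>, so every \<open>r m\<close> is \<open>u * v\<close>. With
  \<open>p\<close> the variable for \<open>beta1\<close> this gives the divisibility behind the
  integrality of \<open>Omega\<close>.\<close>

lemma somos4_degenerate_dvd:
  fixes f :: "int \<Rightarrow> 'a :: idom"
  assumes f: "somos4 a b f" and p: "prime_elem p" and a: "p dvd a" and b: "p dvd b - (u * v) ^ 2"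
    and ndvd: "\<And>n. \<not> p dvd f n"
    and init: "f (-1) = u" "f 0 = 1" "f 1 = 1" "f 2 = v"
  shows "p dvd f (m + 2) * f (m - 1) - u * v * f m * f (m + 1)"
proof (induction m rule: int_induct[where k = 0])
  case base
  show ?case by (simp add: init mult.commute)
next
  case (step1 i)
  have "(f (i + 3) * f i - u * v * f (i + 1) * f (i + 2)) * f (i - 1)
      = f i * (f (i + 3) * f (i - 1)) - u * v * f (i + 1) * (f (i + 2) * f (i - 1))"
    by (simp add: algebra_simps)
  also have "f (i + 3) * f (i - 1) = a * f (i + 2) * f i + b * f (i + 1) ^ 2"
    using f[unfolded somos4_def, rule_format, of "i + 1"] by (simp add: algebra_simps)
  also have "f i * (a * f (i + 2) * f i + b * f (i + 1) ^ 2) - u * v * f (i + 1) * (f (i + 2) * f (i - 1))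
      = a * (f i ^ 2 * f (i + 2)) + (b - (u * v) ^ 2) * (f i * f (i + 1) ^ 2)
        - u * v * f (i + 1) * (f (i + 2) * f (i - 1) - u * v * f i * f (i + 1))"
    by (simp add: algebra_simps power2_eq_square)
  also have "p dvd \<dots>"
    by (intro dvd_add dvd_diff dvd_mult2[OF a] dvd_mult2[OF b] dvd_mult[OF step1(2)])
  finally have "p dvd f (i + 3) * f i - u * v * f (i + 1) * f (i + 2)"
    using p ndvd[of "i - 1"] prime_elem_dvd_mult_iff by blast
  thus ?case by (simp add: algebra_simps)
next
  case (step2 i)
  have "(f (i + 1) * f (i - 2) - u * v * f (i - 1) * f i) * f (i + 2)
      = f (i + 1) * (f (i + 2) * f (i - 2)) - u * v * f i * (f (i + 2) * f (i - 1))"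
    by (simp add: algebra_simps)
  also have "f (i + 2) * f (i - 2) = a * f (i + 1) * f (i - 1) + b * f i ^ 2"
    using f[unfolded somos4_def, rule_format, of i] .
  also have "f (i + 1) * (a * f (i + 1) * f (i - 1) + b * f i ^ 2) - u * v * f i * (f (i + 2) * f (i - 1))
      = a * (f (i + 1) ^ 2 * f (i - 1)) + (b - (u * v) ^ 2) * (f (i + 1) * f i ^ 2)
        - u * v * f i * (f (i + 2) * f (i - 1) - u * v * f i * f (i + 1))"
    by (simp add: algebra_simps power2_eq_square)
  also have "p dvd \<dots>"
    by (intro dvd_add dvd_diff dvd_mult2[OF a] dvd_mult2[OF b] dvd_mult[OF step2(2)])
  finally have "p dvd f (i + 1) * f (i - 2) - u * v * f (i - 1) * f i"
    using p ndvd[of "i + 2"] prime_elem_dvd_mult_iff by blast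
  thus ?case by (simp add: algebra_simps)
qed


section \<open>The universal sequence\<close>

definition eval_poly_hom :: "('a :: comm_ring_1 \<Rightarrow> 'b :: comm_ring_1) \<Rightarrow> 'b \<Rightarrow> 'a poly \<Rightarrow> 'b" where
  "eval_poly_hom h x F = poly (map_poly h F) x"

lemma comm_ring_hom_eval_poly_hom:
  assumes "comm_ring_hom h"
  shows "comm_ring_hom (eval_poly_hom h x)"
proof -
  interpret h: comm_ring_hom h by (rule assms)
  interpret map_poly_comm_ring_hom h ..
  show ?thesis
    by standard (simp_all add: eval_poly_hom_def hom_distribs)
qed

lemma eval_poly_hom_simps:
  assumes "comm_ring_hom h"
  shows "eval_poly_hom h x [:c:] = h c" "eval_poly_hom h x [:0, 1:] = x"
proof -
  interpret h: comm_ring_hom h by (rule assms)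
  show "eval_poly_hom h x [:c:] = h c" "eval_poly_hom h x [:0, 1:] = x"
    by (cases "c = 0") (simp_all add: eval_poly_hom_def map_poly_pCons)
qed

text \<open>Nested univariate polynomials form a factorial ring with exact division, as
  \<open>somos_seq_rec\<close> requires. The variable \<open>U_s\<close> is outermost because
  \<open>U_beta\<close> has degree 1 in it.\<close>

type_synonym poly4 = "int poly poly poly poly"

text \<open>
  The variables stand for \<open>\<Psi>\<^bsub>-1\<^esub>\<close>, \<open>\<Psi>\<^sub>2\<close>, \<open>\<beta>\<^sub>1\<close> and \<open>\<alpha>\<^sub>1 + 2 \<lambda>\<close>, where \<open>\<lambda>\<close> is the slope of the chord
  through \<open>P\<^sub>1\<close> and \<open>P\<^sub>2\<close>; then \<open>-\<beta>\<^sub>2\<close> becomes the polynomial \<open>U_beta\<close> below.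
\<close>

definition U_u :: poly4 where "U_u = [:[:[:[:0, 1:]:]:]:]"
definition U_v :: poly4 where "U_v = [:[:[:0, 1:]:]:]"
definition U_b :: poly4 where "U_b = [:[:0, 1:]:]"
definition U_s :: poly4 where "U_s = [:0, 1:]"

definition eval4 :: "'a :: comm_ring_1 \<Rightarrow> 'a \<Rightarrow> 'a \<Rightarrow> 'a \<Rightarrow> poly4 \<Rightarrow> 'a" where
  "eval4 u v b s = eval_poly_hom (eval_poly_hom (eval_poly_hom (eval_poly_hom of_int u) v) b) s"

lemma comm_ring_hom_of_int: "comm_ring_hom (of_int :: int \<Rightarrow> 'a :: comm_ring_1)"
  by standard auto

lemma comm_ring_hom_eval4: "comm_ring_hom (eval4 u v b s)"
  unfolding eval4_def by (intro comm_ring_hom_eval_poly_hom comm_ring_hom_of_int)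

lemma eval4_gens [simp]:
  "eval4 u v b s U_u = u" "eval4 u v b s U_v = v" "eval4 u v b s U_b = b" "eval4 u v b s U_s = s"
  unfolding eval4_def U_u_def U_v_def U_b_def U_s_def
  by (simp_all add: eval_poly_hom_simps comm_ring_hom_eval_poly_hom comm_ring_hom_of_int)

text \<open>This is \<open>u * v * t - a * (u + v)\<close> with \<open>a = b ^ 2\<close> and
  \<open>t = u * v + b * s\<close>.\<close>

definition U_beta :: poly4 where
  "U_beta = U_u * U_v * (U_u * U_v + U_b * U_s) - U_b ^ 2 * (U_u + U_v)"

section \<open>Primality of the coefficient \<open>U_beta\<close>\<close>

lemma prime_elem_X: "prime_elem [:0, 1 :: 'a :: idom_divide:]"
proof (rule prime_elemI)
  have dvd: "[:0, 1:] dvd p \<longleftrightarrow> poly p 0 = (0 :: 'a)" for p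
    using poly_eq_0_iff_dvd[of p 0] by simp
  show "\<not> is_unit [:0, 1 :: 'a:]"
  proof
    assume "is_unit [:0, 1 :: 'a:]"
    thus False using dvd[of 1] by simp
  qed
  show "[:0, 1:] dvd p \<or> [:0, 1:] dvd q" if "[:0, 1:] dvd p * q" for p q :: "'a poly"
    using that by (simp add: dvd)
qed simp

text \<open>One factor of a linear polynomial is constant; it divides both coefficients and so is a
  unit. In a factorial ring irreducible elements are prime.\<close>

lemma prime_elem_linear:
  fixes c0 c1 :: "'a :: {factorial_ring_gcd, semiring_gcd_mult_normalize}"
  assumes "coprime c0 c1" "c1 \<noteq> 0"
  shows "prime_elem [:c0, c1:]"
proof (rule irreducible_imp_prime_elem)
  show "irreducible [:c0, c1:]"
  proof (rule irreducibleI)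
    show "[:c0, c1:] \<noteq> 0" using assms by simp
    show "\<not> is_unit [:c0, c1:]" using assms(2) by (auto simp: is_unit_poly_iff)
    fix p q assume pq: "[:c0, c1:] = p * q"
    have unit: "is_unit r" if r: "r dvd [:c0, c1:]" and deg: "degree r = 0" for r
    proof -
      obtain c where c: "r = [:c:]" using deg by (rule degree_eq_zeroE)
      hence "c dvd c0" "c dvd c1" using r const_poly_dvd_iff[of c "[:c0, c1:]"] by (force dest: spec[of _ 0] spec[of _ 1])+
      thus ?thesis using assms(1) c by (auto simp: coprime_def is_unit_const_poly_iff)
    qed
    have "p \<noteq> 0" "q \<noteq> 0" using pq assms(2) by auto
    hence "degree p + degree q = 1" using arg_cong[OF pq, of degree] assms(2)
      by (simp add: degree_mult_eq)
    hence "degree p = 0 \<or> degree q = 0" by linarith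
    thus "is_unit p \<or> is_unit q" using unit[of p] unit[of q] pq by auto
  qed
qed

lemma coprime_X_const:
  fixes c :: "'a :: {factorial_ring_gcd, semiring_gcd_mult_normalize}"
  assumes "c \<noteq> 0"
  shows "coprime [:0, 1:] [:c:]"
proof -
  have "\<not> [:0, 1:] dvd [:c:]" using poly_eq_0_iff_dvd[of "[:c:]" 0] assms by simp
  thus ?thesis using prime_elem_X prime_elem_imp_coprime by blast
qed

lemma prime_elem_U_b: "prime_elem U_b"
  unfolding U_b_def by (subst prime_elem_const_poly_iff) (rule prime_elem_X)

text \<open>As a linear polynomial in \<open>U_s\<close> it has coefficients
  \<open>(u * v) ^ 2 - b ^ 2 * (u + v)\<close> and \<open>u * v * b\<close>. A common prime divisor
  divides one of \<open>u\<close>, \<open>v\<close>, \<open>b\<close> by the second coefficient and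
  then another one by the first, but these are pairwise coprime.\<close>

lemma prime_elem_U_beta: "prime_elem U_beta"
proof -
  define u v :: "int poly poly poly" where "u = [:[:[:0, 1:]:]:]" and "v = [:[:0, 1:]:]"
  define b :: "int poly poly poly" where "b = [:0, 1:]"
  have "\<not> [:0, 1:] dvd ([:[:0, 1:]:] :: int poly poly)"
    using poly_eq_0_iff_dvd[of "[:[:0, 1:]:] :: int poly poly" 0] by simp
  hence "\<not> v dvd u" by (simp add: u_def v_def const_poly_dvd_const_poly_iff)
  moreover have "prime_elem v" unfolding v_def by (subst prime_elem_const_poly_iff) (rule prime_elem_X)
  ultimately have uv: "coprime u v" using prime_elem_imp_coprime coprime_commute by blast
  have "coprime b u" "coprime b v"
    unfolding b_def u_def v_def by (rule coprime_X_const, simp)+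
  have eq: "U_beta = [:(u * v) ^ 2 - b ^ 2 * (u + v), u * v * b:]"
    by (simp add: U_beta_def U_u_def U_v_def U_b_def U_s_def u_def v_def b_def power2_eq_square algebra_simps)
  show ?thesis unfolding eq
  proof (rule prime_elem_linear)
    show "u * v * b \<noteq> 0" by (simp add: u_def v_def b_def)
    show "coprime ((u * v) ^ 2 - b ^ 2 * (u + v)) (u * v * b)"
    proof (rule ccontr)
      assume "\<not> coprime ((u * v) ^ 2 - b ^ 2 * (u + v)) (u * v * b)"
      hence "\<not> coprime (u * v * b) ((u * v) ^ 2 - b ^ 2 * (u + v))" by (simp add: coprime_commute)
      moreover have "u * v * b \<noteq> 0" by (simp add: u_def v_def b_def)
      ultimately obtain p where p: "prime_elem p" "p dvd u * v * b" "p dvd (u * v) ^ 2 - b ^ 2 * (u + v)"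
        by (rule not_coprimeE)
      have disj: "\<not> (p dvd u \<and> p dvd v)" "\<not> (p dvd b \<and> p dvd u)" "\<not> (p dvd b \<and> p dvd v)"
        using uv \<open>coprime b u\<close> \<open>coprime b v\<close> p(1) unfolding coprime_def prime_elem_def by blast+
      have "p dvd u \<or> p dvd v \<or> p dvd b"
        using p(1,2) by (auto simp: prime_elem_dvd_mult_iff)
      thus False
      proof (elim disjE)
        assume b: "p dvd b"
        have "p dvd (u * v) ^ 2 - b ^ 2 * (u + v) + b * (b * (u + v))"
          by (rule dvd_add[OF p(3) dvd_mult2[OF b]])
        hence "p dvd (u * v) ^ 2" by (simp add: power2_eq_square algebra_simps)
        hence "p dvd u \<or> p dvd v" using p(1) by (auto simp: prime_elem_dvd_mult_iff power2_eq_square)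
        thus False using b disj by blast
      next
        assume u: "p dvd u"
        have "p dvd u * (u * v ^ 2 - b ^ 2) - ((u * v) ^ 2 - b ^ 2 * (u + v))"
          by (rule dvd_diff[OF dvd_mult2[OF u] p(3)])
        hence "p dvd b ^ 2 * v" by (simp add: power2_eq_square algebra_simps)
        hence "p dvd b \<or> p dvd v" using p(1) by (auto simp: prime_elem_dvd_mult_iff power2_eq_square)
        thus False using u disj by blast
      next
        assume v: "p dvd v"
        have "p dvd v * (u ^ 2 * v - b ^ 2) - ((u * v) ^ 2 - b ^ 2 * (u + v))"
          by (rule dvd_diff[OF dvd_mult2[OF v] p(3)])
        hence "p dvd b ^ 2 * u" by (simp add: power2_eq_square algebra_simps)
        hence "p dvd b \<or> p dvd u" using p(1) by (auto simp: prime_elem_dvd_mult_iff power2_eq_square)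
        thus False using v disj by blast
      qed
    qed
  qed
qed

section \<open>The universal Somos sequence and its divisibility by \<open>U_b\<close>\<close>

definition U_net :: "int \<Rightarrow> poly4" where
  "U_net = somos_net (U_b ^ 2) U_beta U_u U_v"

lemma U_net_init: "U_net (-1) = U_u" "U_net 0 = 1" "U_net 1 = 1" "U_net 2 = U_v"
  by (simp_all add: U_net_def somos_net_init)

text \<open>The test homomorphism sets all four variables to 1, where \<open>U_beta\<close> becomes
  \<open>2 - 2 = 0\<close>.\<close>

lemma somos4_U_net: "somos4 (U_b ^ 2) U_beta U_net"
  unfolding U_net_def
proof (rule somos4_somos_net[where h = "eval4 1 1 1 1"])
  interpret comm_ring_hom "eval4 1 1 1 1 :: _ \<Rightarrow> int" by (rule comm_ring_hom_eval4)
  show "comm_ring_hom (eval4 1 1 1 1 :: _ \<Rightarrow> int)" by unfold_locales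
  show "eval4 1 1 1 1 (U_b ^ 2) = (1 :: int)" "eval4 1 1 1 1 U_beta = (0 :: int)"
    by (simp_all add: U_beta_def hom_distribs)
  show "U_beta = U_u * U_v * (U_u * U_v + U_b * U_s) - U_b ^ 2 * (U_u + U_v)"
    by (simp add: U_beta_def)
qed (simp_all add: prime_elem_U_beta)

lemma somos4_hom:
  assumes "comm_ring_hom h" "somos4 a b f"
  shows "somos4 (h a) (h b) (\<lambda>n. h (f n))"
proof -
  interpret h: comm_ring_hom h by (rule assms)
  show ?thesis
    using assms(2) unfolding somos4_def
    by (simp only: h.hom_mult[symmetric] h.hom_add[symmetric] h.hom_power[symmetric] simp_thms)
qed

lemma somos5_hom:
  assumes "comm_ring_hom h" "somos5 b c f"
  shows "somos5 (h b) (h c) (\<lambda>n. h (f n))"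
proof -
  interpret h: comm_ring_hom h by (rule assms)
  show ?thesis
    using assms(2) unfolding somos5_def
    by (simp only: h.hom_mult[symmetric] h.hom_add[symmetric] simp_thms)
qed

text \<open>The assumption is \<open>a + b = 1\<close> for the coefficients at
  \<open>u = v = 1\<close>. It holds for \<open>b = s = 0\<close>, the case used below.\<close>

lemma eval4_U_net_eq_1:
  assumes "b ^ 2 + (1 + b * s - 2 * b ^ 2) = 1"
  shows "eval4 1 1 b s (U_net n) = (1 :: int)"
proof -
  interpret h: comm_ring_hom "eval4 1 1 b s :: _ \<Rightarrow> int" by (rule comm_ring_hom_eval4)
  show ?thesis
  proof (rule somos4_constant_one[OF somos4_hom[OF comm_ring_hom_eval4 somos4_U_net]])
    show "eval4 1 1 b s (U_b ^ 2) + eval4 1 1 b s U_beta = 1"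
      using assms by (simp add: U_beta_def h.hom_add h.hom_mult h.hom_minus h.hom_power)
  qed (simp_all add: U_net_init)
qed

lemma U_net_nz: "U_net n \<noteq> 0"
proof
  interpret h: comm_ring_hom "eval4 1 1 0 0 :: _ \<Rightarrow> int" by (rule comm_ring_hom_eval4)
  assume "U_net n = 0"
  thus False using eval4_U_net_eq_1[of 0 0 n] by simp
qed

lemma somos5_U_net:
  "somos5 U_beta ((U_b ^ 2) ^ 2 + U_beta * (U_u * U_v + (U_u * U_v + U_b * U_s))) U_net"
  by (rule somos4_imp_somos5[OF somos4_U_net U_net_nz U_net_init]) (rule U_beta_def)

text \<open>Modulo \<open>U_b\<close> the coefficient \<open>U_beta\<close> is
  \<open>(U_u * U_v) ^ 2\<close>, the degenerate case. No term is divisible by \<open>U_b\<close>,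
  because at \<open>U_b = 0\<close>, \<open>U_s = 0\<close>, \<open>U_u = U_v = 1\<close> all terms
  are 1.\<close>

lemma U_b_dvd_U_net:
  "U_b dvd U_net (m + 2) * U_net (m - 1) - U_u * U_v * U_net m * U_net (m + 1)"
proof (rule somos4_degenerate_dvd[OF somos4_U_net prime_elem_U_b _ _ _ U_net_init])
  show "U_b dvd U_b ^ 2" by (rule dvd_power) simp
  have "U_beta - (U_u * U_v) ^ 2 = U_b * (U_u * U_v * U_s - U_b * (U_u + U_v))"
    by (simp add: U_beta_def power2_eq_square algebra_simps)
  thus "U_b dvd U_beta - (U_u * U_v) ^ 2" by (rule dvdI)
  show "\<not> U_b dvd U_net n" for n
  proof
    assume "U_b dvd U_net n"
    then obtain c where c: "U_net n = U_b * c" ..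
    interpret h: comm_ring_hom "eval4 1 1 0 0 :: _ \<Rightarrow> int" by (rule comm_ring_hom_eval4)
    show False using eval4_U_net_eq_1[of 0 0 n] by (simp add: c h.hom_mult)
  qed
qed


section \<open>Translated division polynomials\<close>

text \<open>The two curve equations are linear in \<open>a4\<close> and \<open>a6\<close>. Once
  these are eliminated and the second point is expressed by \<open>d = x1 - x2\<close> and the slope
  \<open>l\<close>, both sides are the same polynomial in the remaining variables.\<close>

lemma weierstrass_beta_identity:
  fixes E :: "'a :: idom weierstrass"
  assumes P1: "weierstrass_poly E x1 y1 = 0" and P2: "weierstrass_poly E x2 y2 = 0"
    and l: "l * (x1 - x2) = y1 - y2" and neq: "x1 \<noteq> x2"
    and u: "u = x1 - x2" and v: "v = 2 * x1 + x2 - l ^ 2 - wa1 E * l + wa2 E"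
    and b: "b = 2 * y1 + wa1 E * x1 + wa3 E" and s: "s = wa1 E + 2 * l"
  shows "- (3 * x1 ^ 4 + wb2 E * x1 ^ 3 + 3 * wb4 E * x1 ^ 2 + 3 * wb6 E * x1 + wb8 E)
           = u * v * (u * v + b * s) - b ^ 2 * (u + v)"
proof -
  obtain a1 a2 a3 a4 a6 where E: "E = Weierstrass a1 a2 a3 a4 a6" by (cases E)
  define d where "d = x1 - x2"
  have x2: "x2 = x1 - d" and y2: "y2 = y1 - l * d" using l by (simp_all add: d_def)
  \<comment> \<open>The value of \<open>a4\<close>, obtained by dividing the difference of the two
    curve equations by \<open>d\<close>.\<close>
  define G where "G = l * (2 * y1 - l * d) + a1 * (y1 + l * x1 - l * d) + a3 * l
      - (3 * x1 ^ 2 - 3 * x1 * d + d ^ 2) - a2 * (2 * x1 - d)"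
  have "d * (G - a4) = weierstrass_poly E x1 y1 - weierstrass_poly E x2 y2"
    by (simp add: G_def E weierstrass_poly_def x2 y2 power2_eq_square power3_eq_cube algebra_simps)
  hence a4: "a4 = G" using P1 P2 neq by (simp add: d_def)
  have a6: "a6 = y1 ^ 2 + a1 * x1 * y1 + a3 * y1 - x1 ^ 3 - a2 * x1 ^ 2 - a4 * x1"
    using P1 by (simp add: E weierstrass_poly_def algebra_simps)
  show ?thesis
    unfolding u v b s x2 E wb2_def wb4_def wb6_def wb8_def weierstrass.sel a6 a4 G_def
    by (simp add: algebra_simps power2_eq_square power3_eq_cube power4_eq_xxxx)
qed

section \<open>The image of the universal sequence in \<open>R^*\<close>\<close>

lemma rstar_of_poly_eq_0I: "elim_eval F = 0 \<Longrightarrow> rstar_of_poly F = 0"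
  unfolding rstar_of_poly_def zero_rstar_def
  using curve_ideal_iff[of F 0] by (subst rstar_rel_iff) (simp_all add: to_fract_in_upoly_loc)

definition r_curve :: "rstar weierstrass" where
  "r_curve = map_weierstrass rvar (Weierstrass Ua1 Ua2 Ua3 Ua4 Ua6)"

lemma weierstrass_poly_r_curve:
  "weierstrass_poly r_curve (rvar Ux1) (rvar Uy1) = 0"
  "weierstrass_poly r_curve (rvar Ux2) (rvar Uy2) = 0"
proof -
  interpret R: comm_ring_hom rstar_of_poly by (rule comm_ring_hom_rstar_of_poly)
  have "weierstrass_poly r_curve (rvar x) (rvar y)
      = rstar_of_poly (weierstrass_poly upoly_curve (pvar x) (pvar y))" for x y
    by (simp add: weierstrass_poly_def r_curve_def upoly_curve_def rvar_eq R.hom_add R.hom_minus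
        R.hom_mult R.hom_power)
  thus "weierstrass_poly r_curve (rvar Ux1) (rvar Uy1) = 0"
    "weierstrass_poly r_curve (rvar Ux2) (rvar Uy2) = 0"
    by (simp_all add: rstar_of_poly_eq_0I)
qed

definition r_u :: rstar where "r_u = rvar Ux1 - rvar Ux2"

lemma r_u_eq: "r_u = rstar_of_poly dx_poly"
proof -
  interpret R: comm_ring_hom rstar_of_poly by (rule comm_ring_hom_rstar_of_poly)
  show ?thesis by (simp add: r_u_def rvar_eq R.hom_minus)
qed

lemma r_u_unit: "\<exists>d. r_u * d = 1"
proof
  have "abs_rstar (to_fract dx_poly) * abs_rstar (1 / to_fract dx_poly)
      = abs_rstar (to_fract dx_poly * (1 / to_fract dx_poly))"
    by (rule times_rstar.abs_eq)
       (use upoly_loc_altI[of 1 1] in \<open>simp_all only: rstar_rel_refl to_fract_in_upoly_loc to_fract_1 power_one_right\<close>)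
  also have "to_fract dx_poly * (1 / to_fract dx_poly) = 1"
    using to_fract_dx_nz by (metis nonzero_eq_divide_eq mult.commute)
  finally show "r_u * abs_rstar (1 / to_fract dx_poly) = 1"
    unfolding r_u_eq rstar_of_poly_def one_rstar_def .
qed

text \<open>The slope of the chord lies in \<open>R^*\<close> since \<open>x1 - x2\<close> is a unit
  there. As \<open>R^*\<close> is only an integral domain, it is chosen as a solution of the linear
  equation instead of a quotient.\<close>

definition r_slope :: rstar where "r_slope = (SOME l. l * r_u = rvar Uy1 - rvar Uy2)"

lemma r_slope: "r_slope * r_u = rvar Uy1 - rvar Uy2"
proof -
  obtain d where "r_u * d = 1" using r_u_unit by blast
  hence "((rvar Uy1 - rvar Uy2) * d) * r_u = rvar Uy1 - rvar Uy2" by (simp add: mult_ac)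
  thus ?thesis unfolding r_slope_def by (rule someI)
qed

definition r_v :: rstar where
  "r_v = 2 * rvar Ux1 + rvar Ux2 - r_slope ^ 2 - rvar Ua1 * r_slope + rvar Ua2"
definition r_b :: rstar where "r_b = 2 * rvar Uy1 + rvar Ua1 * rvar Ux1 + rvar Ua3"
definition r_s :: rstar where "r_s = rvar Ua1 + 2 * r_slope"
definition r_beta2 :: rstar where
  "r_beta2 = 3 * rvar Ux1 ^ 4 + wb2 r_curve * rvar Ux1 ^ 3 + 3 * wb4 r_curve * rvar Ux1 ^ 2
               + 3 * wb6 r_curve * rvar Ux1 + wb8 r_curve"

lemma r_u_nz: "r_u \<noteq> 0"
  by (simp add: r_u_eq)

lemma r_beta2_eq: "- r_beta2 = r_u * r_v * (r_u * r_v + r_b * r_s) - r_b ^ 2 * (r_u + r_v)"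
  unfolding r_beta2_def
  by (rule weierstrass_beta_identity[OF weierstrass_poly_r_curve r_slope[unfolded r_u_def]])
     (use r_u_nz in \<open>simp_all add: r_u_def r_v_def r_b_def r_s_def r_curve_def\<close>)

text \<open>All divisions have been carried out in the universal ring, so these elements lie in
  \<open>R^*\<close> by construction.\<close>

definition r_net :: "int \<Rightarrow> rstar" where "r_net n = eval4 r_u r_v r_b r_s (U_net n)"

lemma r_net_init: "r_net (-1) = r_u" "r_net 0 = 1" "r_net 1 = 1" "r_net 2 = r_v"
proof -
  interpret comm_ring_hom "eval4 r_u r_v r_b r_s" by (rule comm_ring_hom_eval4)
  show "r_net (-1) = r_u" "r_net 0 = 1" "r_net 1 = 1" "r_net 2 = r_v"
    by (simp_all add: r_net_def U_net_init)
qed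

lemma eval4_U_beta: "eval4 r_u r_v r_b r_s U_beta = - r_beta2"
proof -
  interpret h: comm_ring_hom "eval4 r_u r_v r_b r_s" by (rule comm_ring_hom_eval4)
  show ?thesis
    unfolding r_beta2_eq by (simp add: U_beta_def h.hom_add h.hom_minus h.hom_mult h.hom_power)
qed

lemma somos4_r_net: "somos4 (r_b ^ 2) (- r_beta2) r_net"
proof -
  interpret h: comm_ring_hom "eval4 r_u r_v r_b r_s" by (rule comm_ring_hom_eval4)
  show ?thesis
    using somos4_hom[OF comm_ring_hom_eval4[of r_u r_v r_b r_s] somos4_U_net]
    by (simp add: h.hom_power eval4_U_beta flip: r_net_def)
qed

lemma somos5_r_net: "\<exists>c. somos5 (- r_beta2) c r_net"
  using somos5_hom[OF comm_ring_hom_eval4[of r_u r_v r_b r_s] somos5_U_net]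
  by (auto simp: eval4_U_beta simp flip: r_net_def)

text \<open>
  On \<open>y\<^sup>2 + x y + y = x\<^sup>3 + 2 x\<^sup>2 + x\<close> with \<open>P\<^sub>1 = (0, 0)\<close> and \<open>P\<^sub>2 = (-1, 0)\<close> one has \<open>\<beta>\<^sub>1 = 1\<close> and
  \<open>\<beta>\<^sub>2 = 0\<close>, so that all \<open>\<Psi>\<^sub>n\<close> are 1.
\<close>

lemma specialization_to_1:
  obtains h :: "rstar \<Rightarrow> rat"
  where "comm_ring_hom h" "h r_u = 1" "h r_v = 1" "h r_b = 1" "h r_s = 1"
proof -
  define E where "E = Weierstrass 1 2 1 1 (0 :: rat)"
  have "\<exists>!h. comm_ring_hom h \<and>
      map_weierstrass (\<lambda>v. h (rvar v)) (Weierstrass Ua1 Ua2 Ua3 Ua4 Ua6) = E \<and>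
      Point (h (rvar Ux1)) (h (rvar Uy1)) = Point 0 0 \<and>
      Point (h (rvar Ux2)) (h (rvar Uy2)) = Point (-1) 0"
    by (rule specialization_unique) (simp_all add: E_def weierstrass_poly_def)
  then obtain h :: "rstar \<Rightarrow> rat" where hom: "comm_ring_hom h"
    and h: "h (rvar Ua1) = 1" "h (rvar Ua2) = 2" "h (rvar Ua3) = 1" "h (rvar Ux1) = 0"
      "h (rvar Uy1) = 0" "h (rvar Ux2) = -1" "h (rvar Uy2) = 0"
    by (auto simp: E_def)
  interpret h: comm_ring_hom h by (rule hom)
  have 2: "h 2 = 2" using h.hom_of_int[of 2] by simp
  have u: "h r_u = 1" by (simp add: r_u_def h.hom_minus h)
  have "h r_slope * h r_u = 0"
    by (simp add: h.hom_mult[symmetric] r_slope) (simp add: h.hom_minus h)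
  hence l: "h r_slope = 0" using u by simp
  show ?thesis
    by (rule that[OF hom u])
       (simp_all add: r_v_def r_b_def r_s_def h.hom_minus h.hom_mult h.hom_add h.hom_power h l 2)
qed

text \<open>Under the test specialization the coefficients of the recurrence are 1 and 0, so every
  term goes to 1. This justifies the divisions by earlier terms in the definition of
  \<open>Psi\<close>.\<close>

lemma r_net_nz: "r_net n \<noteq> 0"
proof -
  obtain h :: "rstar \<Rightarrow> rat" where hom: "comm_ring_hom h"
    and h: "h r_u = 1" "h r_v = 1" "h r_b = 1" "h r_s = 1"
    by (rule specialization_to_1)
  interpret h: comm_ring_hom h by (rule hom)
  have "h (r_net n) = 1"
  proof (rule somos4_constant_one[OF somos4_hom[OF hom somos4_r_net]])
    show "h (r_b ^ 2) + h (- r_beta2) = 1"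
      unfolding r_beta2_eq by (simp add: h.hom_minus h.hom_mult h.hom_add h.hom_power h)
  qed (simp_all add: r_net_init h)
  thus ?thesis by auto
qed

lemma r_b_nz: "r_b \<noteq> 0" and rstar_2_nz: "(2 :: rstar) \<noteq> 0"
proof -
  obtain h :: "rstar \<Rightarrow> rat" where hom: "comm_ring_hom h" and h: "h r_b = 1"
    by (rule specialization_to_1)
  interpret h: comm_ring_hom h by (rule hom)
  show "r_b \<noteq> 0" using h by auto
  show "(2 :: rstar) \<noteq> 0" using h.hom_of_int[of 2] by auto
qed

section \<open>\<open>Psi\<close>, \<open>Phi\<close> and \<open>Omega\<close> as elements of
  \<open>R^*\<close>\<close>

lemma comm_ring_hom_to_fract: "comm_ring_hom (to_fract :: 'a :: idom \<Rightarrow> _)"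
  by standard auto

lemma generic_eqs:
  "wa1 generic_curve = to_fract (rvar Ua1)" "wa2 generic_curve = to_fract (rvar Ua2)"
  "wa3 generic_curve = to_fract (rvar Ua3)" "beta1 = to_fract r_b" "beta2 = to_fract r_beta2"
proof -
  interpret t: comm_ring_hom "to_fract :: rstar \<Rightarrow> _" by (rule comm_ring_hom_to_fract)
  have num: "to_fract (numeral k) = (numeral k :: rstar fract)" for k
    using t.hom_of_int[of "numeral k"] by simp
  show "wa1 generic_curve = to_fract (rvar Ua1)" "wa2 generic_curve = to_fract (rvar Ua2)"
    "wa3 generic_curve = to_fract (rvar Ua3)"
    by (simp_all add: generic_curve_def)
  show "beta1 = to_fract r_b" "beta2 = to_fract r_beta2"
    by (simp_all add: beta1_def r_b_def beta2_def r_beta2_def generic_curve_def r_curve_def gx1_def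
        gy1_def wb2_def wb4_def wb6_def wb8_def num)
qed

text \<open>Both sequences have the same initial values and satisfy the same recurrence, which
  determines the other terms because no term of \<open>r_net\<close> is zero.\<close>

lemma Psi_eq_r_net: "Psi n = to_fract (r_net n)"
proof (induction n rule: Psi.induct)
  case (1 n)
  interpret t: comm_ring_hom "to_fract :: rstar \<Rightarrow> _" by (rule comm_ring_hom_to_fract)
  have s4: "to_fract (r_net (m + 2)) * to_fract (r_net (m - 2))
      = beta1 ^ 2 * to_fract (r_net (m + 1)) * to_fract (r_net (m - 1)) - beta2 * to_fract (r_net m) ^ 2" for m
    using arg_cong[OF somos4_r_net[unfolded somos4_def, rule_format, of m], of to_fract]
    by (simp add: generic_eqs)
  consider "n = -1" | "n = 0" | "n = 1" | "n = 2" | "n > 2" | "n < -1" by linarith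
  thus ?case
  proof cases
    case 4
    have "gx2 - gx1 \<noteq> 0" "(gy2 - gy1) = to_fract r_slope * (gx2 - gx1)"
    proof -
      show "gx2 - gx1 \<noteq> 0" using r_u_nz by (auto simp: gx1_def gx2_def r_u_def)
      have "gy1 - gy2 = to_fract r_slope * (gx1 - gx2)"
        using arg_cong[OF r_slope, of to_fract] by (simp add: gx1_def gx2_def gy1_def gy2_def r_u_def)
      thus "(gy2 - gy1) = to_fract r_slope * (gx2 - gx1)" by (simp add: algebra_simps)
    qed
    hence "(gy2 - gy1) / (gx2 - gx1) = to_fract r_slope" by simp
    moreover have "to_fract 2 = (2 :: rstar fract)" using t.hom_of_int[of 2] by simp
    ultimately show ?thesis
      using 4 by (subst Psi.simps) (simp add: r_net_init r_v_def gx1_def gx2_def generic_eqs)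
  next
    case 5
    have "to_fract (r_net n) * to_fract (r_net (n - 4))
        = beta1 ^ 2 * Psi (n - 1) * Psi (n - 3) - beta2 * Psi (n - 2) ^ 2"
      using 1 5 s4[of "n - 2"] by simp
    moreover have "Psi (n - 4) = to_fract (r_net (n - 4))" using 1 5 by simp
    ultimately show ?thesis using 5 r_net_nz[of "n - 4"]
      by (subst Psi.simps) (simp add: nonzero_eq_divide_eq[symmetric] divide_eq_eq)
  next
    case 6
    have "to_fract (r_net n) * to_fract (r_net (n + 4))
        = beta1 ^ 2 * Psi (n + 3) * Psi (n + 1) - beta2 * Psi (n + 2) ^ 2"
      using 1 6 s4[of "n + 2"] by (simp add: mult_ac add_ac)
    moreover have "Psi (n + 4) = to_fract (r_net (n + 4))" using 1 6 by simp
    ultimately show ?thesis using 6 r_net_nz[of "n + 4"]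
      by (subst Psi.simps) (simp add: nonzero_eq_divide_eq[symmetric] divide_eq_eq)
  qed (subst Psi.simps, simp add: r_net_init r_u_def gx1_def gx2_def)+
qed

definition r_Phi :: "int \<Rightarrow> rstar" where
  "r_Phi n = rvar Ux1 * r_net n ^ 2 - r_net (n + 1) * r_net (n - 1)"

lemma Phi_eq: "Phi n = to_fract (r_Phi n)"
  by (simp add: Phi_def r_Phi_def Psi_eq_r_net gx1_def)

definition r_Omega_numerator :: "int \<Rightarrow> rstar" where
  "r_Omega_numerator n = r_net (n - 1) ^ 2 * r_net (n + 2) - r_net (n - 2) * r_net (n + 1) ^ 2
     - r_b * r_net n * (rvar Ua1 * r_Phi n + rvar Ua3 * r_net n ^ 2)"

lemma Omega_eq_divide: "Omega n = to_fract (r_Omega_numerator n) / to_fract (2 * r_b)"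
proof -
  interpret t: comm_ring_hom "to_fract :: rstar \<Rightarrow> _" by (rule comm_ring_hom_to_fract)
  have "to_fract 2 = (2 :: rstar fract)" using t.hom_of_int[of 2] by simp
  thus ?thesis
    by (simp add: Omega_def r_Omega_numerator_def Phi_eq Psi_eq_r_net generic_eqs)
qed

text \<open>The conserved quantity rewrites the first term of the numerator, which doubles the term
  with \<open>r_net (n + 1) * r_net (n - 2)\<close>; modulo \<open>r_b\<close> that product is
  \<open>r_u * r_v * r_net (n - 1) * r_net n\<close>.\<close>

lemma r_Omega_numerator_dvd: "\<exists>w. r_Omega_numerator n = 2 * r_b * w"
proof -
  interpret h: comm_ring_hom "eval4 r_u r_v r_b r_s" by (rule comm_ring_hom_eval4)
  obtain c where "U_net (n - 1 + 2) * U_net (n - 1 - 1) - U_u * U_v * U_net (n - 1) * U_net (n - 1 + 1) = U_b * c"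
    using U_b_dvd_U_net[of "n - 1"] by blast
  from arg_cong[OF this, of "eval4 r_u r_v r_b r_s"]
  obtain c' where "r_net (n + 1) * r_net (n - 2) - r_u * r_v * r_net (n - 1) * r_net n = r_b * c'"
    by (auto simp: h.hom_minus h.hom_mult add.commute simp flip: r_net_def)
  hence c': "r_net (n + 1) * r_net (n - 2) = r_u * r_v * r_net (n - 1) * r_net n + r_b * c'"
    by (simp add: algebra_simps)
  have "- r_beta2 = r_u * r_v * (r_u * r_v + r_b * r_s) - r_b ^ 2 * (r_u + r_v)" by (rule r_beta2_eq)
  from somos4_imp_invariant[OF somos4_r_net r_net_nz r_net_init this, of n]
  have inv: "r_net (n - 1) ^ 2 * r_net (n + 2) = (r_u * r_v + (r_u * r_v + r_b * r_s)) * r_net (n - 1) * r_net n * r_net (n + 1)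
      - r_b ^ 2 * r_net n ^ 3 - r_net (n + 1) * (r_net (n + 1) * r_net (n - 2))"
    by (simp add: somos_invariant_def power2_eq_square algebra_simps)
  \<comment> \<open>The terms with \<open>2 * r_u * r_v\<close> cancel. The remaining factor 2 comes
    from adding the \<open>rvar Ua1\<close> of \<open>r_s\<close> to that of \<open>r_Phi\<close>,
    and from \<open>r_b + rvar Ua1 * rvar Ux1 + rvar Ua3 = 2 * (r_b - rvar Uy1)\<close>.\<close>
  have "r_Omega_numerator n = 2 * r_b * ((rvar Ua1 + r_slope) * r_net (n - 1) * r_net n * r_net (n + 1)
      - (r_b - rvar Uy1) * r_net n ^ 3 - c' * r_net (n + 1))"
  proof -
    have "r_Omega_numerator n = r_net (n - 1) ^ 2 * r_net (n + 2) - r_net (n + 1) * (r_net (n + 1) * r_net (n - 2))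
      - r_b * r_net n * (rvar Ua1 * r_Phi n + rvar Ua3 * r_net n ^ 2)"
      by (simp add: r_Omega_numerator_def power2_eq_square algebra_simps)
    also have "\<dots> = 2 * r_b * ((rvar Ua1 + r_slope) * r_net (n - 1) * r_net n * r_net (n + 1)
      - (r_b - rvar Uy1) * r_net n ^ 3 - c' * r_net (n + 1))"
      unfolding inv c' by (simp add: r_Phi_def r_s_def r_b_def power2_eq_square power3_eq_cube algebra_simps)
    finally show ?thesis .
  qed
  thus ?thesis by blast
qed

definition r_Omega :: "int \<Rightarrow> rstar" where
  "r_Omega n = (SOME w. r_Omega_numerator n = 2 * r_b * w)"

lemma r_Omega: "r_Omega_numerator n = 2 * r_b * r_Omega n"
  unfolding r_Omega_def using r_Omega_numerator_dvd by (rule someI_ex)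

lemma Omega_eq: "Omega n = to_fract (r_Omega n)"
  using r_b_nz rstar_2_nz by (simp add: Omega_eq_divide r_Omega)

lemma value_at_to_fract: "value_at E P1 P2 (to_fract r) = specialization E P1 P2 r"
  by (simp add: value_at_def)


section \<open>p-adic numbers\<close>

lemma p_gt_1: "real CARD('p :: prime_card) > 1"
  using prime_gt_1_nat[OF prime_card[where 'a = 'p]] by simp

lemma padic_abs_1 [simp]: "padic_abs (1 :: 'p :: prime_card padic) = 1"
  using padic_abs_of_int[of 1, where ?'p = 'p] by (simp add: prime_card)

lemma padic_abs_0 [simp]: "padic_abs (0 :: 'p :: prime_card padic) = 0"
  by simp

lemma padic_abs_power: "padic_abs (x ^ n :: 'p :: prime_card padic) = padic_abs x ^ n"
  by (induction n) (simp_all add: padic_abs_mult)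

lemma padic_abs_inverse: "padic_abs (inverse x :: 'p :: prime_card padic) = inverse (padic_abs x)"
proof (cases "x = 0")
  case False
  hence "padic_abs x * padic_abs (inverse x) = 1" by (simp flip: padic_abs_mult)
  thus ?thesis by (metis inverse_unique)
qed simp

lemma padic_abs_divide: "padic_abs (x / y :: 'p :: prime_card padic) = padic_abs x / padic_abs y"
  by (simp add: divide_inverse padic_abs_mult padic_abs_inverse)

lemma padic_abs_diff_ultrametric:
  "padic_abs (x - y :: 'p :: prime_card padic) \<le> max (padic_abs x) (padic_abs y)"
  using padic_abs_ultrametric[of x "- y"] by simp

lemma padic_abs_diff_commute: "padic_abs (x - y :: 'p :: prime_card padic) = padic_abs (y - x)"
  using padic_abs_minus[of "x - y"] by (simp del: padic_abs_minus)

lemma padic_abs_add_eq: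
  fixes x y :: "'p :: prime_card padic"
  assumes "padic_abs y < padic_abs x"
  shows "padic_abs (x + y) = padic_abs x"
  using padic_abs_ultrametric[of x y] padic_abs_diff_ultrametric[of "x + y" y] assms by simp

lemma padic_abs_CARD: "padic_abs (of_nat CARD('p) :: 'p :: prime_card padic) = 1 / real CARD('p)"
proof -
  have "int CARD('p) \<noteq> 0" "multiplicity (int CARD('p)) (int CARD('p)) = 1"
    using prime_card[where 'a = 'p] prime_gt_1_nat[OF prime_card[where 'a = 'p]]
    by (auto intro!: multiplicity_self)
  thus ?thesis
    using padic_abs_of_int[of "int CARD('p)", where ?'p = 'p]
      rat_pabs_of_int[OF prime_card[where 'a = 'p], of "int CARD('p)"]
    by (simp add: power_int_minus inverse_eq_divide)
qed

lemma padic_CARD_nz: "(of_nat CARD('p) :: 'p :: prime_card padic) \<noteq> 0"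
  using padic_abs_CARD[where ?'p = 'p] p_gt_1[where ?'p = 'p] by auto

lemma padic_abs_of_int_le_1: "padic_abs (of_int k :: 'p :: prime_card padic) \<le> 1"
proof (cases "k = 0")
  case False
  have "real CARD('p) powi (- int (multiplicity (int CARD('p)) k)) \<le> real CARD('p) powi 0"
    using p_gt_1[where ?'p = 'p] by (intro power_int_increasing) auto
  thus ?thesis using False by (simp add: padic_abs_of_int rat_pabs_of_int prime_card)
qed simp

lemma padic_abs_of_int_less_1_iff:
  "padic_abs (of_int k :: 'p :: prime_card padic) < 1 \<longleftrightarrow> int CARD('p) dvd k"
proof (cases "k = 0")
  case False
  let ?m = "multiplicity (int CARD('p)) k"
  have "padic_abs (of_int k :: 'p padic) = inverse (real CARD('p) ^ ?m)"
    using False by (simp add: padic_abs_of_int rat_pabs_of_int prime_card power_int_minus)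
  moreover have "inverse (real CARD('p) ^ ?m) < 1 \<longleftrightarrow> ?m > 0"
    using p_gt_1[where ?'p = 'p] by (cases "?m = 0") (auto simp: inverse_less_1_iff one_less_power)
  moreover have "?m > 0 \<longleftrightarrow> int CARD('p) dvd k"
    using False prime_card_int[where 'a = 'p]
    by (simp add: prime_multiplicity_gt_zero_iff)
  ultimately show ?thesis by simp
qed simp

lemma padic_integers_iff: "x \<in> padic_integers \<longleftrightarrow> padic_abs x \<le> 1"
  by (simp add: padic_integers_def)

lemma padic_integers_of_int [simp, intro]: "of_int k \<in> padic_integers"
  by (simp add: padic_integers_iff padic_abs_of_int_le_1)

lemma padic_integers_0 [simp, intro]: "0 \<in> padic_integers"
  and padic_integers_1 [simp, intro]: "1 \<in> padic_integers"
  and padic_integers_of_nat [simp, intro]: "of_nat n \<in> padic_integers"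
  and padic_integers_numeral [simp, intro]: "numeral k \<in> padic_integers"
  using padic_integers_of_int[of 0] padic_integers_of_int[of 1] padic_integers_of_int[of "int n"]
    padic_integers_of_int[of "numeral k"] by (simp_all del: padic_integers_of_int)

lemma padic_integers_add [intro]: "x \<in> padic_integers \<Longrightarrow> y \<in> padic_integers \<Longrightarrow> x + y \<in> padic_integers"
  using padic_abs_ultrametric[of x y] by (simp add: padic_integers_iff)

lemma padic_integers_diff [intro]: "x \<in> padic_integers \<Longrightarrow> y \<in> padic_integers \<Longrightarrow> x - y \<in> padic_integers"
  using padic_abs_diff_ultrametric[of x y] by (simp add: padic_integers_iff)

lemma padic_integers_minus [intro]: "x \<in> padic_integers \<Longrightarrow> - x \<in> padic_integers"
  by (simp add: padic_integers_iff)

lemma padic_integers_mult [intro]: "x \<in> padic_integers \<Longrightarrow> y \<in> padic_integers \<Longrightarrow> x * y \<in> padic_integers"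
  by (simp add: padic_integers_iff padic_abs_mult mult_le_one)

lemma padic_integers_power [intro]: "x \<in> padic_integers \<Longrightarrow> x ^ n \<in> padic_integers"
  by (simp add: padic_integers_iff padic_abs_power power_le_one)

section \<open>Density of the rationals, discreteness of the absolute value, completeness\<close>

lemma padic_abs_diff_rat_LIMSEQ:
  assumes "pcauchy CARD('p :: prime_card) X"
  shows "(\<lambda>n. rat_pabs CARD('p) (X n - c)) \<longlonglongrightarrow> padic_abs (abs_padic X - abs_padic (\<lambda>_. c) :: 'p padic)"
proof -
  have "(abs_padic X - abs_padic (\<lambda>_. c) :: 'p padic) = abs_padic (\<lambda>n. X n + - c)"
    using assms plus_abs_padic[of X "\<lambda>_. - c", where ?'p = 'p]
    by (simp add: uminus_abs_padic diff_conv_add_uminus[of "abs_padic X"] del: add_uminus_conv_diff)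
  moreover have "pcauchy CARD('p) (\<lambda>n. X n + - c)"
    using assms by (intro pcauchy_add prime_card pcauchy_const)
  ultimately show ?thesis using abs_padic_LIMSEQ[of "\<lambda>n. X n + - c", where ?'p = 'p] by simp
qed

lemma padic_abs_const: "padic_abs (abs_padic (\<lambda>_. c) :: 'p :: prime_card padic) = rat_pabs CARD('p) c"
  using abs_padic_LIMSEQ[of "\<lambda>_. c", where ?'p = 'p] by (simp add: LIMSEQ_const_iff)

lemma padic_rat_dense:
  fixes x :: "'p :: prime_card padic"
  assumes "e > 0"
  obtains c where "padic_abs (x - abs_padic (\<lambda>_. c)) < e"
proof -
  obtain X where X: "x = abs_padic X" "pcauchy CARD('p) X" by (rule padic_cases)
  obtain M where M: "\<And>m n. m \<ge> M \<Longrightarrow> n \<ge> M \<Longrightarrow> rat_pabs CARD('p) (X m - X n) < e / 2"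
    using X(2) assms unfolding pcauchy_def by (meson half_gt_zero)
  have "padic_abs (x - abs_padic (\<lambda>_. X M)) \<le> e / 2"
    unfolding X(1)
    by (rule LIMSEQ_le_const2[OF padic_abs_diff_rat_LIMSEQ[OF X(2)]]) (use M in \<open>auto intro!: exI[of _ M] less_imp_le\<close>)
  thus ?thesis using that[of "X M"] assms by simp
qed

text \<open>A rational closer to \<open>x\<close> than \<open>padic_abs x\<close> has the same
  absolute value as \<open>x\<close>, which is therefore an integral power of
  \<open>p\<close>.\<close>

lemma padic_abs_less_1D:
  fixes x :: "'p :: prime_card padic"
  assumes "padic_abs x < 1"
  shows "padic_abs x \<le> 1 / real CARD('p)"
proof (cases "x = 0")
  case False
  hence "padic_abs x > 0" using padic_abs_ge_0[of x] padic_abs_eq_0_iff[of x] by linarith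
  then obtain c where c: "padic_abs (x - abs_padic (\<lambda>_. c)) < padic_abs x" by (rule padic_rat_dense)
  have "padic_abs (x + (abs_padic (\<lambda>_. c) - x)) = padic_abs x"
    by (rule padic_abs_add_eq) (use c in \<open>simp add: padic_abs_diff_commute\<close>)
  hence eq: "padic_abs x = rat_pabs CARD('p) c" by (simp add: padic_abs_const)
  hence "c \<noteq> 0" using \<open>padic_abs x > 0\<close> by auto
  then obtain k where k: "rat_pabs CARD('p) c = real CARD('p) powi k" by (auto simp: rat_pabs_def)
  have "k < 0"
  proof (rule ccontr)
    assume "\<not> k < 0"
    hence "real CARD('p) powi 0 \<le> real CARD('p) powi k"
      using p_gt_1[where ?'p = 'p] by (intro power_int_increasing) auto
    thus False using assms eq k by simp
  qed
  hence "real CARD('p) powi k \<le> real CARD('p) powi (-1)"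
    using p_gt_1[where ?'p = 'p] by (intro power_int_increasing) auto
  thus ?thesis by (simp add: eq k power_int_minus inverse_eq_divide)
qed simp

text \<open>Each term is approximated by a rational to within \<open>1 / (n + 1)\<close>. These
  rationals form a p-adic Cauchy sequence, whose class is the limit.\<close>

instance padic :: (prime_card) complete_space
proof
  fix X :: "nat \<Rightarrow> 'a padic"
  assume "Cauchy X"
  have "\<exists>c. padic_abs (X n - abs_padic (\<lambda>_. c)) < inverse (real (Suc n))" for n
    using padic_rat_dense[of "inverse (real (Suc n))" "X n"] by auto
  then obtain c where c: "\<And>n. padic_abs (X n - abs_padic (\<lambda>_. c n)) < inverse (real (Suc n))"
    by metis
  have c_le: "rat_pabs CARD('a) (c m - c n) < e"
    if m: "padic_abs (X m - X n) < e" "inverse (real (Suc m)) < e" "inverse (real (Suc n)) < e" for m n e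
  proof -
    have "rat_pabs CARD('a) (c m - c n) = padic_abs (abs_padic (\<lambda>_. c m) - abs_padic (\<lambda>_. c n) :: 'a padic)"
      using padic_abs_diff_rat_LIMSEQ[of "\<lambda>_. c m" "c n", where ?'p = 'a] by (simp add: LIMSEQ_const_iff)
    also have "abs_padic (\<lambda>_. c m) - abs_padic (\<lambda>_. c n)
        = (X m - X n) - (X m - abs_padic (\<lambda>_. c m)) + (X n - abs_padic (\<lambda>_. c n))"
      by simp
    also have "padic_abs \<dots> < e"
      using padic_abs_ultrametric[of "(X m - X n) - (X m - abs_padic (\<lambda>_. c m))" "X n - abs_padic (\<lambda>_. c n)"]
        padic_abs_diff_ultrametric[of "X m - X n" "X m - abs_padic (\<lambda>_. c m)"] m c[of m] c[of n]
      by linarith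
    finally show ?thesis .
  qed
  have ev: "\<exists>M. \<forall>m\<ge>M. inverse (real (Suc m)) < e" if "e > 0" for e
    using LIMSEQ_inverse_real_of_nat[THEN order_tendstoD(2), OF that] by (simp add: eventually_sequentially)
  have pc: "pcauchy CARD('a) c"
    unfolding pcauchy_def
  proof (intro allI impI)
    fix e :: real assume e: "e > 0"
    obtain M where M: "\<forall>m\<ge>M. \<forall>n\<ge>M. dist (X m) (X n) < e" using metric_CauchyD[OF \<open>Cauchy X\<close> e] by blast
    obtain M' where M': "\<forall>m\<ge>M'. inverse (real (Suc m)) < e" using ev[OF e] by blast
    show "\<exists>M. \<forall>m\<ge>M. \<forall>n\<ge>M. rat_pabs CARD('a) (c m - c n) < e"
      by (rule exI[of _ "max M M'"]) (use M M' c_le in \<open>auto simp: dist_padic_def\<close>)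
  qed
  have "X \<longlonglongrightarrow> abs_padic c"
  proof (rule metric_LIMSEQ_I)
    fix e :: real assume e: "e > 0"
    obtain M where M: "\<And>m n. m \<ge> M \<Longrightarrow> n \<ge> M \<Longrightarrow> rat_pabs CARD('a) (c m - c n) < e / 2"
      using pc e unfolding pcauchy_def by (meson half_gt_zero)
    obtain M' where M': "\<forall>m\<ge>M'. inverse (real (Suc m)) < e" using ev[OF e] by blast
    have "dist (X n) (abs_padic c) < e" if n: "n \<ge> max M M'" for n
    proof -
      have "padic_abs (abs_padic c - abs_padic (\<lambda>_. c n) :: 'a padic) \<le> e / 2"
        by (rule LIMSEQ_le_const2[OF padic_abs_diff_rat_LIMSEQ[OF pc]])
           (use M n in \<open>auto intro!: exI[of _ M] less_imp_le\<close>)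
      moreover have "padic_abs (X n - abs_padic (\<lambda>_. c n)) < e"
        using c[of n] M' n by (meson less_trans max.bounded_iff)
      ultimately have "padic_abs ((X n - abs_padic (\<lambda>_. c n)) - (abs_padic c - abs_padic (\<lambda>_. c n))) < e"
        using padic_abs_diff_ultrametric[of "X n - abs_padic (\<lambda>_. c n)" "abs_padic c - abs_padic (\<lambda>_. c n)"] e
        by linarith
      thus ?thesis by (simp add: dist_padic_def)
    qed
    thus "\<exists>no. \<forall>n\<ge>no. dist (X n) (abs_padic c) < e" by blast
  qed
  thus "convergent X" by (auto simp: convergent_def)
qed

lemma padic_integers_LIMSEQ:
  fixes X :: "nat \<Rightarrow> 'p :: prime_card padic"
  assumes "X \<longlonglongrightarrow> L" "\<And>n. X n \<in> padic_integers"
  shows "L \<in> padic_integers"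
proof -
  obtain n where "dist (X n) L < 1"
    using metric_LIMSEQ_D[OF assms(1), of 1] by auto
  hence "X n - L \<in> padic_integers" by (simp add: padic_integers_iff dist_padic_def)
  from padic_integers_diff[OF assms(2)[of n] this] show ?thesis by simp
qed

text \<open>A nearby rational \<open>a / b\<close> in lowest terms has \<open>b\<close> prime to
  \<open>p\<close>; with \<open>b'\<close> an inverse of \<open>b\<close> modulo \<open>p\<close>,
  the integer \<open>a * b'\<close> is close enough. So every p-adic integer has a residue
  class.\<close>

lemma padic_integer_approx:
  fixes x :: "'p :: prime_card padic"
  assumes "x \<in> padic_integers"
  obtains k :: int where "padic_abs (x - of_int k) < 1"
proof -
  let ?p = "int CARD('p)"
  obtain c where c: "padic_abs (x - abs_padic (\<lambda>_. c)) < 1" using padic_rat_dense[of 1 x] by auto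
  define y :: "'p padic" where "y = abs_padic (\<lambda>_. c)"
  have "padic_abs y \<le> 1"
    using padic_abs_diff_ultrametric[of x "x - y"] c assms by (simp add: y_def padic_integers_iff)
  obtain a b where ab: "quotient_of c = (a, b)" by (cases "quotient_of c")
  have b: "b > 0" and cop: "coprime a b" and cab: "c = of_int a / of_int b"
    using quotient_of_denom_pos[OF ab] quotient_of_coprime[OF ab] quotient_of_div[OF ab] by auto
  have "y * abs_padic (\<lambda>_. of_int b) = abs_padic (\<lambda>_. of_int a)"
    unfolding y_def using b by (simp add: times_abs_padic cab)
  hence yb: "y * of_int b = of_int a" by (simp add: abs_padic_of_int)
  have "\<not> ?p dvd b"
  proof
    assume pb: "?p dvd b"
    hence "padic_abs (of_int b :: 'p padic) < 1" by (simp add: padic_abs_of_int_less_1_iff)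
    hence "padic_abs (y * of_int b) < 1"
      using mult_mono[OF \<open>padic_abs y \<le> 1\<close> order.refl, of "padic_abs (of_int b :: 'p padic)"]
      by (simp add: padic_abs_mult)
    hence "?p dvd a" unfolding yb by (simp add: padic_abs_of_int_less_1_iff)
    hence "is_unit ?p" using pb cop coprime_common_divisor by blast
    thus False using prime_card_int[where 'a = 'p] not_prime_unit by blast
  qed
  hence "coprime b ?p"
    using prime_card_int[where 'a = 'p] prime_imp_coprime coprime_commute by blast
  then obtain b' where "[b * b' = 1] (mod ?p)" using cong_solve_coprime_int by blast
  hence "[a * (b * b') = a * 1] (mod ?p)" by (rule cong_scalar_left)
  hence "?p dvd a - a * b' * b" by (simp add: cong_iff_dvd_diff mult_ac dvd_diff_commute)
  hence "padic_abs (of_int (a - a * b' * b) :: 'p padic) < 1" by (simp only: padic_abs_of_int_less_1_iff)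
  moreover have "of_int (a - a * b' * b) = (y - of_int (a * b')) * of_int b"
    by (simp add: left_diff_distrib yb)
  moreover have "padic_abs (of_int b :: 'p padic) = 1"
    using \<open>\<not> ?p dvd b\<close> padic_abs_of_int_le_1[of b, where ?'p = 'p]
    by (meson antisym_conv2 padic_abs_of_int_less_1_iff)
  ultimately have "padic_abs (y - of_int (a * b')) < 1" by (simp add: padic_abs_mult)
  hence "padic_abs ((x - y) + (y - of_int (a * b'))) < 1"
    using padic_abs_ultrametric[of "x - y" "y - of_int (a * b')"] c unfolding y_def by linarith
  thus ?thesis using that[of "a * b'"] by simp
qed

section \<open>The residue map as a ring homomorphism on the p-adic integers\<close>

lemma of_int_mod_ring_eq_iff:
  "(of_int k = (of_int l :: 'p :: prime_card mod_ring)) \<longleftrightarrow> int CARD('p) dvd k - l"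
  by (simp add: of_int_eq_iff_cong_CHAR semiring_char_mod_ring cong_iff_dvd_diff)

lemma padic_residue_eq:
  fixes x :: "'p :: prime_card padic"
  assumes "padic_abs (x - of_int k) < 1"
  shows "padic_residue x = of_int k"
  unfolding padic_residue_def
proof (rule the_equality)
  show "\<exists>l. of_int k = of_int l \<and> padic_abs (x - of_int l) < 1" using assms by blast
  fix c :: "'p mod_ring" assume "\<exists>l. c = of_int l \<and> padic_abs (x - of_int l) < 1"
  then obtain l where l: "c = of_int l" "padic_abs (x - of_int l) < 1" by blast
  have "padic_abs ((x - of_int k) - (x - of_int l)) < 1"
    using padic_abs_diff_ultrametric[of "x - of_int k" "x - of_int l"] assms l by linarith
  hence "padic_abs (of_int (l - k) :: 'p padic) < 1" by simp
  hence "int CARD('p) dvd l - k" by (simp only: padic_abs_of_int_less_1_iff)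
  thus "c = of_int k" unfolding l(1) by (rule of_int_mod_ring_eq_iff[THEN iffD2])
qed

lemma padic_residue_of_int [simp]: "padic_residue (of_int k :: 'p :: prime_card padic) = of_int k"
  by (rule padic_residue_eq) simp

lemma padic_residue_0 [simp]: "padic_residue (0 :: 'p :: prime_card padic) = 0"
  and padic_residue_1 [simp]: "padic_residue (1 :: 'p :: prime_card padic) = 1"
  and padic_residue_numeral [simp]: "padic_residue (numeral n :: 'p :: prime_card padic) = numeral n"
  using padic_residue_of_int[of 0, where ?'p = 'p] padic_residue_of_int[of 1, where ?'p = 'p]
    padic_residue_of_int[of "numeral n", where ?'p = 'p] by (simp_all del: padic_residue_of_int)

lemma padic_residue_add [simp]:
  fixes x y :: "'p :: prime_card padic"
  assumes "x \<in> padic_integers" "y \<in> padic_integers"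
  shows "padic_residue (x + y) = padic_residue x + padic_residue y"
proof -
  obtain k l where kl: "padic_abs (x - of_int k) < 1" "padic_abs (y - of_int l) < 1"
    using assms padic_integer_approx by metis
  have "padic_abs ((x - of_int k) + (y - of_int l)) < 1"
    using padic_abs_ultrametric[of "x - of_int k" "y - of_int l"] kl by linarith
  hence "padic_abs (x + y - of_int (k + l)) < 1" by (simp add: algebra_simps)
  from padic_residue_eq[OF this] show ?thesis using kl by (simp add: padic_residue_eq)
qed

lemma padic_residue_mult [simp]:
  fixes x y :: "'p :: prime_card padic"
  assumes "x \<in> padic_integers" "y \<in> padic_integers"
  shows "padic_residue (x * y) = padic_residue x * padic_residue y"
proof -
  obtain k l where kl: "padic_abs (x - of_int k) < 1" "padic_abs (y - of_int l) < 1"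
    using assms padic_integer_approx by metis
  have "padic_abs (x * (y - of_int l)) < 1" "padic_abs ((x - of_int k) * of_int l) < 1"
    using assms(1) kl padic_abs_of_int_le_1[of l, where ?'p = 'p]
      mult_mono[of "padic_abs x" 1 "padic_abs (y - of_int l)" "padic_abs (y - of_int l)"]
      mult_mono[of "padic_abs (x - of_int k)" "padic_abs (x - of_int k)" "padic_abs (of_int l :: 'p padic)" 1]
    by (simp_all add: padic_abs_mult padic_integers_iff)
  hence "padic_abs (x * (y - of_int l) + (x - of_int k) * of_int l) < 1"
    using padic_abs_ultrametric[of "x * (y - of_int l)" "(x - of_int k) * of_int l"] by linarith
  hence "padic_abs (x * y - of_int (k * l)) < 1" by (simp add: algebra_simps)
  from padic_residue_eq[OF this] show ?thesis using kl by (simp add: padic_residue_eq)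
qed

lemma padic_residue_minus [simp]:
  "x \<in> padic_integers \<Longrightarrow> padic_residue (- x :: 'p :: prime_card padic) = - padic_residue x"
  using padic_residue_add[of x "- x"] by (simp add: padic_integers_minus add_eq_0_iff)

lemma padic_residue_diff [simp]:
  "x \<in> padic_integers \<Longrightarrow> y \<in> padic_integers \<Longrightarrow>
     padic_residue (x - y :: 'p :: prime_card padic) = padic_residue x - padic_residue y"
  using padic_residue_add[of x "- y"] by (simp add: padic_integers_minus)

lemma padic_residue_power [simp]:
  "x \<in> padic_integers \<Longrightarrow> padic_residue (x ^ n :: 'p :: prime_card padic) = padic_residue x ^ n"
  by (induction n) (simp_all add: padic_integers_power)

lemma padic_residue_eq_0_iff:
  fixes x :: "'p :: prime_card padic"
  assumes "x \<in> padic_integers"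
  shows "padic_residue x = 0 \<longleftrightarrow> padic_abs x < 1"
proof
  assume "padic_abs x < 1"
  thus "padic_residue x = 0" using padic_residue_eq[of x 0] by simp
next
  assume 0: "padic_residue x = 0"
  obtain k where k: "padic_abs (x - of_int k) < 1" using assms by (rule padic_integer_approx)
  hence "of_int k = (of_int 0 :: 'p mod_ring)" using 0 padic_residue_eq[OF k] by simp
  hence "padic_abs (of_int k :: 'p padic) < 1"
    by (simp only: of_int_mod_ring_eq_iff padic_abs_of_int_less_1_iff diff_0_right)
  thus "padic_abs x < 1"
    using padic_abs_ultrametric[of "x - of_int k" "of_int k"] k by simp
qed


section \<open>Periodicity modulo powers of p\<close>

lemma somos4_at:
  "somos4 a b f \<Longrightarrow> f (i + 4) * f i = a * f (i + 3) * f (i + 1) + b * f (i + 2) ^ 2"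
  unfolding somos4_def by (drule spec[of _ "i + 2"]) (simp add: add.assoc add.commute[of 1])

lemma somos5_at:
  "somos5 b k f \<Longrightarrow> f (i + 5) * f i + b * f (i + 4) * f (i + 1) = k * f (i + 3) * f (i + 2)"
  unfolding somos5_def by (drule spec[of _ "i + 2"]) (simp add: add.assoc add.commute[of 1])

text \<open>If two neighbours vanish, the recurrence leaves only \<open>b\<close> times the square
  of the next term on either side, so the zeros spread to all indices, including 0.\<close>

lemma somos4_no_consecutive_zeros:
  fixes f :: "int \<Rightarrow> 'a :: idom"
  assumes f: "somos4 a b f" and b: "b \<noteq> 0" and f0: "f 0 \<noteq> 0"
  shows "f m \<noteq> 0 \<or> f (m + 1) \<noteq> 0"
proof (rule ccontr)
  assume "\<not> (f m \<noteq> 0 \<or> f (m + 1) \<noteq> 0)"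
  hence m: "f m = 0" "f (m + 1) = 0" by auto
  have "f n = 0 \<and> f (n + 1) = 0" for n
  proof (induction n rule: int_induct[where k = m])
    case (step1 i)
    have "b * f (i + 2) ^ 2 = 0"
      using somos4_at[OF f, of i] step1 by simp
    thus ?case using step1 b by (simp add: add.assoc)
  next
    case (step2 i)
    have "b * f (i - 1) ^ 2 = 0"
      using somos4_at[OF f, of "i - 3"] step2 by (simp add: add.commute)
    thus ?case using step2 b by simp
  qed (use m in auto)
  thus False using f0 by blast
qed

text \<open>Somos-4 determines the next term \<open>f (i + 5)\<close> if \<open>f (i + 1)\<close> is
  nonzero, and Somos-5 determines it if \<open>f i\<close> is nonzero; one of the two always
  applies. Downwards \<open>f (i + 3)\<close> and \<open>f (i + 4)\<close> play these parts.\<close>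

lemma somos_window_unique:
  fixes f g :: "int \<Rightarrow> 'a :: idom"
  assumes f: "somos4 a b f" "somos5 b k f" and g: "somos4 a b g" "somos5 b k g"
    and nz: "\<And>m. f m \<noteq> 0 \<or> f (m + 1) \<noteq> 0"
    and eq: "\<And>i. i \<in> {0..4} \<Longrightarrow> f (n0 + i) = g (n0 + i)"
  shows "f n = g n"
proof -
  have "f n = g n \<and> f (n + 1) = g (n + 1) \<and> f (n + 2) = g (n + 2) \<and> f (n + 3) = g (n + 3)
      \<and> f (n + 4) = g (n + 4)"
  proof (induction n rule: int_induct[where k = n0])
    case base
    show ?case using eq[of 0] eq[of 1] eq[of 2] eq[of 3] eq[of 4] by simp
  next
    case (step1 i)
    have "f (i + 5) * f (i + 1) = g (i + 5) * f (i + 1)"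
      using somos4_at[OF f(1), of "i + 1"] somos4_at[OF g(1), of "i + 1"] step1 by (simp add: add.assoc)
    moreover have "f (i + 5) * f i = g (i + 5) * f i"
      using somos5_at[OF f(2), of i] somos5_at[OF g(2), of i] step1
      by (simp add: add.assoc eq_diff_eq[symmetric])
    ultimately have "f (i + 5) = g (i + 5)" using nz[of i] by auto
    thus ?case using step1 by (simp add: add.assoc)
  next
    case (step2 i)
    have "f (i + 3) * f (i - 1) = f (i + 3) * g (i - 1)"
      using somos4_at[OF f(1), of "i - 1"] somos4_at[OF g(1), of "i - 1"] step2 by (simp add: add.commute)
    moreover have "f (i + 4) * f (i - 1) = f (i + 4) * g (i - 1)"
    proof -
      have cancel: "x = y" if "x + c = r" "y + c = r" for x y c r :: 'a
        using that by (metis add_right_imp_eq)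
      show ?thesis
        by (rule cancel[of _ "b * f (i + 3) * f i" "k * f (i + 2) * f (i + 1)"])
           (use somos5_at[OF f(2), of "i - 1"] somos5_at[OF g(2), of "i - 1"] step2 in
             \<open>simp_all add: add.commute\<close>)
    qed
    ultimately have "f (i - 1) = g (i - 1)" using nz[of "i + 3"] by (auto simp: add.commute)
    thus ?case using step2 by (simp add: add.commute)
  qed
  thus ?thesis by blast
qed

text \<open>The derivatives of the Somos-4 and Somos-5 relations at \<open>f\<close> in the
  direction \<open>d\<close>.\<close>

definition linear_somos :: "'a :: comm_ring_1 \<Rightarrow> 'a \<Rightarrow> 'a \<Rightarrow> (int \<Rightarrow> 'a) \<Rightarrow> (int \<Rightarrow> 'a) \<Rightarrow> bool" where
  "linear_somos a b k f d \<longleftrightarrow>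
     (\<forall>m. f (m + 2) * d (m - 2) + d (m + 2) * f (m - 2)
            = a * (f (m + 1) * d (m - 1) + d (m + 1) * f (m - 1)) + 2 * b * f m * d m) \<and>
     (\<forall>m. f (m + 3) * d (m - 2) + d (m + 3) * f (m - 2)
            + b * (f (m + 2) * d (m - 1) + d (m + 2) * f (m - 1))
            = k * (f (m + 1) * d m + d (m + 1) * f m))"

lemma linear_somos_window_zero:
  fixes f d :: "int \<Rightarrow> 'a :: idom"
  assumes d: "linear_somos a b k f d" and nz: "\<And>m. f m \<noteq> 0 \<or> f (m + 1) \<noteq> 0"
    and eq: "\<And>i. i \<in> {0..4} \<Longrightarrow> d (n0 + i) = 0"
  shows "d n = 0"
proof -
  have l4: "f (m + 2) * d (m - 2) + d (m + 2) * f (m - 2)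
      = a * (f (m + 1) * d (m - 1) + d (m + 1) * f (m - 1)) + 2 * b * f m * d m"
    and l5: "f (m + 3) * d (m - 2) + d (m + 3) * f (m - 2)
            + b * (f (m + 2) * d (m - 1) + d (m + 2) * f (m - 1))
            = k * (f (m + 1) * d m + d (m + 1) * f m)" for m
    using d by (auto simp: linear_somos_def)
  have l4': "f (i + 4) * d i + d (i + 4) * f i
      = a * (f (i + 3) * d (i + 1) + d (i + 3) * f (i + 1)) + 2 * b * f (i + 2) * d (i + 2)"
    and l5': "f (i + 5) * d i + d (i + 5) * f i
            + b * (f (i + 4) * d (i + 1) + d (i + 4) * f (i + 1))
            = k * (f (i + 3) * d (i + 2) + d (i + 3) * f (i + 2))" for i
    using l4[of "i + 2"] l5[of "i + 2"] by (simp_all add: add.assoc add.commute[of 1])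
  have "d n = 0 \<and> d (n + 1) = 0 \<and> d (n + 2) = 0 \<and> d (n + 3) = 0 \<and> d (n + 4) = 0"
  proof (induction n rule: int_induct[where k = n0])
    case base
    show ?case using eq[of 0] eq[of 1] eq[of 2] eq[of 3] eq[of 4] by simp
  next
    case (step1 i)
    have "d (i + 5) * f (i + 1) = 0" using l4'[of "i + 1"] step1 by (simp add: add.assoc)
    moreover have "d (i + 5) * f i = 0" using l5'[of i] step1 by simp
    ultimately show ?case using nz[of i] step1 by (auto simp: add.assoc)
  next
    case (step2 i)
    have "f (i + 3) * d (i - 1) = 0" using l4'[of "i - 1"] step2 by (simp add: add.commute)
    moreover have "f (i + 4) * d (i - 1) = 0" using l5'[of "i - 1"] step2 by (simp add: add.commute)
    ultimately show ?case using nz[of "i + 3"] step2 by (auto simp: add.commute)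
  qed
  thus ?thesis by blast
qed

section \<open>Periods over a finite field\<close>

lemma periodic_mult:
  fixes f :: "int \<Rightarrow> 'a"
  assumes "\<And>n. f (n + t) = f n"
  shows "f (n + j * t) = f n"
proof (induction j rule: int_induct[where k = 0])
  case (step1 i)
  thus ?case using assms[of "n + i * t"] by (simp add: algebra_simps)
next
  case (step2 i)
  thus ?case using assms[of "n + (i - 1) * t"] by (simp add: algebra_simps)
qed simp

text \<open>Windows of five terms are compared at the multiples of \<open>t\<close> only. The bound
  on the gap \<open>g\<close> depends on the field alone, so the factorial of the bound is a
  multiple of every gap that can occur.\<close>

lemma windows_pigeonhole:
  fixes f :: "int \<Rightarrow> 'a :: finite"
  shows "\<exists>i g :: nat. 0 < g \<and> g \<le> CARD('a \<times> 'a \<times> 'a \<times> 'a \<times> 'a) \<and>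
    (\<forall>l\<in>{0..4}. f (int i * t + int g * t + l) = f (int i * t + l))"
proof -
  define N where "N = CARD('a \<times> 'a \<times> 'a \<times> 'a \<times> 'a)"
  define W where "W = (\<lambda>i::nat. (f (int i * t), f (int i * t + 1), f (int i * t + 2),
    f (int i * t + 3), f (int i * t + 4)))"
  have "card (W ` {0..N}) \<le> N" unfolding N_def by (rule card_mono) simp_all
  hence "\<not> inj_on W {0..N}" by (intro pigeonhole) simp
  then obtain i j where ij: "i < j" "j \<le> N" "W i = W j"
    unfolding inj_on_def by (metis atLeastAtMost_iff linorder_neqE_nat)
  have "f (int i * t + int (j - i) * t + l) = f (int i * t + l)" if "l \<in> {0..4}" for l
  proof -
    have "int i * t + int (j - i) * t = int j * t" using ij by (simp add: of_nat_diff algebra_simps)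
    moreover have "l = 0 \<or> l = 1 \<or> l = 2 \<or> l = 3 \<or> l = 4" using that by auto
    ultimately show ?thesis using ij(3) by (auto simp: W_def)
  qed
  thus ?thesis using ij unfolding N_def by (intro exI[of _ i] exI[of _ "j - i"]) auto
qed

lemma somos_periodic:
  fixes f :: "int \<Rightarrow> 'a :: {finite, idom}"
  assumes f: "somos4 a b f" "somos5 b k f" and nz: "\<And>m. f m \<noteq> 0 \<or> f (m + 1) \<noteq> 0"
  obtains t :: nat where "t > 0" "\<And>n. f (n + int t) = f n"
proof -
  obtain i g :: nat where ig: "0 < g"
    "\<forall>l\<in>{0..4}. f (int i * 1 + int g * 1 + l) = f (int i * 1 + l)"
    using windows_pigeonhole[of f 1] by blast
  have "f n = f (n + int g)" for n
  proof (rule somos_window_unique[OF f _ _ nz])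
    show "somos4 a b (\<lambda>n. f (n + int g))" unfolding somos4_def
    proof
      fix m
      show "f (m + 2 + int g) * f (m - 2 + int g)
          = a * f (m + 1 + int g) * f (m - 1 + int g) + b * f (m + int g) ^ 2"
        using f(1)[unfolded somos4_def, rule_format, of "m + int g"] by (simp add: algebra_simps)
    qed
    show "somos5 b k (\<lambda>n. f (n + int g))" unfolding somos5_def
    proof
      fix m
      show "f (m + 3 + int g) * f (m - 2 + int g) + b * f (m + 2 + int g) * f (m - 1 + int g)
          = k * f (m + 1 + int g) * f (m + int g)"
        using f(2)[unfolded somos5_def, rule_format, of "m + int g"] by (simp add: algebra_simps)
    qed
    show "f (int i + l) = f (int i + l + int g)" if "l \<in> {0..4}" for l
      using bspec[OF ig(2) that] by (simp add: algebra_simps)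
  qed
  thus ?thesis using that[of g] ig(1) by simp
qed

text \<open>If \<open>s\<close> is a period of \<open>f\<close>, then \<open>d (n + s) - d n\<close>
  is again a solution of the linearized relations. For a suitable \<open>s = g * t\<close> it
  vanishes on a window, hence everywhere. The factorial makes the period independent of
  \<open>d\<close>.\<close>

lemma linear_somos_periodic:
  fixes f d :: "int \<Rightarrow> 'a :: {finite, idom}"
  assumes d: "linear_somos a b k f d" and nz: "\<And>m. f m \<noteq> 0 \<or> f (m + 1) \<noteq> 0"
    and t: "\<And>n. f (n + t) = f n"
  shows "d (n + fact CARD('a \<times> 'a \<times> 'a \<times> 'a \<times> 'a) * t) = d n"
proof -
  let ?N = "CARD('a \<times> 'a \<times> 'a \<times> 'a \<times> 'a)"
  obtain i g :: nat where ig: "0 < g" "g \<le> ?N"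
    "\<forall>l\<in>{0..4}. d (int i * t + int g * t + l) = d (int i * t + l)"
    using windows_pigeonhole[of d t] by blast
  define s where "s = int g * t"
  have s: "f (n + s) = f n" for n unfolding s_def by (rule periodic_mult) (rule t)
  have l4: "f (m + 2) * d (m - 2) + d (m + 2) * f (m - 2)
      = a * (f (m + 1) * d (m - 1) + d (m + 1) * f (m - 1)) + 2 * b * f m * d m"
    and l5: "f (m + 3) * d (m - 2) + d (m + 3) * f (m - 2)
            + b * (f (m + 2) * d (m - 1) + d (m + 2) * f (m - 1))
            = k * (f (m + 1) * d m + d (m + 1) * f m)" for m
    using d by (auto simp: linear_somos_def)
  have shift: "x + s + l = (x + l) + s" "x + s - l = (x - l) + s" for x l :: int by simp_all
  have "linear_somos a b k f (\<lambda>n. d (n + s) - d n)"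
    unfolding linear_somos_def
  proof (intro conjI allI)
    fix m
    show "f (m + 2) * (d (m - 2 + s) - d (m - 2)) + (d (m + 2 + s) - d (m + 2)) * f (m - 2)
        = a * (f (m + 1) * (d (m - 1 + s) - d (m - 1)) + (d (m + 1 + s) - d (m + 1)) * f (m - 1))
          + 2 * b * f m * (d (m + s) - d m)"
      using l4[of m] l4[of "m + s"] unfolding shift s by (simp add: algebra_simps)
    show "f (m + 3) * (d (m - 2 + s) - d (m - 2)) + (d (m + 3 + s) - d (m + 3)) * f (m - 2)
        + b * (f (m + 2) * (d (m - 1 + s) - d (m - 1)) + (d (m + 2 + s) - d (m + 2)) * f (m - 1))
        = k * (f (m + 1) * (d (m + s) - d m) + (d (m + 1 + s) - d (m + 1)) * f m)"
      using l5[of m] l5[of "m + s"] unfolding shift s by (simp add: algebra_simps)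
  qed
  hence "d (n + s) - d n = 0" for n
    by (rule linear_somos_window_zero[where f = f and ?n0.0 = "int i * t", OF _ nz])
       (use ig(3) in \<open>simp add: s_def algebra_simps\<close>)
  hence ds: "d (n + s) = d n" for n by simp
  have "g dvd fact ?N" using ig by (simp add: dvd_fact)
  then obtain j where j: "fact ?N = g * j" by blast
  have "fact ?N * t = int j * s"
    unfolding s_def using arg_cong[OF j, of int] by (simp add: mult_ac)
  thus ?thesis using periodic_mult[of d s, OF ds] by simp
qed

section \<open>Lifting periods to higher powers of p\<close>

lemma padic_residue_sum:
  fixes f :: "nat \<Rightarrow> 'p :: prime_card padic"
  assumes "\<And>j. f j \<in> padic_integers"
  shows "(\<Sum>j<n. f j) \<in> padic_integers" "padic_residue (\<Sum>j<n. f j) = (\<Sum>j<n. padic_residue (f j))"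
proof -
  have "(\<Sum>j<n. f j) \<in> padic_integers \<and> padic_residue (\<Sum>j<n. f j) = (\<Sum>j<n. padic_residue (f j))"
    by (induction n) (auto simp: assms)
  thus "(\<Sum>j<n. f j) \<in> padic_integers" "padic_residue (\<Sum>j<n. f j) = (\<Sum>j<n. padic_residue (f j))"
    by auto
qed

lemma somos_padic_periodic:
  fixes f :: "int \<Rightarrow> 'p :: prime_card padic"
  assumes f: "somos4 a b f" "somos5 b k f" and int: "\<And>n. f n \<in> padic_integers"
    and abk: "a \<in> padic_integers" "b \<in> padic_integers" "k \<in> padic_integers"
    and b: "padic_residue b \<noteq> 0" and f0: "f 0 = 1"
  obtains M :: nat where "M > 0"
    "\<And>h n. padic_abs (f (n + int (M * CARD('p) ^ h)) - f n) \<le> (1 / real CARD('p)) ^ Suc h"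
proof -
  define c where "c = (\<lambda>n. padic_residue (f n))"
  note mem = int abk padic_integers_add padic_integers_mult padic_integers_power padic_integers_diff
  have c4: "somos4 (padic_residue a) (padic_residue b) c"
    unfolding somos4_def
  proof
    fix m
    show "c (m + 2) * c (m - 2) = padic_residue a * c (m + 1) * c (m - 1) + padic_residue b * c m ^ 2"
      using arg_cong[OF f(1)[unfolded somos4_def, rule_format, of m], of padic_residue]
      by (simp add: c_def mem)
  qed
  have c5: "somos5 (padic_residue b) (padic_residue k) c"
    unfolding somos5_def
  proof
    fix m
    show "c (m + 3) * c (m - 2) + padic_residue b * c (m + 2) * c (m - 1) = padic_residue k * c (m + 1) * c m"
      using arg_cong[OF f(2)[unfolded somos5_def, rule_format, of m], of padic_residue]
      by (simp add: c_def mem)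
  qed
  have nz: "c m \<noteq> 0 \<or> c (m + 1) \<noteq> 0" for m
    by (rule somos4_no_consecutive_zeros[OF c4 b]) (simp add: c_def f0)
  obtain t where t: "t > 0" "\<And>n. c (n + int t) = c n"
    by (rule somos_periodic[OF c4 c5 nz]) blast
  let ?N = "CARD('p mod_ring \<times> 'p mod_ring \<times> 'p mod_ring \<times> 'p mod_ring \<times> 'p mod_ring)"
  \<comment> \<open>The factor \<open>t\<close> is a period modulo \<open>p\<close>; the factorial
    makes \<open>M\<close> a period of every solution of the linearized relations at
    \<open>c\<close>.\<close>
  define M :: nat where "M = fact ?N * t"
  define P where "P = (of_nat CARD('p) :: 'p padic)"
  have P: "P \<noteq> 0" "P \<in> padic_integers" "padic_residue P = 0" "padic_abs P = 1 / real CARD('p)"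
    using padic_CARD_nz[where ?'p = 'p] padic_abs_CARD[where ?'p = 'p] p_gt_1[where ?'p = 'p]
    by (simp_all add: P_def padic_residue_eq_0_iff)
  have "padic_abs (f (n + int (M * CARD('p) ^ h)) - f n) \<le> (1 / real CARD('p)) ^ Suc h" for h n
  proof (induction h arbitrary: n)
    case 0
    have "c (n + int (fact ?N) * int t) = c n" by (rule periodic_mult) (rule t(2))
    hence "padic_residue (f (n + int M) - f n) = 0" by (simp add: M_def c_def mem)
    hence "padic_abs (f (n + int M) - f n) < 1"
      using padic_residue_eq_0_iff[OF padic_integers_diff[OF int int]] by blast
    thus ?case by (simp add: padic_abs_less_1D)
  next
    case (Suc h)
    define T where "T = int (M * CARD('p) ^ h)"
    \<comment> \<open>The error of the period \<open>T\<close>, scaled by its size; it is integral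
      by the induction hypothesis.\<close>
    define D where "D = (\<lambda>n. (f (n + T) - f n) / P ^ Suc h)"
    define d where "d = (\<lambda>n. padic_residue (D n))"
    have fD: "f (n + T) = f n + P ^ Suc h * D n" for n using P by (simp add: D_def)
    have Dint: "D n \<in> padic_integers" for n
    proof -
      have "(0 :: real) < (1 / real CARD('p)) ^ Suc h" using p_gt_1[where ?'p = 'p] by simp
      moreover have "padic_abs (D n) = padic_abs (f (n + T) - f n) / (1 / real CARD('p)) ^ Suc h"
        by (simp only: D_def padic_abs_divide padic_abs_power P(4))
      ultimately show ?thesis
        using Suc[of n] unfolding padic_integers_iff T_def by (simp only: divide_le_eq_1_pos)
    qed
    note mem' = mem Dint P(2)
    have shift: "x + T + l = (x + l) + T" "x + T - l = (x - l) + T" for x l :: int by simp_all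
    have "linear_somos (padic_residue a) (padic_residue b) (padic_residue k) c d"
      unfolding linear_somos_def
    proof (intro conjI allI)
      fix m
      \<comment> \<open>The recurrence at \<open>m + T\<close> minus the one at \<open>m\<close>.
        Terms quadratic in \<open>D\<close> carry \<open>P ^ Suc h\<close> twice, so one factor
        \<open>P\<close> survives the cancellation and kills them modulo \<open>p\<close>.\<close>
      have "P ^ Suc h * (f (m + 2) * D (m - 2) + D (m + 2) * f (m - 2) + P * (P ^ h * D (m + 2) * D (m - 2)))
          = P ^ Suc h * (a * (f (m + 1) * D (m - 1) + D (m + 1) * f (m - 1) + P * (P ^ h * D (m + 1) * D (m - 1)))
              + b * (2 * f m * D m + P * (P ^ h * D m ^ 2)))"
        using f(1)[unfolded somos4_def, rule_format, of m] f(1)[unfolded somos4_def, rule_format, of "m + T"]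
        unfolding shift fD by (simp add: algebra_simps power2_eq_square)
      hence "f (m + 2) * D (m - 2) + D (m + 2) * f (m - 2) + P * (P ^ h * D (m + 2) * D (m - 2))
          = a * (f (m + 1) * D (m - 1) + D (m + 1) * f (m - 1) + P * (P ^ h * D (m + 1) * D (m - 1)))
              + b * (2 * f m * D m + P * (P ^ h * D m ^ 2))"
        using P(1) by simp
      from arg_cong[OF this, of padic_residue]
      show "c (m + 2) * d (m - 2) + d (m + 2) * c (m - 2)
            = padic_residue a * (c (m + 1) * d (m - 1) + d (m + 1) * c (m - 1)) + 2 * padic_residue b * c m * d m"
        by (simp add: mem' P(3) c_def d_def mult_ac)
      have "P ^ Suc h * (f (m + 3) * D (m - 2) + D (m + 3) * f (m - 2) + P * (P ^ h * D (m + 3) * D (m - 2))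
            + b * (f (m + 2) * D (m - 1) + D (m + 2) * f (m - 1) + P * (P ^ h * D (m + 2) * D (m - 1))))
          = P ^ Suc h * (k * (f (m + 1) * D m + D (m + 1) * f m + P * (P ^ h * D (m + 1) * D m)))"
      proof -
        have "P ^ Suc h * (f (m + 3) * D (m - 2) + D (m + 3) * f (m - 2) + P * (P ^ h * D (m + 3) * D (m - 2))
            + b * (f (m + 2) * D (m - 1) + D (m + 2) * f (m - 1) + P * (P ^ h * D (m + 2) * D (m - 1))))
          = (f (m + T + 3) * f (m + T - 2) + b * f (m + T + 2) * f (m + T - 1))
            - (f (m + 3) * f (m - 2) + b * f (m + 2) * f (m - 1))"
          unfolding shift fD by (simp add: algebra_simps)
        also have "\<dots> = k * f (m + T + 1) * f (m + T) - k * f (m + 1) * f m"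
          using f(2)[unfolded somos5_def, rule_format, of m] f(2)[unfolded somos5_def, rule_format, of "m + T"]
          by (simp only:)
        also have "\<dots> = P ^ Suc h * (k * (f (m + 1) * D m + D (m + 1) * f m + P * (P ^ h * D (m + 1) * D m)))"
          unfolding shift fD by (simp add: algebra_simps)
        finally show ?thesis .
      qed
      hence "f (m + 3) * D (m - 2) + D (m + 3) * f (m - 2) + P * (P ^ h * D (m + 3) * D (m - 2))
            + b * (f (m + 2) * D (m - 1) + D (m + 2) * f (m - 1) + P * (P ^ h * D (m + 2) * D (m - 1)))
          = k * (f (m + 1) * D m + D (m + 1) * f m + P * (P ^ h * D (m + 1) * D m))"
        using P(1) by simp
      from arg_cong[OF this, of padic_residue]
      show "c (m + 3) * d (m - 2) + d (m + 3) * c (m - 2)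
            + padic_residue b * (c (m + 2) * d (m - 1) + d (m + 2) * c (m - 1))
            = padic_residue k * (c (m + 1) * d m + d (m + 1) * c m)"
        by (simp add: mem' P(3) c_def d_def)
    qed
    from linear_somos_periodic[OF this nz t(2)]
    have dM: "d (n + int M) = d n" for n by (simp add: M_def)
    \<comment> \<open>\<open>T\<close> is a multiple of the period \<open>M\<close> of
      \<open>d\<close>.\<close>
    have dT: "d (n + int j * T) = d n" for n j
      using periodic_mult[of d "int M" n "int j * int CARD('p) ^ h", OF dM] by (simp add: T_def mult_ac)
    have tele: "f (n + int j * T) = f n + P ^ Suc h * (\<Sum>i<j. D (n + int i * T))" for n j
    proof (induction j)
      case (Suc j)
      have "f (n + int (Suc j) * T) = f (n + int j * T + T)" by (simp add: algebra_simps)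
      also have "\<dots> = f n + P ^ Suc h * (\<Sum>i<Suc j. D (n + int i * T))"
        unfolding fD Suc by (simp add: algebra_simps)
      finally show ?case .
    qed simp
    let ?S = "\<Sum>i<CARD('p). D (n + int i * T)"
    \<comment> \<open>All \<open>p\<close> summands have the same residue, so their sum vanishes
      modulo \<open>p\<close>; this gains the additional power of \<open>p\<close>.\<close>
    have "padic_residue ?S = (\<Sum>i<CARD('p). d (n + int i * T))"
      by (simp add: padic_residue_sum Dint d_def)
    also have "\<dots> = of_nat CARD('p) * d n" by (simp add: dT)
    also have "(of_nat CARD('p) :: 'p mod_ring) = 0"
      using of_nat_CHAR[where 'a = "'p mod_ring"] by simp
    finally have "padic_abs ?S < 1"
      using padic_residue_eq_0_iff[OF padic_residue_sum(1)[of "\<lambda>i. D (n + int i * T)" "CARD('p)"]] Dint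
      by simp
    hence "padic_abs ?S \<le> 1 / real CARD('p)" by (rule padic_abs_less_1D)
    moreover have "int (M * CARD('p) ^ Suc h) = int CARD('p) * T" by (simp add: T_def)
    hence "f (n + int (M * CARD('p) ^ Suc h)) - f n = P ^ Suc h * ?S"
      by (simp only: tele add_diff_cancel_left')
    hence "padic_abs (f (n + int (M * CARD('p) ^ Suc h)) - f n) = (1 / real CARD('p)) ^ Suc h * padic_abs ?S"
      by (simp only: padic_abs_mult padic_abs_power P(4))
    moreover have "(0 :: real) \<le> (1 / real CARD('p)) ^ Suc h" by simp
    ultimately show ?case by (metis mult_left_mono power_Suc2)
  qed
  moreover have "M > 0" using t(1) by (simp add: M_def)
  ultimately show ?thesis using that by blast
qed

text \<open>
  Uniform continuity for the topology on the integers with the neighbourhoods \<open>M p\<^sup>c \<int>\<close> of 0.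
\<close>

definition Mp_continuous :: "nat \<Rightarrow> (int \<Rightarrow> 'p :: prime_card padic) \<Rightarrow> bool" where
  "Mp_continuous M f \<longleftrightarrow> (\<forall>n. f n \<in> padic_integers) \<and>
     (\<forall>e>0. \<exists>c. \<forall>n n'. int (M * CARD('p) ^ c) dvd n' - n \<longrightarrow> padic_abs (f n' - f n) < e)"

text \<open>By the ultrametric inequality the error does not grow when a shift by \<open>T\<close>
  is repeated, in either direction, so the bound for one shift holds for all multiples of
  \<open>T\<close>.\<close>

lemma Mp_continuousI:
  fixes f :: "int \<Rightarrow> 'p :: prime_card padic"
  assumes int: "\<And>n. f n \<in> padic_integers"
    and M: "\<And>h n. padic_abs (f (n + int (M * CARD('p) ^ h)) - f n) \<le> (1 / real CARD('p)) ^ Suc h"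
  shows "Mp_continuous M f"
  unfolding Mp_continuous_def
proof (intro conjI allI impI int)
  fix e :: real assume e: "e > 0"
  have "(\<lambda>h. (1 / real CARD('p)) ^ h) \<longlonglongrightarrow> 0"
    using p_gt_1[where ?'p = 'p] by (intro LIMSEQ_power_zero) simp
  from order_tendstoD(2)[OF this e] obtain h where "(1 / real CARD('p)) ^ h < e"
    by (auto simp: eventually_sequentially)
  moreover have "(1 / real CARD('p)) ^ Suc h \<le> (1 / real CARD('p)) ^ h"
    using p_gt_1[where ?'p = 'p] by (intro power_decreasing) auto
  ultimately have h: "(1 / real CARD('p)) ^ Suc h < e" by linarith
  define T where "T = int (M * CARD('p) ^ h)"
  have T: "padic_abs (f (n + T) - f n) < e" for n using M[of n h] h by (simp only: T_def)
  have "padic_abs (f (n + j * T) - f n) < e" for n j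
  proof (induction j rule: int_induct[where k = 0])
    case base
    show ?case using e by simp
  next
    case (step1 i)
    have "f (n + (i + 1) * T) - f n = (f (n + i * T + T) - f (n + i * T)) + (f (n + i * T) - f n)"
      by (simp add: algebra_simps)
    thus ?case using padic_abs_ultrametric[of "f (n + i * T + T) - f (n + i * T)" "f (n + i * T) - f n"]
        T[of "n + i * T"] step1 by simp
  next
    case (step2 i)
    have "f (n + (i - 1) * T) - f n = (f (n + i * T) - f n) - (f (n + (i - 1) * T + T) - f (n + (i - 1) * T))"
      by (simp add: algebra_simps)
    thus ?case using padic_abs_diff_ultrametric[of "f (n + i * T) - f n" "f (n + (i - 1) * T + T) - f (n + (i - 1) * T)"]
        T[of "n + (i - 1) * T"] step2 by simp
  qed
  hence "\<forall>n n'. T dvd n' - n \<longrightarrow> padic_abs (f n' - f n) < e"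
    by (metis add_diff_cancel_left' diff_add_cancel dvd_def mult.commute add.commute)
  thus "\<exists>c. \<forall>n n'. int (M * CARD('p) ^ c) dvd n' - n \<longrightarrow> padic_abs (f n' - f n) < e"
    unfolding T_def by blast
qed

lemma Mp_continuous_const:
  "x \<in> padic_integers \<Longrightarrow> Mp_continuous M (\<lambda>_. x)"
  by (simp add: Mp_continuous_def)

lemma Mp_continuous_shift:
  assumes "Mp_continuous M f"
  shows "Mp_continuous M (\<lambda>n. f (n + k))"
  using assms unfolding Mp_continuous_def
  by (metis add_diff_cancel_right)

text \<open>Addition, subtraction and multiplication of p-adic integers do not increase distances in
  the maximum metric, so the finer of the two moduli serves for the combined function.\<close>

lemma Mp_continuous_combine:
  fixes f g :: "int \<Rightarrow> 'p :: prime_card padic" and F :: "'p padic \<Rightarrow> 'p padic \<Rightarrow> 'p padic"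
  assumes f: "Mp_continuous M f" and g: "Mp_continuous M g"
    and int: "\<And>x y. x \<in> padic_integers \<Longrightarrow> y \<in> padic_integers \<Longrightarrow> F x y \<in> padic_integers"
    and F: "\<And>x y x' y'. x \<in> padic_integers \<Longrightarrow> y \<in> padic_integers \<Longrightarrow> x' \<in> padic_integers \<Longrightarrow>
      y' \<in> padic_integers \<Longrightarrow> padic_abs (F x' y' - F x y) \<le> max (padic_abs (x' - x)) (padic_abs (y' - y))"
  shows "Mp_continuous M (\<lambda>n. F (f n) (g n))"
  unfolding Mp_continuous_def
proof (intro conjI allI impI)
  have fi: "f n \<in> padic_integers" and gi: "g n \<in> padic_integers" for n
    using f g by (auto simp: Mp_continuous_def)
  show "F (f n) (g n) \<in> padic_integers" for n by (rule int[OF fi gi])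
  fix e :: real assume e: "e > 0"
  obtain c where c: "\<And>n n'. int (M * CARD('p) ^ c) dvd n' - n \<Longrightarrow> padic_abs (f n' - f n) < e"
    using f e unfolding Mp_continuous_def by metis
  obtain d where d: "\<And>n n'. int (M * CARD('p) ^ d) dvd n' - n \<Longrightarrow> padic_abs (g n' - g n) < e"
    using g e unfolding Mp_continuous_def by metis
  have dvd: "int (M * CARD('p) ^ c) dvd int (M * CARD('p) ^ max c d)"
    "int (M * CARD('p) ^ d) dvd int (M * CARD('p) ^ max c d)"
    by (simp_all add: le_imp_power_dvd mult_dvd_mono)
  show "\<exists>c. \<forall>n n'. int (M * CARD('p) ^ c) dvd n' - n \<longrightarrow> padic_abs (F (f n') (g n') - F (f n) (g n)) < e"
  proof (intro exI[of _ "max c d"] allI impI)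
    fix n n' assume "int (M * CARD('p) ^ max c d) dvd n' - n"
    hence "padic_abs (f n' - f n) < e" "padic_abs (g n' - g n) < e"
      using c d dvd dvd_trans by blast+
    thus "padic_abs (F (f n') (g n') - F (f n) (g n)) < e"
      using F[OF fi gi fi gi, of n' n' n n] by linarith
  qed
qed

lemma Mp_continuous_diff:
  "Mp_continuous M f \<Longrightarrow> Mp_continuous M g \<Longrightarrow>
     Mp_continuous M (\<lambda>n. f n - g n)"
proof (erule Mp_continuous_combine, assumption)
  fix x y x' y' :: "'a padic"
  show "padic_abs (x' - y' - (x - y)) \<le> max (padic_abs (x' - x)) (padic_abs (y' - y))"
    using padic_abs_diff_ultrametric[of "x' - x" "y' - y"] by (simp add: algebra_simps)
qed (rule padic_integers_diff)

lemma Mp_continuous_add: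
  "Mp_continuous M f \<Longrightarrow> Mp_continuous M g \<Longrightarrow>
     Mp_continuous M (\<lambda>n. f n + g n)"
proof (erule Mp_continuous_combine, assumption)
  fix x y x' y' :: "'a padic"
  show "padic_abs (x' + y' - (x + y)) \<le> max (padic_abs (x' - x)) (padic_abs (y' - y))"
    using padic_abs_ultrametric[of "x' - x" "y' - y"] by (simp add: algebra_simps)
qed (rule padic_integers_add)

lemma Mp_continuous_mult:
  "Mp_continuous M f \<Longrightarrow> Mp_continuous M g \<Longrightarrow>
     Mp_continuous M (\<lambda>n. f n * g n)"
proof (erule Mp_continuous_combine, assumption)
  fix x y x' y' :: "'a padic"
  assume *: "x \<in> padic_integers" "y' \<in> padic_integers"
  have "padic_abs ((x' - x) * y') \<le> padic_abs (x' - x)" "padic_abs (x * (y' - y)) \<le> padic_abs (y' - y)"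
    using * by (simp_all add: padic_abs_mult padic_integers_iff mult_left_le mult_left_le_one_le)
  moreover have "x' * y' - x * y = (x' - x) * y' + x * (y' - y)" by (simp add: algebra_simps)
  ultimately show "padic_abs (x' * y' - x * y) \<le> max (padic_abs (x' - x)) (padic_abs (y' - y))"
    using padic_abs_ultrametric[of "(x' - x) * y'" "x * (y' - y)"] by simp
qed (rule padic_integers_mult)

lemma Mp_continuous_power:
  "Mp_continuous M f \<Longrightarrow> Mp_continuous M (\<lambda>n. f n ^ k)"
  by (induction k) (auto intro: Mp_continuous_const Mp_continuous_mult)

text \<open>The integers \<open>m * q ^ i\<close> with \<open>q = p ^ N\<close> form a Cauchy
  sequence for the neighbourhoods \<open>M * p ^ c\<close>, and uniform continuity carries this over
  to their images. The choice of \<open>N\<close> depends on \<open>p\<close> and \<open>M\<close>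
  alone.\<close>

lemma Mp_continuous_limit:
  fixes p M :: nat
  assumes p: "p = CARD('p :: prime_card)" and M: "M > 0"
  shows "\<exists>N\<ge>1. \<forall>(f :: int \<Rightarrow> 'p padic) m. Mp_continuous M f \<longrightarrow>
    (\<exists>L\<in>padic_integers. (\<lambda>i. f (int (m * (p ^ N) ^ i))) \<longlonglongrightarrow> L)"
proof -
  have prime: "prime p" unfolding p by (rule prime_card)
  obtain M' where M': "M = p ^ multiplicity p M * M'" "\<not> p dvd M'"
    using M prime by (metis multiplicity_decompose' not_prime_unit not_gr_zero)
  \<comment> \<open>\<open>p ^ a\<close> is the full power of \<open>p\<close> in \<open>M\<close>,
    and \<open>N\<close> is an exponent with \<open>p ^ N = 1\<close> modulo the cofactor
    \<open>M'\<close> by Euler's theorem.\<close>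
  define a N where "a = multiplicity p M" and "N = totient M'"
  have "M' > 0" using M M' by (metis gr0I mult_0_right)
  hence N: "N \<ge> 1" by (simp add: N_def Suc_le_eq)
  have "coprime p M'" using prime M'(2) by (rule prime_imp_coprime)
  hence "[p ^ N = 1] (mod M')" unfolding N_def by (rule euler_theorem)
  hence cong: "[(p ^ N) ^ k = 1] (mod M')" for k using cong_pow[of "p ^ N" 1 M' k] by simp
  \<comment> \<open>The difference is \<open>m * q ^ i * (q ^ (j - i) - 1)\<close> with
    \<open>q = p ^ N\<close>: the power \<open>p ^ (a + c)\<close> divides \<open>q ^ i\<close>, and
    \<open>M'\<close> divides the last factor.\<close>
  have dvd: "M * p ^ c dvd m * (p ^ N) ^ j - m * (p ^ N) ^ i" if ij: "a + c \<le> i" "i \<le> j" for c m i j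
  proof -
    have "a + c \<le> N * i" using ij(1) mult_le_mono1[OF N, of i] by linarith
    hence "p ^ (a + c) dvd (p ^ N) ^ i" by (simp add: le_imp_power_dvd flip: power_mult)
    moreover have "M' dvd (p ^ N) ^ (j - i) - 1"
      using cong[of "j - i"] prime_gt_0_nat[OF prime] by (simp add: cong_altdef_nat)
    ultimately have "p ^ (a + c) * M' dvd m * ((p ^ N) ^ i * ((p ^ N) ^ (j - i) - 1))"
      by (intro dvd_mult mult_dvd_mono)
    moreover have "(p ^ N) ^ i * (p ^ N) ^ (j - i) = (p ^ N) ^ j" using ij(2) by (simp flip: power_add)
    hence "m * ((p ^ N) ^ i * ((p ^ N) ^ (j - i) - 1)) = m * (p ^ N) ^ j - m * (p ^ N) ^ i"
      by (simp add: diff_mult_distrib2)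
    moreover have "p ^ (a + c) * M' = M * p ^ c"
      using M'(1) by (simp add: a_def power_add)
    ultimately show ?thesis by simp
  qed
  show ?thesis
  proof (intro exI[of _ N] conjI N allI impI)
    fix f :: "int \<Rightarrow> 'p padic" and m
    assume f: "Mp_continuous M f"
    define X where "X = (\<lambda>i. f (int (m * (p ^ N) ^ i)))"
    have "Cauchy X"
    proof (rule metric_CauchyI)
      fix e :: real assume "e > 0"
      then obtain c where c: "\<And>n n'. int (M * p ^ c) dvd n' - n \<Longrightarrow> padic_abs (f n' - f n) < e"
        using f unfolding Mp_continuous_def p by metis
      have less: "dist (X j) (X i) < e" if ij: "a + c \<le> i" "i \<le> j" for i j
      proof -
        have "m * (p ^ N) ^ i \<le> m * (p ^ N) ^ j"
          using ij(2) prime_gt_0_nat[OF prime] by (intro mult_left_mono power_increasing) auto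
        hence "int (m * (p ^ N) ^ j - m * (p ^ N) ^ i) = int (m * (p ^ N) ^ j) - int (m * (p ^ N) ^ i)"
          by (rule of_nat_diff)
        moreover have "int (M * p ^ c) dvd int (m * (p ^ N) ^ j - m * (p ^ N) ^ i)"
          using dvd[OF ij] by (simp only: int_dvd_int_iff)
        ultimately show ?thesis unfolding X_def dist_padic_def by (intro c) simp
      qed
      have "dist (X i) (X j) < e" if "i \<ge> a + c" "j \<ge> a + c" for i j
        using that less[of i j] less[of j i] by (cases "i \<le> j") (auto simp: dist_commute)
      thus "\<exists>M. \<forall>i\<ge>M. \<forall>j\<ge>M. dist (X i) (X j) < e" by blast
    qed
    then obtain L where L: "X \<longlonglongrightarrow> L" by (auto simp: Cauchy_convergent_iff convergent_def)
    have "L \<in> padic_integers"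
      by (rule padic_integers_LIMSEQ[OF L]) (use f in \<open>simp add: X_def Mp_continuous_def\<close>)
    thus "\<exists>L\<in>padic_integers. (\<lambda>i. f (int (m * (p ^ N) ^ i))) \<longlonglongrightarrow> L" using L unfolding X_def by blast
  qed
qed


section \<open>Reduction and specialization\<close>

lemma padic_abs_eq_1:
  "x \<in> padic_integers \<Longrightarrow> padic_residue x \<noteq> 0 \<Longrightarrow> padic_abs (x :: 'p :: prime_card padic) = 1"
  using padic_residue_eq_0_iff[of x] by (simp add: padic_integers_iff)

text \<open>For nonintegral \<open>y\<close> the term \<open>y ^ 2\<close> would be strictly larger
  than all others in the equation.\<close>

lemma weierstrass_y_integral:
  fixes E :: "'p :: prime_card padic weierstrass"
  assumes E: "set_weierstrass E \<subseteq> padic_integers" and x: "x \<in> padic_integers"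
    and eq: "weierstrass_poly E x y = 0"
  shows "y \<in> padic_integers"
proof (rule ccontr)
  assume "y \<notin> padic_integers"
  hence y: "padic_abs y > 1" by (simp add: padic_integers_iff)
  obtain a1 a2 a3 a4 a6 where W: "E = Weierstrass a1 a2 a3 a4 a6" by (cases E)
  have a: "a1 \<in> padic_integers" "a2 \<in> padic_integers" "a3 \<in> padic_integers"
    "a4 \<in> padic_integers" "a6 \<in> padic_integers" using E by (auto simp: W)
  define s t where "s = a1 * x + a3" and "t = x ^ 3 + a2 * x ^ 2 + a4 * x + a6"
  have s: "s \<in> padic_integers" and t: "t \<in> padic_integers"
    unfolding s_def t_def
    by (intro padic_integers_add padic_integers_mult padic_integers_power a x)+
  have "y * y = t - s * y"
    using eq by (simp add: W weierstrass_poly_def s_def t_def power2_eq_square algebra_simps)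
  hence "padic_abs y * padic_abs y \<le> max (padic_abs t) (padic_abs s * padic_abs y)"
    using padic_abs_diff_ultrametric[of t "s * y"] by (simp add: padic_abs_mult flip: padic_abs_mult)
  also have "\<dots> \<le> padic_abs y"
    using s t y by (simp add: padic_integers_iff mult_left_le_one_le)
  finally show False using y by simp
qed

text \<open>The two expressions are \<open>beta1\<close> and \<open>beta2\<close> at the point
  \<open>P\<close>. If the first is zero then \<open>2 P\<close> is infinity. Otherwise
  \<open>beta1 ^ 2 * (x(P) - x(2 P)) = beta2\<close>, so a zero of the second gives
  \<open>2 P = - P\<close> by the form of the tangent, and \<open>3 P\<close> is infinity.\<close>

lemma point_order_gt_3:
  fixes E :: "'a :: field weierstrass"
  assumes curve: "weierstrass_poly E x y = 0" and ord: "has_point_order E (Point x y) r" "r > 3"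
  shows "2 * y + wa1 E * x + wa3 E \<noteq> 0"
    and "3 * x ^ 4 + wb2 E * x ^ 3 + 3 * wb4 E * x ^ 2 + 3 * wb6 E * x + wb8 E \<noteq> 0"
proof -
  obtain a1 a2 a3 a4 a6 where W: "E = Weierstrass a1 a2 a3 a4 a6" by (cases E)
  define b where "b = 2 * y + a1 * x + a3"
  have ne: "point_mult E 2 (Point x y) \<noteq> Infinity" "point_mult E 3 (Point x y) \<noteq> Infinity"
    using ord by (auto simp: has_point_order_def)
  have b: "b \<noteq> 0"
  proof
    assume "b = 0"
    hence "y + y + a1 * x + a3 = 0" by (simp add: b_def)
    thus False using ne(1) by (simp add: point_mult_def numeral_2_eq_2 W)
  qed
  thus "2 * y + wa1 E * x + wa3 E \<noteq> 0" by (simp add: b_def W)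
  define m where "m = (3 * x ^ 2 + 2 * a2 * x + a4 - a1 * y) / b"
  define x3 where "x3 = m ^ 2 + a1 * m - a2 - x - x"
  define y3 where "y3 = - (m + a1) * x3 - (y - m * x) - a3"
  have "y + y + a1 * x + a3 = b" by (simp add: b_def)
  hence dbl: "point_add E (Point x y) (Point x y) = Point x3 y3"
    using b by (simp add: W Let_def x3_def y3_def m_def b_def[symmetric])
  have a6: "a6 = y ^ 2 + a1 * x * y + a3 * y - x ^ 3 - a2 * x ^ 2 - a4 * x"
    using curve by (simp add: W weierstrass_poly_def algebra_simps)
  have mb: "m * b = 3 * x ^ 2 + 2 * a2 * x + a4 - a1 * y" using b by (simp add: m_def)
  have "b ^ 2 * (x - x3) = b ^ 2 * (3 * x + a2) - (m * b) ^ 2 - a1 * (m * b) * b"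
    by (simp add: x3_def power2_eq_square algebra_simps)
  also have "\<dots> = 3 * x ^ 4 + wb2 E * x ^ 3 + 3 * wb4 E * x ^ 2 + 3 * wb6 E * x + wb8 E"
    unfolding mb unfolding b_def wb2_def wb4_def wb6_def wb8_def W weierstrass.sel a6
    by (simp add: algebra_simps power2_eq_square power3_eq_cube power4_eq_xxxx)
  finally have beta2: "b ^ 2 * (x - x3)
      = 3 * x ^ 4 + wb2 E * x ^ 3 + 3 * wb4 E * x ^ 2 + 3 * wb6 E * x + wb8 E" .
  show "3 * x ^ 4 + wb2 E * x ^ 3 + 3 * wb4 E * x ^ 2 + 3 * wb6 E * x + wb8 E \<noteq> 0"
  proof
    assume "3 * x ^ 4 + wb2 E * x ^ 3 + 3 * wb4 E * x ^ 2 + 3 * wb6 E * x + wb8 E = 0"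
    hence x3: "x3 = x" using beta2 b by simp
    hence "y + y3 + a1 * x3 + a3 = 0" by (simp add: y3_def algebra_simps)
    hence "point_add E (Point x y) (Point x3 y3) = Infinity" using x3 by (simp add: W)
    thus False using ne(2) dbl by (simp add: point_mult_def numeral_3_eq_3)
  qed
qed

lemma reduce_curve_poly:
  fixes E :: "'p :: prime_card padic weierstrass"
  assumes E: "set_weierstrass E \<subseteq> padic_integers"
    and "x \<in> padic_integers" "y \<in> padic_integers"
  shows "weierstrass_poly (reduce_curve E) (padic_residue x) (padic_residue y)
           = padic_residue (weierstrass_poly E x y)"
proof -
  obtain a1 a2 a3 a4 a6 where W: "E = Weierstrass a1 a2 a3 a4 a6" by (cases E)
  have "a1 \<in> padic_integers" "a2 \<in> padic_integers" "a3 \<in> padic_integers"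
    "a4 \<in> padic_integers" "a6 \<in> padic_integers" using E by (auto simp: W)
  thus ?thesis
    using assms(2,3)
    by (simp add: W reduce_curve_def weierstrass_poly_def padic_integers_add padic_integers_mult
        padic_integers_power padic_integers_diff)
qed

text \<open>
  The square of the slope of the chord, which is not integral, dominates the \<open>x\<close>-coordinate of the sum.
\<close>

lemma reduce_chord:
  fixes E :: "'p :: prime_card padic weierstrass"
  assumes E: "set_weierstrass E \<subseteq> padic_integers"
    and int: "x1 \<in> padic_integers" "x2 \<in> padic_integers" "y1 \<in> padic_integers" "y2 \<in> padic_integers"
    and neq: "x1 \<noteq> x2" and x: "padic_abs (x2 - x1) < 1" and y: "padic_abs (y2 - y1) = 1"
  shows "reduce_point (point_add E (Point x1 y1) (Point x2 y2)) = Infinity"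
proof -
  obtain a1 a2 a3 a4 a6 where W: "E = Weierstrass a1 a2 a3 a4 a6" by (cases E)
  have a: "a1 \<in> padic_integers" "a2 \<in> padic_integers" using E by (auto simp: W)
  define m where "m = (y2 - y1) / (x2 - x1)"
  have m: "padic_abs m > 1"
    using x y neq padic_abs_ge_0[of "x2 - x1"] padic_abs_eq_0_iff[of "x2 - x1"]
    by (simp add: m_def padic_abs_divide less_divide_eq del: padic_abs_ge_0 padic_abs_eq_0_iff)
  have "padic_abs (a1 * m - (a2 + x1 + x2)) \<le> max (padic_abs (a1 * m)) (padic_abs (a2 + x1 + x2))"
    by (rule padic_abs_diff_ultrametric)
  also have "\<dots> \<le> padic_abs m"
    using a m padic_integers_add[OF padic_integers_add[OF a(2) int(1)] int(2)]
    by (simp add: padic_abs_mult padic_integers_iff mult_left_le_one_le)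
  also have "\<dots> < padic_abs (m ^ 2)" using m by (simp add: power2_eq_square padic_abs_mult)
  finally have "padic_abs (m ^ 2 + (a1 * m - (a2 + x1 + x2))) = padic_abs (m ^ 2)"
    by (rule padic_abs_add_eq)
  also have "\<dots> > 1" using m by (simp add: padic_abs_power one_less_power)
  finally have "m ^ 2 + a1 * m - a2 - x1 - x2 \<notin> padic_integers"
    by (simp add: padic_integers_iff algebra_simps)
  thus ?thesis using neq by (simp add: W Let_def m_def)
qed

text \<open>If the \<open>x\<close>-coordinates agree modulo \<open>p\<close>, then
  \<open>P2\<close> reduces to the reduction of \<open>P1\<close> or of \<open>- P1\<close>. These
  differ as \<open>beta1\<close> is a unit, so the chord from \<open>P2\<close> to the other one has
  nonintegral slope and \<open>P2 - P1\<close> or \<open>P2 + P1\<close> reduces to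
  infinity.\<close>

lemma reduced_x_distinct:
  fixes E :: "'p :: prime_card padic weierstrass"
  assumes E: "set_weierstrass E \<subseteq> padic_integers"
    and int: "x1 \<in> padic_integers" "x2 \<in> padic_integers" "y1 \<in> padic_integers" "y2 \<in> padic_integers"
    and P1: "weierstrass_poly E x1 y1 = 0" and P2: "weierstrass_poly E x2 y2 = 0"
    and b: "padic_residue (2 * y1 + wa1 E * x1 + wa3 E) \<noteq> 0"
    and add: "reduce_point (point_add E (Point x2 y2) (Point x1 y1)) \<noteq> Infinity"
    and diff: "reduce_point (point_add E (Point x2 y2) (point_neg E (Point x1 y1))) \<noteq> Infinity"
  shows "padic_abs (x1 - x2) = 1"
proof (rule ccontr)
  assume "padic_abs (x1 - x2) \<noteq> 1"
  hence x: "padic_abs (x1 - x2) < 1"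
    using padic_integers_diff[OF int(1,2)] by (simp add: padic_integers_iff)
  obtain a1 a2 a3 a4 a6 where W: "E = Weierstrass a1 a2 a3 a4 a6" by (cases E)
  have a: "a1 \<in> padic_integers" "a2 \<in> padic_integers" "a3 \<in> padic_integers"
    "a4 \<in> padic_integers" "a6 \<in> padic_integers" using E by (auto simp: W)
  note mem = int a padic_integers_add padic_integers_mult padic_integers_power padic_integers_diff
    padic_integers_minus
  \<comment> \<open>The \<open>y\<close>-coordinate of \<open>- P1\<close>.\<close>
  define n where "n = - y1 - a1 * x1 - a3"
  have n: "n \<in> padic_integers" by (simp add: n_def mem)
  have rx: "padic_residue x2 = padic_residue x1"
    using padic_residue_eq_0_iff[OF padic_integers_diff[OF int(1,2)]] x int by simp
  have "padic_residue y1 - padic_residue n = padic_residue (2 * y1 + wa1 E * x1 + wa3 E)"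
    by (simp add: W n_def mem)
  hence rb: "padic_residue y1 \<noteq> padic_residue n" using b by auto
  \<comment> \<open>Modulo \<open>x2 - x1\<close> the curve equation factors with the roots
    \<open>y1\<close> and \<open>n\<close>.\<close>
  have "(y2 - y1) * (y2 - n) = weierstrass_poly E x2 y2 - weierstrass_poly E x1 y1
      + (x2 - x1) * (x2 ^ 2 + x1 * x2 + x1 ^ 2 + a2 * (x1 + x2) + a4 - a1 * y2)"
    by (simp add: W weierstrass_poly_def n_def power2_eq_square power3_eq_cube algebra_simps)
  hence "padic_residue ((y2 - y1) * (y2 - n))
      = padic_residue ((x2 - x1) * (x2 ^ 2 + x1 * x2 + x1 ^ 2 + a2 * (x1 + x2) + a4 - a1 * y2))"
    using P1 P2 by simp
  hence "(padic_residue y2 - padic_residue y1) * (padic_residue y2 - padic_residue n) = 0"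
    by (simp add: mem n rx)
  hence disj: "padic_residue y2 = padic_residue y1 \<or> padic_residue y2 = padic_residue n" by simp
  have unit: "padic_abs (u - w) = 1" if "u \<in> padic_integers" "w \<in> padic_integers"
    "padic_residue u \<noteq> padic_residue w" for u w :: "'p padic"
    using that by (intro padic_abs_eq_1) (simp_all add: padic_integers_diff)
  show False
  proof (cases "x1 = x2")
    case True
    have "(y2 - y1) * (y2 - n) = 0"
      using P1 P2 True by (simp add: W weierstrass_poly_def n_def power2_eq_square algebra_simps)
    hence "y2 = y1 \<or> y2 = n" by simp
    thus False
    proof
      assume "y2 = y1"
      thus False using diff True by (simp add: W)
    next
      assume "y2 = n"
      thus False using add True by (simp add: W n_def)
    qed
  next
    case False
    from disj show False
    proof
      assume "padic_residue y2 = padic_residue y1"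
      hence "reduce_point (point_add E (Point x2 y2) (Point x1 n)) = Infinity"
        using False x rb int n by (intro reduce_chord[OF E] unit) auto
      thus False using diff by (simp add: W n_def)
    next
      assume "padic_residue y2 = padic_residue n"
      hence "reduce_point (point_add E (Point x2 y2) (Point x1 y1)) = Infinity"
        using False x rb int n by (intro reduce_chord[OF E] unit) auto
      thus False using add by simp
    qed
  qed
qed

section \<open>Specialization of \<open>R^*\<close> to integral points\<close>

lemma specialization_props:
  fixes E :: "'a :: field weierstrass"
  assumes "weierstrass_poly E x1 y1 = 0" "weierstrass_poly E x2 y2 = 0" "x1 \<noteq> x2"
  defines "h \<equiv> specialization E (Point x1 y1) (Point x2 y2)"
  shows "comm_ring_hom h"
    and "map_weierstrass (\<lambda>v. h (rvar v)) (Weierstrass Ua1 Ua2 Ua3 Ua4 Ua6) = E"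
    and "h (rvar Ux1) = x1" "h (rvar Uy1) = y1" "h (rvar Ux2) = x2" "h (rvar Uy2) = y2"
  using theI'[OF specialization_unique[OF assms(1-3)]]
  unfolding h_def specialization_def by auto

text \<open>Every element of \<open>R^*\<close> is a polynomial in the generators divided by a power
  of \<open>x1 - x2\<close>, which goes to a unit.\<close>

lemma rstar_hom_integral:
  fixes h :: "rstar \<Rightarrow> 'p :: prime_card padic"
  assumes hom: "comm_ring_hom h" and var: "\<And>v. h (rvar v) \<in> padic_integers"
    and unit: "padic_abs (h r_u) = 1"
  shows "h r \<in> padic_integers"
proof -
  interpret h: comm_ring_hom h by (rule hom)
  interpret R: comm_ring_hom rstar_of_poly by (rule comm_ring_hom_rstar_of_poly)
  have poly: "h (rstar_of_poly F) \<in> padic_integers" for F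
  proof (induction F rule: upoly_closure_induct)
    case (var v)
    thus ?case using assms(2)[of v] by (simp add: rvar_eq)
  qed (simp_all add: R.hom_of_int h.hom_of_int R.hom_add h.hom_add R.hom_mult h.hom_mult
      padic_integers_add padic_integers_mult)
  obtain F k where "r * rstar_of_poly dx_poly ^ k = rstar_of_poly F" by (rule rstar_cases)
  hence "h r * h r_u ^ k = h (rstar_of_poly F)"
    by (simp only: r_u_eq h.hom_mult[symmetric] h.hom_power[symmetric])
  from arg_cong[OF this, of padic_abs] show ?thesis
    using poly[of F] unit by (simp add: padic_integers_iff padic_abs_mult padic_abs_power)
qed

theorem theorem1p3:
  fixes E :: "'p :: prime_card padic weierstrass"
    and P1 P2 :: "'p padic point"
    and p r :: nat
  assumes "p = CARD('p)" and "odd p"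
    and "elliptic_curve E"
    and "set_weierstrass E \<subseteq> padic_integers"
    and "P1 \<in> curve_points E" and "P2 \<in> curve_points E"
    and "reduce_point P1 \<in> nonsingular_points (reduce_curve E)"
    and "has_point_order (reduce_curve E) (reduce_point P1) r"
    and "r > 3"
    and "reduce_point P2 \<noteq> Infinity"
    and "reduce_point (point_add E P2 P1) \<noteq> Infinity"
    and "reduce_point (point_add E P2 (point_neg E P1)) \<noteq> Infinity"
    and "\<not> p dvd r"
  shows "\<exists>N\<ge>1. \<exists>q. q = p ^ N \<and> (\<forall>m\<ge>1.
           (\<exists>L\<in>padic_integers. (\<lambda>i. value_at E P1 P2 (Psi (int (m * q ^ i)))) \<longlonglongrightarrow> L) \<and>
           (\<exists>L\<in>padic_integers. (\<lambda>i. value_at E P1 P2 (Phi (int (m * q ^ i)))) \<longlonglongrightarrow> L) \<and>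
           (\<exists>L\<in>padic_integers. (\<lambda>i. value_at E P1 P2 (Omega (int (m * q ^ i)))) \<longlonglongrightarrow> L))"
proof -
  note E = assms(4)
  have "point_mult (reduce_curve E) 1 (reduce_point P1) \<noteq> Infinity"
    using assms(8,9) by (auto simp: has_point_order_def)
  hence "reduce_point P1 \<noteq> Infinity" by (auto simp: point_mult_def)
  then obtain x1 y1 where P1: "P1 = Point x1 y1" and x1: "x1 \<in> padic_integers"
    by (cases P1) (auto split: if_splits)
  obtain x2 y2 where P2: "P2 = Point x2 y2" and x2: "x2 \<in> padic_integers"
    using assms(10) by (cases P2) (auto split: if_splits)
  have eq1: "weierstrass_poly E x1 y1 = 0" and eq2: "weierstrass_poly E x2 y2 = 0"
    using assms(5,6) by (auto simp: P1 P2 curve_points_def)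
  have y1: "y1 \<in> padic_integers" and y2: "y2 \<in> padic_integers"
    by (rule weierstrass_y_integral[OF E x1 eq1], rule weierstrass_y_integral[OF E x2 eq2])
  obtain a1 a2 a3 a4 a6 where W: "E = Weierstrass a1 a2 a3 a4 a6" by (cases E)
  have a: "a1 \<in> padic_integers" "a2 \<in> padic_integers" "a3 \<in> padic_integers"
    "a4 \<in> padic_integers" "a6 \<in> padic_integers" using E by (auto simp: W)
  note mem = x1 x2 y1 y2 a padic_integers_add padic_integers_mult padic_integers_power
    padic_integers_diff padic_integers_minus
  define b where "b = 2 * y1 + wa1 E * x1 + wa3 E"
  define beta where "beta = 3 * x1 ^ 4 + wb2 E * x1 ^ 3 + 3 * wb4 E * x1 ^ 2 + 3 * wb6 E * x1 + wb8 E"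
  have bint: "b \<in> padic_integers" "beta \<in> padic_integers"
    by (simp_all add: b_def beta_def W wb2_def wb4_def wb6_def wb8_def mem)
  have "weierstrass_poly (reduce_curve E) (padic_residue x1) (padic_residue y1) = 0"
    by (simp add: reduce_curve_poly[OF E x1 y1] eq1)
  \<comment> \<open>Reduction sends \<open>b\<close> and \<open>beta\<close> to the corresponding
    quantities of the reduced curve.\<close>
  from point_order_gt_3[OF this _ assms(9)] assms(8) x1
  have nz: "padic_residue b \<noteq> 0" "padic_residue beta \<noteq> 0"
    by (simp_all add: P1 b_def beta_def W reduce_curve_def wb2_def wb4_def wb6_def wb8_def mem)
  have dx: "padic_abs (x1 - x2) = 1"
    using reduced_x_distinct[OF E x1 x2 y1 y2 eq1 eq2] nz(1) assms(11,12)
    unfolding P1 P2 b_def by blast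
  hence neq: "x1 \<noteq> x2" by auto
  define h where "h = specialization E P1 P2"
  note props = specialization_props[OF eq1 eq2 neq, folded P1 P2, folded h_def]
  interpret h: comm_ring_hom h by (rule props(1))
  have ha: "h (rvar Ua1) = a1" "h (rvar Ua2) = a2" "h (rvar Ua3) = a3" "h (rvar Ua4) = a4" "h (rvar Ua6) = a6"
    using props(2) by (simp_all add: W)
  have hnum: "h (numeral k) = numeral k" for k using h.hom_of_int[of "numeral k"] by simp
  have "h (rvar v) \<in> padic_integers" for v by (cases v) (simp_all add: props ha mem)
  hence int: "h s \<in> padic_integers" for s
    by (rule rstar_hom_integral[OF props(1)]) (simp add: r_u_def h.hom_minus props dx)
  have hb: "h r_b = b" by (simp add: r_b_def b_def W h.hom_add h.hom_mult hnum props ha)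
  have hbeta: "h r_beta2 = beta"
    by (simp add: r_beta2_def beta_def W r_curve_def wb2_def wb4_def wb6_def wb8_def
        h.hom_add h.hom_mult h.hom_minus h.hom_power hnum props ha)
  define f where "f = (\<lambda>n. h (r_net n))"
  \<comment> \<open>Since \<open>k\<close> lies in \<open>R^*\<close>, its image under
    \<open>h\<close> is integral.\<close>
  obtain k where k: "somos5 (- r_beta2) k r_net" using somos5_r_net by blast
  have s4: "somos4 (b ^ 2) (- beta) f"
    using somos4_hom[OF props(1) somos4_r_net] by (simp add: f_def h.hom_power h.hom_uminus hb hbeta)
  have s5: "somos5 (- beta) (h k) f"
    using somos5_hom[OF props(1) k] by (simp add: f_def h.hom_uminus hbeta)
  obtain M where M: "M > 0"
    "\<And>l n. padic_abs (f (n + int (M * CARD('p) ^ l)) - f n) \<le> (1 / real CARD('p)) ^ Suc l"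
    by (rule somos_padic_periodic[OF s4 s5]) (use nz bint int in \<open>auto simp: f_def mem r_net_init\<close>)
  have cont: "Mp_continuous M f"
    by (rule Mp_continuousI[OF _ M(2)]) (simp add: f_def int)
  note cont_intros = Mp_continuous_mult Mp_continuous_diff
    Mp_continuous_add Mp_continuous_power Mp_continuous_const
  have shift: "Mp_continuous M (\<lambda>n. f (n + 1))" "Mp_continuous M (\<lambda>n. f (n + 2))"
    "Mp_continuous M (\<lambda>n. f (n - 1))" "Mp_continuous M (\<lambda>n. f (n - 2))"
    using Mp_continuous_shift[OF cont, of 1] Mp_continuous_shift[OF cont, of 2]
      Mp_continuous_shift[OF cont, of "-1"] Mp_continuous_shift[OF cont, of "-2"]
    by simp_all
  have contPhi: "Mp_continuous M (\<lambda>n. h (r_Phi n))"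
  proof -
    have "h (r_Phi n) = x1 * f n ^ 2 - f (n + 1) * f (n - 1)" for n
      by (simp add: r_Phi_def f_def h.hom_minus h.hom_mult h.hom_power props)
    moreover have "Mp_continuous M (\<lambda>n. x1 * f n ^ 2 - f (n + 1) * f (n - 1))"
      by (intro cont_intros cont shift x1)
    ultimately show ?thesis by simp
  qed
  have contOmega: "Mp_continuous M (\<lambda>n. h (r_Omega n))"
  proof -
    \<comment> \<open>As \<open>p\<close> is odd, \<open>2 * b\<close> is a unit, and the
      denominator of \<open>Omega\<close> becomes an integral constant factor.\<close>
    have "\<not> int CARD('p) dvd 2"
    proof
      assume "int CARD('p) dvd 2"
      hence "int CARD('p) \<le> 2" by (rule zdvd_imp_le) simp
      hence "CARD('p) = 2" using prime_gt_1_nat[OF prime_card[where 'a = 'p]] by linarith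
      thus False using assms(1,2) by simp
    qed
    hence "padic_abs (of_int 2 :: 'p padic) = 1"
      using padic_abs_of_int_less_1_iff[of 2, where ?'p = 'p] padic_abs_of_int_le_1[of 2, where ?'p = 'p]
      by linarith
    hence abs: "padic_abs (2 * b) = 1" using padic_abs_eq_1[OF bint(1) nz(1)] by (simp add: padic_abs_mult)
    hence inv: "inverse (2 * b) \<in> padic_integers" and nz': "2 * b \<noteq> 0"
      by (simp_all only: padic_integers_iff padic_abs_inverse) auto
    have "h (r_Omega n) = inverse (2 * b) * (f (n - 1) ^ 2 * f (n + 2) - f (n - 2) * f (n + 1) ^ 2
        - b * f n * (a1 * h (r_Phi n) + a3 * f n ^ 2))" for n
    proof -
      have "2 * b * h (r_Omega n) = h (r_Omega_numerator n)"
        by (simp add: r_Omega h.hom_mult hnum hb)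
      also have "\<dots> = f (n - 1) ^ 2 * f (n + 2) - f (n - 2) * f (n + 1) ^ 2
          - b * f n * (a1 * h (r_Phi n) + a3 * f n ^ 2)"
        by (simp add: r_Omega_numerator_def h.hom_mult h.hom_minus h.hom_add h.hom_power hb ha f_def)
      finally show ?thesis using nz' by (simp add: field_simps)
    qed
    moreover have "Mp_continuous M (\<lambda>n. inverse (2 * b) *
        (f (n - 1) ^ 2 * f (n + 2) - f (n - 2) * f (n + 1) ^ 2
        - b * f n * (a1 * h (r_Phi n) + a3 * f n ^ 2)))"
      by (intro cont_intros cont shift contPhi inv bint a)
    ultimately show ?thesis by (simp only:)
  qed
  \<comment> \<open>One \<open>N\<close> serves for all three sequences and all
    \<open>m\<close>.\<close>
  obtain N where N: "N \<ge> 1" "\<forall>(g :: int \<Rightarrow> 'p padic) m. Mp_continuous M g \<longrightarrow>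
      (\<exists>L\<in>padic_integers. (\<lambda>i. g (int (m * (p ^ N) ^ i))) \<longlonglongrightarrow> L)"
    using Mp_continuous_limit[OF assms(1) M(1)] by blast
  hence lim: "\<exists>L\<in>padic_integers. (\<lambda>i. g (int (m * (p ^ N) ^ i))) \<longlonglongrightarrow> L"
    if "Mp_continuous M g" for g :: "int \<Rightarrow> 'p padic" and m using that by blast
  have vals: "value_at E P1 P2 (Psi n) = f n" "value_at E P1 P2 (Phi n) = h (r_Phi n)"
    "value_at E P1 P2 (Omega n) = h (r_Omega n)" for n
    by (simp_all add: Psi_eq_r_net Phi_eq Omega_eq value_at_to_fract f_def h_def)
  show ?thesis
    unfolding vals
    by (intro exI[of _ N] conjI exI[of _ "p ^ N"] allI impI refl N(1)
        lim[OF cont] lim[OF contPhi] lim[OF contOmega])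
qed

end
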